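(* Let $l,m$ be vectors of non-negative integers in dimension $d$ and $V>0$. Assume $\gamma,\gamma_n\in S^{*}_{l,m}(V)$ for $n=1,2,\dots$, and let $\phi$ be a continuous regular function that has continuous derivatives $\partial^{l_i}\phi$ for all subvectors $l_i$ of $l$. Let $\varepsilon=\gamma\phi$ and $\varepsilon_n=\gamma_n\phi$, $n=1,2,\dots$ (products in $S^{*}$), and suppose $\varepsilon_n-\varepsilon\to0$ in $S^{*}$. Put $g=Ft^{-1}(\gamma)$. If $\phi^{-1}$ and all $\partial^{l_i}(\phi^{-1})$, for every subvector $l_i$ of $l$, satisfy the polynomial growth condition $(\mathrm{PG})$, then $\varepsilon_n\phi^{-1}$ exists in $S^{*}$ and $$Ft^{-1}(\varepsilon_n\phi^{-1})\to g\quad\text{in } S^{*}.$$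
   Context: $S$ is the Schwartz space on $\mathbb{R}^d$, $S^{*}$ its dual (tempered distributions) with weak convergence: $b_n\to b$ iff $(b_n,\psi)\to(b,\psi)$ for all $\psi\in S$. $Ft$ is the Fourier transform on $S^{*}$, normalized so that $Ft(b)(s)=\int b(x)e^{ix^Ts}dx$ for integrable $b$. For a vector $m$ write $((1+t^2)^{-1})^m=\prod_{i=1}^d(1+t_i^2)^{-m_i}$ and $(1+x^2)^{m/2}=\prod_{i=1}^d(1+x_i^2)^{m_i/2}$. $\partial^l=\frac{\partial^{l_1}}{\partial x_1^{l_1}}\cdots\frac{\partial^{l_d}}{\partial x_d^{l_d}}$ (in the generalized sense). A subvector $l_i$ of $l$ is a vector of non-negative integers that is componentwise at most $l$. $S^{*}_{l,m}(V)$ is the set of $b\in S^{*}$ that can be written $b=\partial^l c$ with $c(x)=(1+x^2)^{m/2}\tilde c(x)$, $\tilde c$ continuous and $|\tilde c(x)|<V$ on $\mathbb{R}^d$. Condition $(\mathrm{PG})$ for a locally summable function $b$: there is a vector $m$ of non-negative integers with $\int((1+t^2)^{-1})^m|b(t)|\,dt<\infty$. For $b=\partial^l c$ with $c$ continuous and a function $\chi$ with continuous derivatives of all orders that are subvectors of $l$, the product $b\chi$ is the generalized function $(b\chi,\psi)=(-1)^{l_1+\cdots+l_d}(c,\partial^l(\chi\psi))$. *)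

theory Defs
  imports "HOL-Analysis.Analysis"
begin

section \<open>Multi-indices and derivatives\<close>

text \<open>The coordinates of \<open>real ^ 'd\<close> are indexed by a finite linearly ordered type, so that
  \<open>mderiv k f\<close> below is \<open>\<partial>\<^sub>1\<^bsup>k\<^sub>1\<^esup> (\<partial>\<^sub>2\<^bsup>k\<^sub>2\<^esup> (\<dots> (\<partial>\<^sub>d\<^bsup>k\<^sub>d\<^esup> f)))\<close>. Multi-indices are functions \<open>'d \<Rightarrow> nat\<close>;
  a subvector of \<open>l\<close> is some \<open>k \<le> l\<close> in the pointwise order.\<close>

type_synonym 'd cfun = "real ^ 'd \<Rightarrow> complex"

definition pderiv1 :: "'d::finite \<Rightarrow> 'd cfun \<Rightarrow> 'd cfun" where
  "pderiv1 i f = (\<lambda>x. vector_derivative (\<lambda>t. f (x + t *\<^sub>R axis i 1)) (at 0))"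

definition mderiv :: "('d::{finite,linorder} \<Rightarrow> nat) \<Rightarrow> 'd cfun \<Rightarrow> 'd cfun" where
  "mderiv k f = foldr (\<lambda>i. pderiv1 i ^^ k i) (sorted_list_of_set UNIV) f"

text \<open>Since \<open>vector_derivative\<close> is total, existence of the derivatives is stated explicitly.
  The second conjunct also says that the order of differentiation is irrelevant; given the
  continuity of all \<open>mderiv k f\<close> with \<open>k \<le> l\<close>, this is Schwarz's theorem.\<close>

definition cont_derivs :: "('d::{finite,linorder} \<Rightarrow> nat) \<Rightarrow> 'd cfun \<Rightarrow> bool" where
  "cont_derivs l f \<longleftrightarrow>
     (\<forall>k\<le>l. continuous_on UNIV (mderiv k f)) \<and>
     (\<forall>k i x. k(i := Suc (k i)) \<le> l \<longrightarrow>
        ((\<lambda>t. mderiv k f (x + t *\<^sub>R axis i 1)) has_vector_derivative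
           mderiv (k(i := Suc (k i))) f x) (at 0))"

definition smooth :: "'d::{finite,linorder} cfun \<Rightarrow> bool" where
  "smooth f \<longleftrightarrow> (\<forall>l. cont_derivs l f)"


section \<open>Test functions and tempered distributions\<close>

definition monomial :: "('d::finite \<Rightarrow> nat) \<Rightarrow> real ^ 'd \<Rightarrow> complex" where
  "monomial a x = complex_of_real (\<Prod>i\<in>UNIV. (x $ i) ^ a i)"

definition schwartz :: "'d::{finite,linorder} cfun set" where
  "schwartz = {\<psi>. smooth \<psi> \<and> (\<forall>a k. bounded (range (\<lambda>x. monomial a x * mderiv k \<psi> x)))}"

definition schwartz_tendsto :: "(nat \<Rightarrow> 'd::{finite,linorder} cfun) \<Rightarrow> 'd cfun \<Rightarrow> bool" where
  "schwartz_tendsto \<psi>s \<psi> \<longleftrightarrow>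
     (\<forall>n. \<psi>s n \<in> schwartz) \<and> \<psi> \<in> schwartz \<and>
     (\<forall>a k. uniform_limit UNIV (\<lambda>n x. monomial a x * mderiv k (\<psi>s n) x)
                               (\<lambda>x. monomial a x * mderiv k \<psi> x) sequentially)"

definition test_functions :: "'d::{finite,linorder} cfun set" where
  "test_functions = {\<psi>. smooth \<psi> \<and> (\<exists>K. compact K \<and> (\<forall>x. x \<notin> K \<longrightarrow> \<psi> x = 0))}"

text \<open>Elements of the dual of \<open>schwartz\<close>. As the Schwartz space is metrizable, continuity is
  sequential continuity. Functionals are normalized to \<open>0\<close> outside \<open>schwartz\<close>, so that
  equality of tempered distributions is equality of HOL functions.\<close>

type_synonym 'd functional = "'d cfun \<Rightarrow> complex"

definition tempered :: "'d::{finite,linorder} functional set" where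
  "tempered = {b.
     (\<forall>\<psi>\<in>schwartz. \<forall>\<eta>\<in>schwartz. b (\<lambda>x. \<psi> x + \<eta> x) = b \<psi> + b \<eta>) \<and>
     (\<forall>\<psi>\<in>schwartz. \<forall>a. b (\<lambda>x. a * \<psi> x) = a * b \<psi>) \<and>
     (\<forall>\<psi>s \<psi>. schwartz_tendsto \<psi>s \<psi> \<longrightarrow> (\<lambda>n. b (\<psi>s n)) \<longlonglongrightarrow> b \<psi>) \<and>
     (\<forall>\<psi>. \<psi> \<notin> schwartz \<longrightarrow> b \<psi> = 0)}"

definition tempered_tendsto ::
    "(nat \<Rightarrow> 'd::{finite,linorder} functional) \<Rightarrow> 'd functional \<Rightarrow> bool" where
  "tempered_tendsto bs b \<longleftrightarrow>
     (\<forall>n. bs n \<in> tempered) \<and> b \<in> tempered \<and> (\<forall>\<psi>\<in>schwartz. (\<lambda>n. bs n \<psi>) \<longlonglongrightarrow> b \<psi>)"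


section \<open>Fourier transform\<close>

definition fourier :: "'d::finite cfun \<Rightarrow> 'd cfun" where
  "fourier \<psi> s = (LINT x|lborel. \<psi> x * exp (\<i> * complex_of_real (x \<bullet> s)))"

text \<open>By Fubini, \<open>\<integral> Ft(b) \<psi> = \<integral> b Ft(\<psi>)\<close> for integrable \<open>b\<close>, whence the transpose below.\<close>

definition Ft :: "'d::{finite,linorder} functional \<Rightarrow> 'd functional" where
  "Ft b = (\<lambda>\<psi>. if \<psi> \<in> schwartz then b (fourier \<psi>) else 0)"

definition Ft_inv :: "'d::{finite,linorder} functional \<Rightarrow> 'd functional" where
  "Ft_inv = inv_into tempered Ft"


section \<open>Growth conditions\<close>

definition locally_summable :: "'d::finite cfun \<Rightarrow> bool" where
  "locally_summable b \<longleftrightarrow> (\<forall>K. compact K \<longrightarrow> set_integrable lborel K b)"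

text \<open>A regular function is one that defines a generalized function by integration against
  compactly supported test functions; no growth at infinity is prescribed.\<close>

definition regular_function :: "'d::finite cfun \<Rightarrow> bool" where
  "regular_function b \<longleftrightarrow> locally_summable b"

definition PG :: "'d::finite cfun \<Rightarrow> bool" where
  "PG b \<longleftrightarrow> locally_summable b \<and>
     (\<exists>m :: 'd \<Rightarrow> nat. integrable lborel (\<lambda>t. (\<Prod>i\<in>UNIV. inverse (1 + (t $ i)\<^sup>2) ^ m i) * norm (b t)))"


section \<open>Generalized derivatives and products\<close>

text \<open>\<open>gderiv l c \<psi>\<close> is the value of the generalized derivative \<open>\<partial>\<^sup>l c\<close> at \<open>\<psi>\<close>.\<close>

definition gderiv :: "('d::{finite,linorder} \<Rightarrow> nat) \<Rightarrow> 'd cfun \<Rightarrow> 'd functional" where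
  "gderiv l c \<psi> = (- 1) ^ (\<Sum>i\<in>UNIV. l i) * (LINT x|lborel. c x * mderiv l \<psi> x)"

definition Slm ::
    "('d::{finite,linorder} \<Rightarrow> nat) \<Rightarrow> ('d \<Rightarrow> nat) \<Rightarrow> real \<Rightarrow> 'd functional set" where
  "Slm l m V = {b \<in> tempered. \<exists>c c'.
     (\<forall>x. c x = complex_of_real (\<Prod>i\<in>UNIV. (1 + (x $ i)\<^sup>2) powr (real (m i) / 2)) * c' x) \<and>
     continuous_on UNIV c' \<and> (\<forall>x. norm (c' x) < V) \<and>
     (\<forall>\<psi>\<in>schwartz. b \<psi> = gderiv l c \<psi>)}"

text \<open>\<open>is_product l b h p\<close>: for some representation \<open>b = \<partial>\<^sup>l c\<close> with \<open>c\<close> continuous, \<open>p\<close> is a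
  tempered distribution with \<open>(p, \<psi>) = (-1)\<^bsup>|l|\<^esup> (c, \<partial>\<^sup>l (h \<psi>))\<close>. No growth is imposed on \<open>c\<close> and
  \<open>h\<close>, so the integral makes sense for compactly supported \<open>\<psi>\<close>: it gives a generalized function,
  and the product exists in the space of tempered distributions if that generalized function is
  tempered. Such a \<open>p\<close> is unique: the formula does not depend on the choice of \<open>c\<close>, and
  \<open>test_functions\<close> is dense in \<open>schwartz\<close>.\<close>

definition is_product ::
    "('d::{finite,linorder} \<Rightarrow> nat) \<Rightarrow> 'd functional \<Rightarrow> 'd cfun \<Rightarrow> 'd functional \<Rightarrow> bool" where
  "is_product l b h p \<longleftrightarrow> p \<in> tempered \<and> cont_derivs l h \<and>
     (\<exists>c. continuous_on UNIV c \<and>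
          (\<forall>\<psi>\<in>test_functions. b \<psi> = gderiv l c \<psi>) \<and>
          (\<forall>\<psi>\<in>test_functions. p \<psi> =
             (- 1) ^ (\<Sum>i\<in>UNIV. l i) * (LINT x|lborel. c x * mderiv l (\<lambda>y. h y * \<psi> y) x)))"

definition product_exists ::
    "('d::{finite,linorder} \<Rightarrow> nat) \<Rightarrow> 'd functional \<Rightarrow> 'd cfun \<Rightarrow> bool" where
  "product_exists l b h \<longleftrightarrow> (\<exists>p. is_product l b h p)"

definition product_of ::
    "('d::{finite,linorder} \<Rightarrow> nat) \<Rightarrow> 'd functional \<Rightarrow> 'd cfun \<Rightarrow> 'd functional" where
  "product_of l b h = (THE p. is_product l b h p)"

end

theory Submission
  imports Defs "HOL-Probability.Characteristic_Functions" "HOL-Probability.Sinc_Integral"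
begin

text \<open>The product \<open>\<epsilon>\<^sub>n \<phi>\<^sup>-\<^sup>1\<close> is \<open>\<gamma>\<^sub>n\<close>: by partial integration \<open>\<epsilon>\<^sub>n = \<phi> \<partial>\<^sup>l c\<^sub>n\<close> is again \<open>\<partial>\<^sup>l e\<^sub>n\<close> with
  \<open>e\<^sub>n\<close> continuous, and mollification shows that products do not depend on the representing continuous
  function. Hence it suffices that \<open>\<gamma>\<^sub>n\<close> tends to \<open>\<gamma>\<close>. Formally \<open>\<gamma>\<^sub>n \<psi> = \<epsilon>\<^sub>n (\<phi>\<^sup>-\<^sup>1 \<psi>)\<close>, but \<open>\<phi>\<^sup>-\<^sup>1 \<psi>\<close> is only of
  class \<open>C\<^sup>l\<close>. The common bound on the \<open>c\<^sub>n\<close> makes the \<open>\<gamma>\<^sub>n\<close> equicontinuous, so that \<open>\<phi>\<^sup>-\<^sup>1 \<psi>\<close> may be replaced by a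
  mollification, and then a Schwartz function \<open>\<psi>\<close> by test functions. Finally the inverse Fourier transform
  on tempered distributions is the transpose of the inverse Fourier transform on the Schwartz space,
  where the inversion formula follows by Gaussian regularization.\<close>

section \<open>Multi-index calculus\<close>

text \<open>\<open>mderiv\<close> iterates a total operator in one fixed order, so its values mean
  nothing until differentiability is known. Every regularity claim is therefore made by exhibiting
  all derivatives at once, as a family \<open>D k\<close> linked by \<open>has_pderiv\<close>; this
  is also why the bumps come with closed formulas for all their derivatives. Closed multi-index
  formulas for products and reciprocals are avoided: one first derivative is split off at a time and
  induction over multi-indices does the rest. Test functions are treated before Schwartz functions
  because \<open>inverse (\<phi> x) * \<psi> x\<close> then has compact support, so that only values
  of \<open>\<phi>\<close> and its derivatives on a compact set enter the estimates. The passage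
  from smooth to C^l functions is used twice: for the convergence, and for the uniqueness that the
  definite description in \<open>product_of\<close> requires. \<open>Ft_inv\<close> picks some
  preimage under \<open>Ft\<close>. Its values become computable once \<open>fourier\<close> is
  known to be a bijection of the Schwartz space with an explicit continuous inverse.\<close>

definition inc :: "'d \<Rightarrow> ('d \<Rightarrow> nat) \<Rightarrow> 'd \<Rightarrow> nat" where
  "inc i k = k(i := Suc (k i))"

definition dec :: "'d \<Rightarrow> ('d \<Rightarrow> nat) \<Rightarrow> 'd \<Rightarrow> nat" where
  "dec i k = k(i := k i - 1)"

lemma inc_apply: "inc i k j = (if j = i then Suc (k j) else k j)"
  by (simp add: inc_def)

lemma inc_same [simp]: "inc i k i = Suc (k i)"
  by (simp add: inc_def)

lemma dec_apply: "dec i k j = (if j = i then k j - 1 else k j)"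
  by (simp add: dec_def)

lemma dec_inc [simp]: "dec i (inc i k) = k"
  by (auto simp: fun_eq_iff inc_apply dec_apply)

lemma inc_dec [simp]: "0 < k i \<Longrightarrow> inc i (dec i k) = k"
  by (auto simp: fun_eq_iff inc_apply dec_apply)

abbreviation mdegree :: "('d::finite \<Rightarrow> nat) \<Rightarrow> nat" where
  "mdegree k \<equiv> \<Sum>i\<in>UNIV. k i"

abbreviation zero_index :: "'d \<Rightarrow> nat" where
  "zero_index \<equiv> \<lambda>_. 0"

lemma multiindex_induct [case_names zero inc]:
  fixes k :: "'d::finite \<Rightarrow> nat"
  assumes "P zero_index" and "\<And>k i. P k \<Longrightarrow> P (inc i k)"
  shows "P k"
proof (induction "\<Sum>i\<in>UNIV. k i" arbitrary: k)
  case 0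
  then have "k = zero_index" by auto
  then show ?case using assms(1) by simp
next
  case (Suc n)
  then have "\<not> (\<forall>i\<in>UNIV. k i = 0)" by (metis sum.neutral nat.distinct(1))
  then obtain i where i: "k i > 0" by auto
  have "sum k UNIV = k i + sum k (UNIV - {i})"
    by (simp add: sum.remove)
  moreover have "sum (dec i k) UNIV = dec i k i + sum (dec i k) (UNIV - {i})"
    by (rule sum.remove) auto
  moreover have "sum (dec i k) (UNIV - {i}) = sum k (UNIV - {i})"
    by (rule sum.cong) (auto simp: dec_apply)
  ultimately have "sum (dec i k) UNIV = n"
    using Suc.hyps(2) i by (simp add: dec_apply)
  then have "P (dec i k)" using Suc.hyps(1) by metis
  then have "P (inc i (dec i k))" by (rule assms(2))
  then show ?case using i by simp
qed

lemma inc_le_inc: "k \<le> l \<Longrightarrow> inc i k \<le> inc i l"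
  by (simp add: le_fun_def inc_apply dec_apply)

lemma le_inc: "k \<le> inc i k"
  by (simp add: le_fun_def inc_apply dec_apply)

lemma dec_le: "dec i k \<le> k"
  by (simp add: le_fun_def inc_apply dec_apply)

lemma inc_commute: "inc i (inc j k) = inc j (inc i k)"
  by (rule ext) (auto simp: inc_apply)

lemma le_incD: "inc i k \<le> l \<Longrightarrow> k \<le> l"
  by (rule order_trans[OF le_inc])

text \<open>Existence and value are combined in one relation because \<open>pderiv1\<close> is
  total. The derivative is asked for at parameter 0 only, but at every base point, which yields it
  along whole lines.\<close>

definition has_pderiv :: "'d::finite \<Rightarrow> 'd cfun \<Rightarrow> 'd cfun \<Rightarrow> bool" where
  "has_pderiv i f f' \<longleftrightarrow>
     (\<forall>x. ((\<lambda>t. f (x + t *\<^sub>R axis i 1)) has_vector_derivative f' x) (at 0))"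

lemma has_pderiv_imp_pderiv1: "has_pderiv i f f' \<Longrightarrow> pderiv1 i f = f'"
  unfolding has_pderiv_def pderiv1_def by (auto intro!: vector_derivative_at)

lemma has_pderiv_at:
  assumes "has_pderiv i f f'"
  shows "((\<lambda>t. f (x + t *\<^sub>R axis i 1)) has_vector_derivative f' (x + s *\<^sub>R axis i 1)) (at s within S)"
proof -
  have "((\<lambda>t. f ((x + s *\<^sub>R axis i 1) + t *\<^sub>R axis i 1)) has_vector_derivative f' (x + s *\<^sub>R axis i 1)) (at 0)"
    using assms by (simp add: has_pderiv_def)
  then have "((\<lambda>t. f ((x + s *\<^sub>R axis i 1) + t *\<^sub>R axis i 1)) has_vector_derivative f' (x + s *\<^sub>R axis i 1))
      (at (s - s))"
    by simp
  then have "(((\<lambda>t. f ((x + s *\<^sub>R axis i 1) + t *\<^sub>R axis i 1)) \<circ> (\<lambda>t. t - s)) has_vector_derivative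
      1 *\<^sub>R f' (x + s *\<^sub>R axis i 1)) (at s)"
    by (intro vector_diff_chain_at) (auto intro!: derivative_eq_intros)
  then show ?thesis
    by (auto simp: o_def algebra_simps intro: has_vector_derivative_at_within)
qed

lemma mderiv_zero [simp]: "mderiv zero_index f = f"
proof -
  have "foldr (\<lambda>i. pderiv1 i ^^ 0) xs f = f" for xs :: "'a list"
    by (induction xs) auto
  then show ?thesis by (simp add: mderiv_def)
qed

text \<open>Each \<open>pderiv1 i\<close> in the fold moves from \<open>D k\<close> to
  \<open>D (inc i k)\<close>, so a family closed under these single steps has to consist of the
  iterated derivatives of \<open>D zero_index\<close>.\<close>

lemma mderiv_family:
  fixes D :: "('d::{finite,linorder} \<Rightarrow> nat) \<Rightarrow> 'd cfun"
  assumes D: "\<And>k i. inc i k \<le> l \<Longrightarrow> has_pderiv i (D k) (D (inc i k))" and "k \<le> l"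
  shows "mderiv k (D zero_index) = D k"
proof -
  have power: "(pderiv1 i ^^ n) (D k') = D (k'(i := n))"
    if "k' i = 0" "k'(i := n) \<le> l" for i n k'
    using that(2)
  proof (induction n)
    case 0
    then show ?case using that(1) by (simp add: fun_upd_idem)
  next
    case (Suc n)
    have eq: "inc i (k'(i := n)) = k'(i := Suc n)" by (simp add: inc_def)
    have *: "inc i (k'(i := n)) \<le> l" unfolding eq by (rule Suc.prems)
    have "(pderiv1 i ^^ Suc n) (D k') = pderiv1 i ((pderiv1 i ^^ n) (D k'))"
      by (simp only: funpow.simps o_def)
    also have "(pderiv1 i ^^ n) (D k') = D (k'(i := n))"
      by (rule Suc.IH[OF le_incD[OF *]])
    also have "pderiv1 i \<dots> = D (inc i (k'(i := n)))"
      by (rule has_pderiv_imp_pderiv1[OF D[OF *]])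
    finally show ?case unfolding eq .
  qed
  \<comment> \<open>Invariant of the fold: coordinates already processed have reached their final
    exponent, the others are still at 0. All indices met stay below \<open>k\<close>, hence below
    \<open>l\<close>.\<close>
  have "foldr (\<lambda>i. pderiv1 i ^^ k i) xs (D zero_index) = D (\<lambda>i. if i \<in> set xs then k i else 0)"
    if "distinct xs" for xs
    using that
  proof (induction xs)
    case Nil
    then show ?case by simp
  next
    case (Cons j xs)
    let ?k = "\<lambda>i. if i \<in> set xs then k i else 0"
    have eq: "?k(j := k j) = (\<lambda>i. if i \<in> set (j # xs) then k i else 0)"
      by auto
    have le: "?k(j := k j) \<le> l"
      using \<open>k \<le> l\<close> by (auto simp: le_fun_def inc_apply)
    have "(pderiv1 j ^^ k j) (D ?k) = D (?k(j := k j))"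
      by (rule power) (use Cons.prems le in auto)
    then show ?case using Cons eq by simp
  qed
  from this[of "sorted_list_of_set UNIV"] show ?thesis
    by (simp add: mderiv_def)
qed

text \<open>The general way to obtain \<open>cont_derivs\<close>: guess all derivatives. Commutation
  comes for free, since a multi-index does not record the order of differentiation.\<close>

lemma cont_derivsI_family:
  fixes D :: "('d::{finite,linorder} \<Rightarrow> nat) \<Rightarrow> 'd cfun"
  assumes "D zero_index = f"
    and "\<And>k. k \<le> l \<Longrightarrow> continuous_on UNIV (D k)"
    and "\<And>k i. inc i k \<le> l \<Longrightarrow> has_pderiv i (D k) (D (inc i k))"
  shows "cont_derivs l f" and "\<And>k. k \<le> l \<Longrightarrow> mderiv k f = D k"
proof -
  show eq: "mderiv k f = D k" if "k \<le> l" for k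
    using mderiv_family[of l D k] assms that by simp
  show "cont_derivs l f"
    unfolding cont_derivs_def inc_def[symmetric]
  proof (intro conjI allI impI)
    show "continuous_on UNIV (mderiv k f)" if "k \<le> l" for k
      using assms(2) eq that by simp
    show "((\<lambda>t. mderiv k f (x + t *\<^sub>R axis i 1)) has_vector_derivative mderiv (inc i k) f x) (at 0)"
      if "inc i k \<le> l" for k i x
      using assms(3)[OF that] eq[OF that] eq[OF le_incD[OF that]]
      by (simp add: has_pderiv_def)
  qed
qed

lemma cont_derivs_continuous: "cont_derivs l f \<Longrightarrow> k \<le> l \<Longrightarrow> continuous_on UNIV (mderiv k f)"
  by (simp add: cont_derivs_def)

lemma cont_derivs_imp_continuous: "cont_derivs l f \<Longrightarrow> continuous_on UNIV f"
  using cont_derivs_continuous[of l f zero_index] by (simp add: le_fun_def inc_apply dec_apply)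

lemma cont_derivs_has_pderiv:
  "cont_derivs l f \<Longrightarrow> inc i k \<le> l \<Longrightarrow> has_pderiv i (mderiv k f) (mderiv (inc i k) f)"
  by (simp add: cont_derivs_def has_pderiv_def inc_def)

lemma cont_derivs_mono: "cont_derivs l f \<Longrightarrow> l' \<le> l \<Longrightarrow> cont_derivs l' f"
  unfolding cont_derivs_def by (meson order_trans)

lemma cont_derivs_pderiv1:
  assumes "cont_derivs l f" "0 < l i"
  shows "has_pderiv i f (pderiv1 i f)"
proof -
  have "inc i zero_index \<le> l" using assms(2) by (auto simp: le_fun_def inc_apply)
  from cont_derivs_has_pderiv[OF assms(1) this]
  show ?thesis using has_pderiv_imp_pderiv1 by fastforce
qed

lemma
  assumes "cont_derivs (inc i l) f"
  shows cont_derivs_inc: "cont_derivs l (pderiv1 i f)"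
    and mderiv_pderiv1: "\<And>k. k \<le> l \<Longrightarrow> mderiv k (pderiv1 i f) = mderiv (inc i k) f"
proof -
  have 1: "mderiv (inc i zero_index) f = pderiv1 i f"
  proof -
    have "inc i zero_index \<le> inc i l" by (auto simp: le_fun_def inc_apply)
    from cont_derivs_has_pderiv[OF assms this]
    show ?thesis using has_pderiv_imp_pderiv1 by fastforce
  qed
  have 2: "continuous_on UNIV (mderiv (inc i k) f)" if "k \<le> l" for k
    by (rule cont_derivs_continuous[OF assms inc_le_inc[OF that]])
  have 3: "has_pderiv j (mderiv (inc i k) f) (mderiv (inc i (inc j k)) f)" if "inc j k \<le> l" for j k
  proof -
    have "inc j (inc i k) \<le> inc i l"
      using inc_le_inc[OF that, of i] unfolding inc_commute[where i=i and j=j and k=k] .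
    from cont_derivs_has_pderiv[OF assms this] show ?thesis
      unfolding inc_commute[where i=j and j=i and k=k] .
  qed
  show "cont_derivs l (pderiv1 i f)" "\<And>k. k \<le> l \<Longrightarrow> mderiv k (pderiv1 i f) = mderiv (inc i k) f"
    using cont_derivsI_family[of "\<lambda>k. mderiv (inc i k) f" "pderiv1 i f" l] 1 2 3 by auto
qed

lemma cont_derivs_dec: "cont_derivs l f \<Longrightarrow> 0 < l i \<Longrightarrow> cont_derivs (dec i l) (pderiv1 i f)"
  using cont_derivs_inc[where i=i and l="dec i l" and f=f] by simp

lemma mderiv_dec: "cont_derivs l f \<Longrightarrow> k \<le> l \<Longrightarrow> 0 < k i \<Longrightarrow> mderiv (dec i k) (pderiv1 i f) = mderiv k f"
  using mderiv_pderiv1[where i=i and l="dec i k" and f=f and k="dec i k"] cont_derivs_mono[of l f k] by simp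

text \<open>A derivative of order \<open>k\<close> may start with any coordinate i such that
  \<open>0 < k i\<close>; commuting second derivatives make the result independent of that start.
  Regularity up to \<open>l\<close> is thereby reduced to regularity of the first derivatives up to
  \<open>dec i l\<close>, which suits products and reciprocals.\<close>

lemma cont_derivsI_step:
  fixes f :: "'d::{finite,linorder} cfun"
  assumes cont: "continuous_on UNIV f"
    and deriv: "\<And>i. 0 < l i \<Longrightarrow> has_pderiv i f (f' i)"
    and step: "\<And>i. 0 < l i \<Longrightarrow> cont_derivs (dec i l) (f' i)"
    and schwarz: "\<And>i j. i \<noteq> j \<Longrightarrow> 0 < l i \<Longrightarrow> 0 < l j \<Longrightarrow> pderiv1 j (f' i) = pderiv1 i (f' j)"
  shows "cont_derivs l f"
proof -
  \<comment> \<open>The first differentiation is chosen arbitrarily; \<open>indep\<close> shows that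
    the choice does not matter.\<close>
  define D where "D k = (if k = zero_index then f else
      let i = (SOME i. 0 < k i) in mderiv (dec i k) (f' i))" for k
  have dec_mono: "dec i k \<le> dec i l" if "k \<le> l" for i k
    using that by (auto simp: le_fun_def dec_apply intro: diff_le_mono)
  have pos: "0 < l i" if "k \<le> l" "0 < k i" for i k
    using that le_funD[OF that(1), of i] by simp
  \<comment> \<open>After a first step by i, the next step is taken by j, and \<open>schwarz\<close>
    exchanges the two.\<close>
  have indep: "mderiv (dec i k) (f' i) = mderiv (dec j k) (f' j)"
    if "k \<le> l" "0 < k i" "0 < k j" for i j k
  proof (cases "i = j")
    case False
    have "mderiv (dec i k) (f' i) = mderiv (dec j (dec i k)) (pderiv1 j (f' i))"
      by (rule mderiv_dec[symmetric, OF step[of i]]) (use that False pos dec_mono in \<open>auto simp: dec_apply\<close>)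
    also have "\<dots> = mderiv (dec i (dec j k)) (pderiv1 i (f' j))"
    proof -
      have "dec j (dec i k) = dec i (dec j k)" using False by (intro ext) (auto simp: inc_apply dec_apply)
      moreover have "pderiv1 j (f' i) = pderiv1 i (f' j)"
        using False that pos by (intro schwarz) blast+
      ultimately show ?thesis by simp
    qed
    also have "\<dots> = mderiv (dec j k) (f' j)"
      by (rule mderiv_dec[OF step[of j]]) (use that False pos dec_mono in \<open>auto simp: dec_apply\<close>)
    finally show ?thesis .
  qed simp
  have D_eq: "D k = mderiv (dec i k) (f' i)" if "k \<le> l" "0 < k i" for i k
  proof -
    have "k \<noteq> zero_index" using that by auto
    then have "D k = mderiv (dec (SOME i. 0 < k i) k) (f' (SOME i. 0 < k i))"
      by (simp only: D_def Let_def if_False)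
    also have "\<dots> = mderiv (dec i k) (f' i)"
      using that(1) someI[of "\<lambda>i. 0 < k i", OF that(2)] that(2) by (rule indep)
    finally show ?thesis .
  qed
  have D0: "D zero_index = f" by (simp add: D_def)
  have nz: "\<exists>i. 0 < k i" if "k \<noteq> zero_index" for k :: "'d \<Rightarrow> nat"
    using that by auto
  have "continuous_on UNIV (D k)" if "k \<le> l" for k
  proof (cases "k = zero_index")
    case False
    then obtain i where "0 < k i" using nz by blast
    then show ?thesis
      using D_eq[OF that] cont_derivs_continuous[OF step[OF pos[OF that]] dec_mono[OF that]] by simp
  qed (use D0 cont in simp)
  moreover have "has_pderiv i (D k) (D (inc i k))" if "inc i k \<le> l" for i k
  proof (cases "k = zero_index")
    case True
    have "0 < l i" using le_funD[OF that, of i] by (simp add: inc_apply)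
    then show ?thesis
      using D_eq[OF that, of i] deriv[of i] True D0 by simp
  next
    case False
    then obtain j where j: "0 < k j" using nz by blast
    have kl: "k \<le> l" by (rule le_incD[OF that])
    have lj: "0 < l j" using pos kl j by blast
    have eq: "inc i (dec j k) = dec j (inc i k)"
      using j by (intro ext) (auto simp: inc_apply dec_apply)
    have le: "inc i (dec j k) \<le> dec j l"
      unfolding eq by (rule dec_mono[OF that])
    have "0 < inc i k j" using j by (simp add: inc_apply)
    then have "D (inc i k) = mderiv (inc i (dec j k)) (f' j)"
      unfolding eq by (rule D_eq[OF that])
    then show ?thesis
      using cont_derivs_has_pderiv[OF step[OF lj] le] D_eq[OF kl j] by (simp only:)
  qed
  ultimately show ?thesis
    by (intro cont_derivsI_family(1)[of D f l] D0)
qed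

lemma cont_derivs_incD: "cont_derivs (inc i l) f \<Longrightarrow> cont_derivs l f"
  by (rule cont_derivs_mono[OF _ le_inc])

lemma cont_derivs_decI: "cont_derivs l f \<Longrightarrow> cont_derivs (dec i l) f"
  by (rule cont_derivs_mono[OF _ dec_le])

lemma multiindex_dec_induct [case_names dec]:
  fixes l :: "'d::finite \<Rightarrow> nat"
  assumes "\<And>l. (\<And>i. 0 < l i \<Longrightarrow> P (dec i l)) \<Longrightarrow> P l"
  shows "P l"
proof (induction "\<Sum>i\<in>UNIV. l i" arbitrary: l rule: less_induct)
  case less
  show ?case
  proof (rule assms)
    fix i assume i: "0 < l i"
    have "sum (dec i l) UNIV < sum l UNIV"
      by (rule sum_strict_mono_ex1) (use i in \<open>auto simp: dec_apply\<close>)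
    then show "P (dec i l)" by (rule less)
  qed
qed

section \<open>Differentiation rules; products and reciprocals of functions of class C^l\<close>

lemma has_pderiv_const: "has_pderiv i (\<lambda>x. c) (\<lambda>x. 0)"
  by (simp add: has_pderiv_def)

lemma has_pderiv_add:
  "has_pderiv i f f' \<Longrightarrow> has_pderiv i g g' \<Longrightarrow> has_pderiv i (\<lambda>x. f x + g x) (\<lambda>x. f' x + g' x)"
  unfolding has_pderiv_def by (auto intro: has_vector_derivative_add)

lemma has_pderiv_mult:
  assumes "has_pderiv i f f'" "has_pderiv i g g'"
  shows "has_pderiv i (\<lambda>x. f x * g x) (\<lambda>x. f x * g' x + f' x * g x)"
  unfolding has_pderiv_def
proof
  fix x
  show "((\<lambda>t. f (x + t *\<^sub>R axis i 1) * g (x + t *\<^sub>R axis i 1)) has_vector_derivative f x * g' x + f' x * g x) (at 0)"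
    using has_vector_derivative_mult[OF assms[unfolded has_pderiv_def, THEN spec, of x]] by simp
qed

lemma has_pderiv_cmult: "has_pderiv i f f' \<Longrightarrow> has_pderiv i (\<lambda>x. a * f x) (\<lambda>x. a * f' x)"
  using has_pderiv_mult[OF has_pderiv_const, of i f f' a] by simp

lemma has_pderiv_inverse:
  assumes "has_pderiv i f f'" "\<And>x. f x \<noteq> 0"
  shows "has_pderiv i (\<lambda>x. inverse (f x)) (\<lambda>x. - f' x * (inverse (f x) * inverse (f x)))"
  unfolding has_pderiv_def
proof
  fix x
  have "(inverse has_field_derivative - (inverse (f x) ^ Suc (Suc 0))) (at (f (x + 0 *\<^sub>R axis i 1)))"
    using DERIV_inverse[of "f x"] assms(2) by simp
  from field_vector_diff_chain_at[OF assms(1)[unfolded has_pderiv_def, THEN spec, of x] this]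
  show "((\<lambda>t. inverse (f (x + t *\<^sub>R axis i 1))) has_vector_derivative
      - f' x * (inverse (f x) * inverse (f x))) (at 0)"
    by (simp add: o_def)
qed

lemma
  assumes "cont_derivs l f" "cont_derivs l g"
  shows cont_derivs_add: "cont_derivs l (\<lambda>x. f x + g x)"
    and mderiv_add: "k \<le> l \<Longrightarrow> mderiv k (\<lambda>x. f x + g x) = (\<lambda>x. mderiv k f x + mderiv k g x)"
proof -
  note fam = cont_derivsI_family[of "\<lambda>k x. mderiv k f x + mderiv k g x" "\<lambda>x. f x + g x" l]
  have 1: "continuous_on UNIV (\<lambda>x. mderiv k f x + mderiv k g x)" if "k \<le> l" for k
    using assms that by (intro continuous_intros cont_derivs_continuous)
  have 2: "has_pderiv i (\<lambda>x. mderiv k f x + mderiv k g x)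
      (\<lambda>x. mderiv (inc i k) f x + mderiv (inc i k) g x)" if "inc i k \<le> l" for i k
    using assms that by (intro has_pderiv_add cont_derivs_has_pderiv)
  show "cont_derivs l (\<lambda>x. f x + g x)" by (rule fam(1)[OF _ 1 2]) simp
  show "k \<le> l \<Longrightarrow> mderiv k (\<lambda>x. f x + g x) = (\<lambda>x. mderiv k f x + mderiv k g x)"
    by (rule fam(2)[OF _ 1 2]) simp
qed

lemma
  assumes "cont_derivs l f"
  shows cont_derivs_cmult: "cont_derivs l (\<lambda>x. a * f x)"
    and mderiv_cmult: "k \<le> l \<Longrightarrow> mderiv k (\<lambda>x. a * f x) = (\<lambda>x. a * mderiv k f x)"
proof -
  note fam = cont_derivsI_family[of "\<lambda>k x. a * mderiv k f x" "\<lambda>x. a * f x" l]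
  have 1: "continuous_on UNIV (\<lambda>x. a * mderiv k f x)" if "k \<le> l" for k
    using assms that by (intro continuous_intros cont_derivs_continuous)
  have 2: "has_pderiv i (\<lambda>x. a * mderiv k f x) (\<lambda>x. a * mderiv (inc i k) f x)"
    if "inc i k \<le> l" for i k
    using assms that by (intro has_pderiv_cmult cont_derivs_has_pderiv)
  show "cont_derivs l (\<lambda>x. a * f x)" by (rule fam(1)[OF _ 1 2]) simp
  show "k \<le> l \<Longrightarrow> mderiv k (\<lambda>x. a * f x) = (\<lambda>x. a * mderiv k f x)"
    by (rule fam(2)[OF _ 1 2]) simp
qed

lemma pderiv1_commute:
  assumes "cont_derivs l f" "i \<noteq> j" "0 < l i" "0 < l j"
  shows "pderiv1 j (pderiv1 i f) = pderiv1 i (pderiv1 j f)"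
proof -
  have *: "pderiv1 j (pderiv1 i f) = mderiv (inc j (inc i zero_index)) f"
    if "i \<noteq> j" "0 < l i" "0 < l j" for i j
  proof -
    have le1: "inc i zero_index \<le> l" and le2: "inc j (inc i zero_index) \<le> l"
      using that by (auto simp: le_fun_def inc_apply)
    have "pderiv1 i f = mderiv (inc i zero_index) f"
      using cont_derivs_has_pderiv[OF assms(1) le1] has_pderiv_imp_pderiv1 by fastforce
    moreover have "pderiv1 j (mderiv (inc i zero_index) f) = mderiv (inc j (inc i zero_index)) f"
      by (rule has_pderiv_imp_pderiv1[OF cont_derivs_has_pderiv[OF assms(1) le2]])
    ultimately show ?thesis by simp
  qed
  show ?thesis
    unfolding *[OF assms(2-4)] *[OF assms(2)[symmetric] assms(4,3)]
      inc_commute[of i j] ..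
qed

lemma pderiv1_has_pderiv:
  assumes "cont_derivs l f" "i \<noteq> j" "0 < l i" "0 < l j"
  shows "has_pderiv j (pderiv1 i f) (pderiv1 j (pderiv1 i f))"
  by (rule cont_derivs_pderiv1[OF cont_derivs_dec[OF assms(1,3)]]) (use assms in \<open>auto simp: dec_apply\<close>)

text \<open>By the product rule a first derivative is a sum of products whose factors have
  continuous derivatives up to \<open>dec i l\<close>, so the induction hypothesis applies to each
  summand.\<close>

lemma cont_derivs_mult:
  assumes "cont_derivs l f" "cont_derivs l g"
  shows "cont_derivs l (\<lambda>x. f x * g x)"
  using assms
proof (induction l arbitrary: f g rule: multiindex_dec_induct)
  case (dec l)
  note f = dec.prems(1) and g = dec.prems(2)
  let ?p = "\<lambda>i x. f x * pderiv1 i g x + pderiv1 i f x * g x"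
  have deriv: "has_pderiv j (?p i)
      (\<lambda>x. (f x * pderiv1 j (pderiv1 i g) x + pderiv1 j f x * pderiv1 i g x)
        + (pderiv1 i f x * pderiv1 j g x + pderiv1 j (pderiv1 i f) x * g x))"
    if "i \<noteq> j" "0 < l i" "0 < l j" for i j
    using that f g
    by (intro has_pderiv_add has_pderiv_mult pderiv1_has_pderiv[of l]) (auto intro: cont_derivs_pderiv1)
  show ?case
  proof (rule cont_derivsI_step)
    show "continuous_on UNIV (\<lambda>x. f x * g x)"
      using f g by (intro continuous_intros cont_derivs_imp_continuous)
    show "has_pderiv i (\<lambda>x. f x * g x) (?p i)"
      if "0 < l i" for i
      using that f g by (intro has_pderiv_mult cont_derivs_pderiv1)
    show "cont_derivs (dec i l) (?p i)" if "0 < l i" for i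
      using that f g
      by (intro cont_derivs_add dec.IH) (auto intro: cont_derivs_dec cont_derivs_decI)
    show "pderiv1 j (?p i) =
        pderiv1 i (?p j)"
      if "i \<noteq> j" "0 < l i" "0 < l j" for i j
      unfolding has_pderiv_imp_pderiv1[OF deriv[OF that]]
        has_pderiv_imp_pderiv1[OF deriv[OF that(1)[symmetric] that(3,2)]]
        pderiv1_commute[OF f that] pderiv1_commute[OF g that]
      by (simp add: algebra_simps)
  qed
qed

text \<open>The Leibniz rule for a single differentiation. Used inside inductions over multi-indices
  it takes the place of binomial coefficients.\<close>

lemma mderiv_mult_inc:
  assumes "cont_derivs (inc i k) f" "cont_derivs (inc i k) g"
  shows "mderiv (inc i k) (\<lambda>x. f x * g x) =
    (\<lambda>x. mderiv k (\<lambda>x. f x * pderiv1 i g x) x + mderiv k (\<lambda>x. pderiv1 i f x * g x) x)"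
proof -
  have c: "cont_derivs k f" "cont_derivs k g"
    using assms by (auto dest: cont_derivs_incD)
  have i: "0 < inc i k i" by (simp add: inc_apply)
  have "pderiv1 i (\<lambda>x. f x * g x) = (\<lambda>x. f x * pderiv1 i g x + pderiv1 i f x * g x)"
    by (intro has_pderiv_imp_pderiv1 has_pderiv_mult cont_derivs_pderiv1[OF assms(1) i]
      cont_derivs_pderiv1[OF assms(2) i])
  then have "mderiv (inc i k) (\<lambda>x. f x * g x) =
      mderiv k (\<lambda>x. f x * pderiv1 i g x + pderiv1 i f x * g x)"
    using mderiv_pderiv1[OF cont_derivs_mult[OF assms] order_refl] by simp
  also have "\<dots> = (\<lambda>x. mderiv k (\<lambda>x. f x * pderiv1 i g x) x + mderiv k (\<lambda>x. pderiv1 i f x * g x) x)"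
    by (intro mderiv_add[of k] cont_derivs_mult c cont_derivs_inc assms order_refl)
  finally show ?thesis .
qed

text \<open>The first derivative -f'/f^2 contains the reciprocal again, but needs it only up to
  \<open>dec i l\<close>, where the induction hypothesis supplies it.\<close>

lemma cont_derivs_inverse:
  assumes "cont_derivs l f" "\<And>x. f x \<noteq> 0"
  shows "cont_derivs l (\<lambda>x. inverse (f x))"
  using assms(1)
proof (induction l rule: multiindex_dec_induct)
  case (dec l)
  note f = dec.prems
  let ?h = "\<lambda>x. inverse (f x)"
  let ?d = "\<lambda>i x. - pderiv1 i f x * (?h x * ?h x)"
  have deriv1: "has_pderiv i ?h (?d i)" if "0 < l i" for i
    using that f assms(2) by (intro has_pderiv_inverse cont_derivs_pderiv1)
  have neg: "has_pderiv i (\<lambda>x. - g x) (\<lambda>x. - g' x)" if "has_pderiv i g g'" for i g g'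
    using has_pderiv_cmult[OF that, of "- 1"] by simp
  have deriv: "has_pderiv j (?d i)
      (\<lambda>x. - pderiv1 i f x * (?h x * ?d j x + ?d j x * ?h x)
        + - pderiv1 j (pderiv1 i f) x * (?h x * ?h x))"
    if "i \<noteq> j" "0 < l i" "0 < l j" for i j
    using that f
    by (intro has_pderiv_mult deriv1 neg pderiv1_has_pderiv[of l]) auto
  show ?case
  proof (rule cont_derivsI_step)
    show "continuous_on UNIV ?h"
      using f assms(2) by (intro continuous_intros cont_derivs_imp_continuous) auto
    show "has_pderiv i ?h (?d i)" if "0 < l i" for i
      using that by (rule deriv1)
    show "cont_derivs (dec i l) (?d i)" if "0 < l i" for i
    proof -
      have "cont_derivs (dec i l) ?h"
        by (rule dec.IH[OF that cont_derivs_decI[OF f]])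
      moreover have "cont_derivs (dec i l) (\<lambda>x. - pderiv1 i f x)"
        using cont_derivs_cmult[OF cont_derivs_dec[OF f that], of "- 1"] by simp
      ultimately show ?thesis by (intro cont_derivs_mult)
    qed
    show "pderiv1 j (?d i) = pderiv1 i (?d j)"
      if "i \<noteq> j" "0 < l i" "0 < l j" for i j
      unfolding has_pderiv_imp_pderiv1[OF deriv[OF that]]
        has_pderiv_imp_pderiv1[OF deriv[OF that(1)[symmetric] that(3,2)]] pderiv1_commute[OF f that]
      by (simp add: algebra_simps)
  qed
qed

text \<open>The complement of \<open>K\<close> is open, so on each line through x the derivative of
  the previous order vanishes near x.\<close>

lemma mderiv_eq_0_outside:
  assumes "cont_derivs k f" "closed K" "\<And>x. x \<notin> K \<Longrightarrow> f x = 0" "x \<notin> K"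
  shows "mderiv k f x = 0"
  using assms(1,4)
proof (induction k arbitrary: x rule: multiindex_induct)
  case zero
  then show ?case using assms(3) by simp
next
  case (inc k i)
  have f: "cont_derivs k f" using inc.prems(1) by (rule cont_derivs_incD)
  have d: "((\<lambda>t. mderiv k f (x + t *\<^sub>R axis i 1)) has_vector_derivative mderiv (inc i k) f x) (at 0)"
    using cont_derivs_has_pderiv[OF inc.prems(1) order_refl] by (simp add: has_pderiv_def)
  have "((\<lambda>t. x + t *\<^sub>R axis i 1) \<longlongrightarrow> x + 0 *\<^sub>R axis i 1) (at (0::real))"
    by (intro tendsto_intros)
  then have "\<forall>\<^sub>F t in at 0. x + t *\<^sub>R axis i 1 \<in> - K"
    by (rule topological_tendstoD) (use assms(2) inc.prems(2) in \<open>auto simp: open_Compl\<close>)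
  then have "\<forall>\<^sub>F t in at 0. mderiv k f (x + t *\<^sub>R axis i 1) = 0"
    by eventually_elim (use inc.IH[OF f] in auto)
  then have "\<forall>\<^sub>F t in nhds 0. mderiv k f (x + t *\<^sub>R axis i 1) = 0"
    unfolding eventually_at_filter
    by eventually_elim (use inc.IH[OF f] inc.prems(2) in force)
  then have "((\<lambda>t. mderiv k f (x + t *\<^sub>R axis i 1)) has_vector_derivative 0) (at 0)"
    using has_vector_derivative_const[of 0 "at 0"]
    by (subst has_vector_derivative_cong_ev[where g = "\<lambda>_. 0"])
      (use inc.IH[OF f] inc.prems(2) in auto)
  then show ?case using d by (metis vector_derivative_at)
qed

text \<open>\<open>\<phi>\<close> stays arbitrary in the induction because the Leibniz step replaces
  it by \<open>pderiv1 i \<phi>\<close>. Compactness enters at order zero: products of uniform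
  limits converge uniformly when the limits are bounded.\<close>

lemma uniform_limit_mderiv_mult:
  fixes \<phi> :: "'d::{finite,linorder} cfun"
  assumes "compact K" "cont_derivs k \<phi>" "\<And>n. cont_derivs k (\<eta>s n)" "cont_derivs k \<eta>"
    and "\<And>j. j \<le> k \<Longrightarrow> uniform_limit K (\<lambda>n. mderiv j (\<eta>s n)) (mderiv j \<eta>) sequentially"
  shows "uniform_limit K (\<lambda>n. mderiv k (\<lambda>x. \<phi> x * \<eta>s n x)) (mderiv k (\<lambda>x. \<phi> x * \<eta> x)) sequentially"
  using assms(2-)
proof (induction k arbitrary: \<phi> \<eta>s \<eta> rule: multiindex_induct)
  case zero
  have "bounded (\<phi> ` K)" "bounded (\<eta> ` K)"
    using zero.prems(1,3) \<open>compact K\<close>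
    by (auto intro!: compact_imp_bounded compact_continuous_image
      intro: continuous_on_subset cont_derivs_imp_continuous)
  moreover have "uniform_limit K (\<lambda>n. \<phi>) \<phi> sequentially"
    by (auto simp: uniform_limit_iff)
  moreover have "uniform_limit K \<eta>s \<eta> sequentially"
    using zero.prems(4)[of zero_index] by simp
  ultimately show ?case by (auto intro: uniform_lim_mult)
next
  case (inc k i)
  have 1: "uniform_limit K (\<lambda>n. mderiv k (\<lambda>x. \<phi> x * pderiv1 i (\<eta>s n) x))
      (mderiv k (\<lambda>x. \<phi> x * pderiv1 i \<eta> x)) sequentially"
  proof (rule inc.IH)
    show "uniform_limit K (\<lambda>n. mderiv j (pderiv1 i (\<eta>s n))) (mderiv j (pderiv1 i \<eta>)) sequentially"
      if "j \<le> k" for j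
      using inc.prems(4)[OF inc_le_inc[OF that]] mderiv_pderiv1[OF inc.prems(2) that]
        mderiv_pderiv1[OF inc.prems(3) that] by simp
  qed (rule cont_derivs_inc cont_derivs_incD, rule inc.prems)+
  have 2: "uniform_limit K (\<lambda>n. mderiv k (\<lambda>x. pderiv1 i \<phi> x * \<eta>s n x))
      (mderiv k (\<lambda>x. pderiv1 i \<phi> x * \<eta> x)) sequentially"
  proof (rule inc.IH)
    show "uniform_limit K (\<lambda>n. mderiv j (\<eta>s n)) (mderiv j \<eta>) sequentially" if "j \<le> k" for j
      by (rule inc.prems(4)[OF order_trans[OF that le_inc]])
  qed (rule cont_derivs_inc cont_derivs_incD, rule inc.prems)+
  show ?case
    unfolding mderiv_mult_inc[OF inc.prems(1) inc.prems(2)] mderiv_mult_inc[OF inc.prems(1) inc.prems(3)]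
    by (rule uniform_limit_add[OF 1 2])
qed

section \<open>Integration\<close>

abbreviation pairing :: "'d::finite cfun \<Rightarrow> 'd cfun \<Rightarrow> complex" where
  "pairing f g \<equiv> LINT x|lborel. f x * g x"

lemma has_vector_derivative_iff_quotient:
  "(f has_vector_derivative D) (at x) \<longleftrightarrow> ((\<lambda>y. (f y - f x) /\<^sub>R (y - x)) \<longlongrightarrow> D) (at x)"
proof -
  have "norm (f y - f x - (y - x) *\<^sub>R D) / norm (y - x) = norm ((f y - f x) /\<^sub>R (y - x) - D)"
    if "y \<noteq> x" for y
  proof -
    have "(f y - f x) /\<^sub>R (y - x) - D = (f y - f x - (y - x) *\<^sub>R D) /\<^sub>R (y - x)"
      using that by (simp add: scaleR_right_diff_distrib)
    then show ?thesis by (simp add: divide_inverse mult.commute)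
  qed
  then have ev: "\<forall>\<^sub>F y in at x. norm (f y - f x - (y - x) *\<^sub>R D) / norm (y - x) = norm ((f y - f x) /\<^sub>R (y - x) - D)"
    by (auto simp: eventually_at_filter)
  have "(f has_vector_derivative D) (at x) \<longleftrightarrow>
      ((\<lambda>y. norm (f y - f x - (y - x) *\<^sub>R D) / norm (y - x)) \<longlongrightarrow> 0) (at x)"
    by (simp add: has_vector_derivative_def has_derivative_iff_norm bounded_linear_scaleR_left)
  also have "\<dots> \<longleftrightarrow> ((\<lambda>y. norm ((f y - f x) /\<^sub>R (y - x) - D)) \<longlongrightarrow> 0) (at x)"
    by (rule tendsto_cong[OF ev])
  also have "\<dots> \<longleftrightarrow> ((\<lambda>y. (f y - f x) /\<^sub>R (y - x)) \<longlongrightarrow> D) (at x)"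
    by (simp add: tendsto_norm_zero_iff LIM_zero_iff)
  finally show ?thesis .
qed

text \<open>Dominated convergence for the difference quotients. The mean value inequality bounds
  them by \<open>w\<close>, so a bound on the derivative for parameters in [-1,1] suffices.\<close>

lemma has_vector_derivative_integral:
  fixes F :: "real \<Rightarrow> 'a \<Rightarrow> complex"
  assumes int: "\<And>t. integrable M (F t)"
    and deriv: "\<And>t z. \<bar>t\<bar> \<le> 1 \<Longrightarrow> ((\<lambda>t. F t z) has_vector_derivative F' t z) (at t)"
    and meas: "F' 0 \<in> borel_measurable M"
    and w: "integrable M w" "\<And>t z. \<bar>t\<bar> \<le> 1 \<Longrightarrow> norm (F' t z) \<le> w z"
  shows "((\<lambda>t. LINT z|M. F t z) has_vector_derivative (LINT z|M. F' 0 z)) (at 0)"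
  unfolding has_vector_derivative_iff_quotient tendsto_at_iff_sequentially
proof (intro allI impI)
  fix X :: "nat \<Rightarrow> real" assume X: "\<forall>i. X i \<in> UNIV - {0}" "X \<longlonglongrightarrow> 0"
  let ?I = "\<lambda>t. LINT z|M. F t z"
  have bound: "norm (F t z - F 0 z) \<le> w z * \<bar>t\<bar>" if "\<bar>t\<bar> \<le> 1" for t z
  proof -
    have "norm (F t z - F 0 z) \<le> w z * norm (t - 0)"
    proof (rule differentiable_bound[of "{-1..1}"])
      show "((\<lambda>t. F t z) has_derivative (\<lambda>h. h *\<^sub>R F' s z)) (at s within {-1..1})" if "s \<in> {-1..1}" for s
        using deriv[of s z] that by (auto simp: has_vector_derivative_def intro: has_derivative_at_withinI)
      show "onorm (\<lambda>h. h *\<^sub>R F' s z) \<le> w z" if "s \<in> {-1..1}" for s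
        using w(2)[of s z] that
        by (intro onorm_le) (auto simp: mult.commute intro: mult_left_mono)
    qed (use that in auto)
    then show ?thesis by simp
  qed
  \<comment> \<open>The bounds hold in [-1,1] only, so the finitely many terms of \<open>X\<close>
    that may lie outside are dropped.\<close>
  have "\<forall>\<^sub>F n in sequentially. \<bar>X n\<bar> < 1"
    using tendstoD[OF X(2), of 1] by (simp add: dist_real_def)
  then obtain N where N: "\<And>n. n \<ge> N \<Longrightarrow> \<bar>X n\<bar> < 1"
    by (auto simp: eventually_sequentially)
  define Y where "Y n = X (n + N)" for n
  have Y: "\<bar>Y n\<bar> \<le> 1" "Y n \<noteq> 0" for n
    using N[of "n + N"] X(1) by (auto simp: Y_def less_imp_le)
  have Y0: "Y \<longlonglongrightarrow> 0" unfolding Y_def by (rule LIMSEQ_ignore_initial_segment[OF X(2)])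
  have "(\<lambda>n. LINT z|M. (F (Y n) z - F 0 z) /\<^sub>R Y n) \<longlonglongrightarrow> (LINT z|M. F' 0 z)"
  proof (rule integral_dominated_convergence[where w = w])
    show "AE z in M. (\<lambda>n. (F (Y n) z - F 0 z) /\<^sub>R Y n) \<longlonglongrightarrow> F' 0 z"
    proof (rule AE_I2)
      fix z
      have "((\<lambda>y. (F y z - F 0 z) /\<^sub>R (y - 0)) \<longlongrightarrow> F' 0 z) (at 0)"
        using deriv[of 0 z] by (simp add: has_vector_derivative_iff_quotient)
      then have "((\<lambda>y. (F y z - F 0 z) /\<^sub>R (y - 0)) \<circ> Y) \<longlonglongrightarrow> F' 0 z"
        unfolding tendsto_at_iff_sequentially using Y Y0 by blast
      then show "(\<lambda>n. (F (Y n) z - F 0 z) /\<^sub>R Y n) \<longlonglongrightarrow> F' 0 z"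
        by (simp add: o_def)
    qed
    show "AE z in M. norm ((F (Y n) z - F 0 z) /\<^sub>R Y n) \<le> w z" for n
    proof (rule AE_I2)
      fix z
      have "norm ((F (Y n) z - F 0 z) /\<^sub>R Y n) = norm (F (Y n) z - F 0 z) / \<bar>Y n\<bar>"
        by (simp only: norm_scaleR abs_inverse divide_inverse mult.commute)
      also have "\<dots> \<le> w z"
        using bound[OF Y(1), of n z] Y(2)[of n] by (simp add: pos_divide_le_eq)
      finally show "norm ((F (Y n) z - F 0 z) /\<^sub>R Y n) \<le> w z" .
    qed
    show "(\<lambda>z. (F (Y n) z - F 0 z) /\<^sub>R Y n) \<in> borel_measurable M" for n
      using int by (auto intro!: borel_measurable_integrable)
  qed (use w meas in auto)
  then have "(\<lambda>n. (?I (Y n) - ?I 0) /\<^sub>R Y n) \<longlonglongrightarrow> (LINT z|M. F' 0 z)"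
    using int by simp
  then have "(\<lambda>n. (\<lambda>n. (?I (X n) - ?I 0) /\<^sub>R X n) (n + N)) \<longlonglongrightarrow> (LINT z|M. F' 0 z)"
    by (simp only: Y_def)
  then have "(\<lambda>n. (?I (X n) - ?I 0) /\<^sub>R X n) \<longlonglongrightarrow> (LINT z|M. F' 0 z)"
    by (rule LIMSEQ_offset)
  then show "((\<lambda>y. (?I y - ?I 0) /\<^sub>R (y - 0)) \<circ> X) \<longlonglongrightarrow> (LINT z|M. F' 0 z)"
    by (simp only: o_def diff_zero)
qed

lemma
  fixes f :: "'a::euclidean_space \<Rightarrow> 'b::{banach, second_countable_topology}"
  assumes "c \<noteq> 0" and [measurable]: "f \<in> borel_measurable borel"
  shows lborel_integral_affine: "(LINT x|lborel. f x) = \<bar>c\<bar> ^ DIM('a) *\<^sub>R (LINT x|lborel. f (t + c *\<^sub>R x))"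
    and lborel_integrable_affine: "integrable lborel f \<longleftrightarrow> integrable lborel (\<lambda>x. f (t + c *\<^sub>R x))"
proof -
  have [measurable]: "(\<lambda>x. t + c *\<^sub>R x) \<in> borel \<rightarrow>\<^sub>M borel" by simp
  show "(LINT x|lborel. f x) = \<bar>c\<bar> ^ DIM('a) *\<^sub>R (LINT x|lborel. f (t + c *\<^sub>R x))"
    by (subst lborel_affine[OF assms(1), of t]) (simp add: integral_density integral_distr)
  show "integrable lborel f \<longleftrightarrow> integrable lborel (\<lambda>x. f (t + c *\<^sub>R x))"
  proof -
    have "integrable lborel (\<lambda>x. a *\<^sub>R g x) \<longleftrightarrow> integrable lborel g"
      if "a \<noteq> 0" for a and g :: "'a \<Rightarrow> 'b"
      using that integrable_scaleR_right[of "inverse a" lborel "\<lambda>x. a *\<^sub>R g x"] by auto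
    then show ?thesis
      using assms(1)
      by (subst lborel_affine[OF assms(1), of t]) (simp add: integrable_density integrable_distr_eq)
  qed
qed

text \<open>Lebesgue measure on \<open>real ^ 'd\<close> is the image of a product measure indexed
  by \<open>Basis\<close>. The vectors \<open>axis i 1\<close> put \<open>Basis\<close> in bijection
  with the coordinates, which turns the product over basis vectors into one over i.\<close>

lemma
  fixes h :: "'d::finite \<Rightarrow> real \<Rightarrow> 'b::{real_normed_field, banach, second_countable_topology}"
  assumes "\<And>i. integrable lborel (h i)"
  shows lborel_integrable_prod: "integrable lborel (\<lambda>x::real^'d. \<Prod>i\<in>UNIV. h i (x $ i))"
    and lborel_integral_prod: "integral\<^sup>L lborel (\<lambda>x::real^'d. \<Prod>i\<in>UNIV. h i (x $ i)) = (\<Prod>i\<in>UNIV. LINT t|lborel. h i t)"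
proof -
  interpret product_sigma_finite "\<lambda>_::real^'d. lborel :: real measure" by standard
  let ?T = "\<lambda>f. \<Sum>b\<in>(Basis::(real^'d) set). f b *\<^sub>R b"
  let ?P = "\<Pi>\<^sub>M b\<in>(Basis::(real^'d) set). (lborel :: real measure)"
  have [measurable]: "h i \<in> borel_measurable borel" for i
    using borel_measurable_integrable[OF assms[of i]] by simp
  have basis: "(Basis::(real^'d) set) = range (\<lambda>i. axis i 1)" by (auto simp: Basis_vec_def)
  have inj: "inj (\<lambda>i::'d. axis i (1::real))" by (auto simp: inj_on_def axis_eq_axis)
  have comp: "?T f $ i = f (axis i 1)" for f :: "real^'d \<Rightarrow> real" and i
  proof -
    have "?T f $ i = ?T f \<bullet> axis i 1" by (simp add: inner_axis)
    moreover have "axis i (1::real) \<in> (Basis::(real^'d) set)" by (auto simp: Basis_vec_def)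
    ultimately show ?thesis by (simp only: inner_sum_left_Basis)
  qed
  have eq: "(\<Prod>i\<in>UNIV. h i (?T f $ i)) = (\<Prod>b\<in>Basis. h (axis_index b) (f b))" for f
  proof -
    have "(\<Prod>i\<in>UNIV. h i (?T f $ i)) = (\<Prod>i\<in>UNIV. h i (f (axis i 1)))"
      by (simp only: comp)
    also have "\<dots> = (\<Prod>b\<in>Basis. h (axis_index b) (f b))"
      unfolding basis by (subst prod.reindex[OF inj]) (simp add: axis_index_axis)
    finally show ?thesis .
  qed
  have "(\<lambda>f. f b) \<in> ?P \<rightarrow>\<^sub>M borel" if "b \<in> Basis" for b
    using measurable_component_singleton[OF that, of "\<lambda>_. lborel"] by simp
  then have [measurable]: "?T \<in> ?P \<rightarrow>\<^sub>M borel"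
    by (intro borel_measurable_sum borel_measurable_scaleR) auto
  have "integrable ?P (\<lambda>f. \<Prod>i\<in>UNIV. h i (?T f $ i))"
    unfolding eq by (intro product_integrable_prod assms) auto
  then show "integrable lborel (\<lambda>x::real^'d. \<Prod>i\<in>UNIV. h i (x $ i))"
    unfolding lborel_eq[where 'a="real^'d"] by (subst integrable_distr_eq) auto
  have "integral\<^sup>L lborel (\<lambda>x::real^'d. \<Prod>i\<in>UNIV. h i (x $ i)) = integral\<^sup>L ?P (\<lambda>f. \<Prod>i\<in>UNIV. h i (?T f $ i))"
    unfolding lborel_eq[where 'a="real^'d"] by (subst integral_distr) auto
  also have "\<dots> = (\<Prod>b\<in>(Basis::(real^'d) set). LINT t|lborel. h (axis_index b) t)"
    unfolding eq by (intro product_integral_prod assms) auto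
  also have "\<dots> = (\<Prod>i\<in>UNIV. LINT t|lborel. h i t)"
    unfolding basis by (subst prod.reindex[OF inj]) (simp add: axis_index_axis)
  finally show "integral\<^sup>L lborel (\<lambda>x::real^'d. \<Prod>i\<in>UNIV. h i (x $ i)) = (\<Prod>i\<in>UNIV. LINT t|lborel. h i t)" .
qed

lemma continuous_on_borel_measurable: "continuous_on UNIV f \<Longrightarrow> f \<in> borel_measurable borel"
  by (rule borel_measurable_continuous_onI)

lemma integrable_compact_support:
  fixes f :: "'a::euclidean_space \<Rightarrow> 'b::{banach, second_countable_topology}"
  assumes "continuous_on UNIV f" "compact K" "\<And>x. x \<notin> K \<Longrightarrow> f x = 0"
  shows "integrable lborel f"
proof -
  have "integrable lborel (\<lambda>x. indicator K x *\<^sub>R f x)"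
    using assms by (intro borel_integrable_compact) (auto intro: continuous_on_subset)
  also have "(\<lambda>x. indicator K x *\<^sub>R f x) = f"
    using assms(3) by (auto simp: fun_eq_iff indicator_def)
  finally show ?thesis .
qed

text \<open>Translation invariance: the integral of \<open>F\<close> shifted by t along
  \<open>axis i 1\<close> is constant in t, and its derivative at 0 is the integral of
  \<open>F'\<close>.\<close>

lemma integral_pderiv_eq_0:
  fixes F :: "'d::finite cfun"
  assumes "has_pderiv i F F'" "integrable lborel F" "continuous_on UNIV F'"
    and "integrable lborel w" "\<And>t x. \<bar>t\<bar> \<le> 1 \<Longrightarrow> norm (F' (x + t *\<^sub>R axis i 1)) \<le> w x"
  shows "(LINT x|lborel. F' x) = 0"
proof -
  let ?e = "axis i 1 :: real^'d"
  have [measurable]: "F \<in> borel_measurable borel"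
    using borel_measurable_integrable[OF assms(2)] by simp
  have shift: "integrable lborel (\<lambda>x. F (x + t *\<^sub>R ?e))"
    "(LINT x|lborel. F (x + t *\<^sub>R ?e)) = (LINT x|lborel. F x)" for t
    using lborel_integrable_affine[of 1 F "t *\<^sub>R ?e"] lborel_integral_affine[of 1 F "t *\<^sub>R ?e"] assms(2)
    by (simp_all add: add.commute)
  have "((\<lambda>t. LINT x|lborel. F (x + t *\<^sub>R ?e)) has_vector_derivative
      (LINT x|lborel. F' (x + 0 *\<^sub>R ?e))) (at 0)"
  proof (rule has_vector_derivative_integral[OF shift(1) _ _ assms(4,5)])
    show "(\<lambda>x. F' (x + 0 *\<^sub>R ?e)) \<in> borel_measurable lborel"
      using continuous_on_borel_measurable[OF assms(3)] by simp
  qed (rule has_pderiv_at[OF assms(1)])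
  then have "((\<lambda>t::real. LINT x|lborel. F x) has_vector_derivative (LINT x|lborel. F' x)) (at 0)"
    unfolding shift(2) by simp
  moreover have "((\<lambda>t::real. LINT x|lborel. F x) has_vector_derivative 0) (at 0)"
    by (rule has_vector_derivative_const)
  ultimately show ?thesis by (metis vector_derivative_at)
qed

lemma integral_pderiv_compact_support:
  fixes F :: "'d::finite cfun"
  assumes "has_pderiv i F F'" "continuous_on UNIV F" "continuous_on UNIV F'"
    and "compact K" "\<And>x. x \<notin> K \<Longrightarrow> F x = 0" "\<And>x. x \<notin> K \<Longrightarrow> F' x = 0"
  shows "(LINT x|lborel. F' x) = 0"
proof -
  obtain R where R: "\<And>x. x \<in> K \<Longrightarrow> norm x \<le> R"
    using compact_imp_bounded[OF assms(4)] by (auto simp: bounded_iff)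
  have "bounded (F' ` K)"
    using assms(3,4) by (intro compact_imp_bounded compact_continuous_image) (auto intro: continuous_on_subset)
  then obtain B where B: "\<And>x. x \<in> K \<Longrightarrow> norm (F' x) \<le> B" by (auto simp: bounded_iff)
  \<comment> \<open>A shift by at most 1 keeps the support within radius R + 1.
    \<open>max B 0\<close> covers an empty \<open>K\<close>, where \<open>B\<close> may be
    negative.\<close>
  define w where "w x = indicator (cball 0 (R + 1)) x * max B 0" for x :: "real^'d"
  have "integrable lborel w"
    unfolding w_def 
    by (intro integrable_mult_left integrable_real_indicator emeasure_bounded_finite) auto
  moreover have "norm (F' (x + t *\<^sub>R axis i 1)) \<le> w x" if "\<bar>t\<bar> \<le> 1" for t x
  proof (cases "x + t *\<^sub>R axis i 1 \<in> K")
    case True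
    have "norm x \<le> norm (x + t *\<^sub>R axis i 1) + norm (t *\<^sub>R axis i 1 :: real^'d)"
      using norm_triangle_ineq4[of "x + t *\<^sub>R axis i 1" "t *\<^sub>R axis i 1"] by simp
    also have "\<dots> \<le> R + 1" using R[OF True] that by (simp add: norm_axis_1)
    finally show ?thesis using B[OF True] by (simp add: w_def)
  qed (simp add: assms(6) w_def)
  ultimately show ?thesis
    by (intro integral_pderiv_eq_0[OF assms(1) integrable_compact_support[OF assms(2,4,5)] assms(3)])
qed

lemma integral_by_parts_compact_support:
  fixes f g :: "'d::finite cfun"
  assumes "has_pderiv i f f'" "continuous_on UNIV f" "continuous_on UNIV f'"
    and "has_pderiv i g g'" "continuous_on UNIV g" "continuous_on UNIV g'"
    and "compact K" "\<And>x. x \<notin> K \<Longrightarrow> g x = 0" "\<And>x. x \<notin> K \<Longrightarrow> g' x = 0"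
  shows "(LINT x|lborel. f' x * g x) = - (LINT x|lborel. f x * g' x)"
proof -
  have "(LINT x|lborel. f x * g' x + f' x * g x) = 0"
    by (rule integral_pderiv_compact_support[OF has_pderiv_mult[OF assms(1,4)] _ _ assms(7)])
      (auto intro!: continuous_intros assms(1-6) simp: assms(8,9))
  moreover have "integrable lborel (\<lambda>x. f x * g' x)" "integrable lborel (\<lambda>x. f' x * g x)"
    by (rule integrable_compact_support[OF _ assms(7)]; auto intro!: continuous_intros assms(1-6) simp: assms(8,9))+
  ultimately show ?thesis by (simp add: eq_neg_iff_add_eq_0 add.commute)
qed

text \<open>\<open>E x\<close> integrates \<open>e\<close> along the i-th direction from the
  hyperplane of vanishing i-th coordinate up to x. Rescaling to the fixed interval [0,1] makes
  continuity in x an instance of continuity of parameter integrals.\<close>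

lemma continuous_primitive:
  fixes e :: "'d::finite cfun"
  assumes "continuous_on UNIV e"
  obtains E where "continuous_on UNIV E" "has_pderiv i E e"
proof -
  let ?e = "axis i 1 :: real^'d"
  define E where "E x = (x $ i) *\<^sub>R integral (cbox 0 1) (\<lambda>s. e (x + ((s - 1) * x $ i) *\<^sub>R ?e))" for x
  have cont: "continuous_on UNIV E"
    unfolding E_def
  proof (intro continuous_intros integral_continuous_on_param)
    have "continuous_on (UNIV \<times> cbox 0 1) (e \<circ> (\<lambda>(x, s). x + ((s - 1) * x $ i) *\<^sub>R ?e))"
      by (intro continuous_on_compose continuous_on_subset[OF assms])
        (auto simp: case_prod_beta intro!: continuous_intros)
    then show "continuous_on (UNIV \<times> cbox 0 1) (\<lambda>(x, s). e (x + ((s - 1) * x $ i) *\<^sub>R ?e))"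
      by (simp add: o_def case_prod_beta)
  qed
  have "((\<lambda>t. E (x + t *\<^sub>R ?e)) has_vector_derivative e x) (at 0)" for x
  proof -
    have "isCont (\<lambda>t. e (x + t *\<^sub>R ?e)) s" for s
    proof -
      have "continuous_on UNIV (\<lambda>t. e (x + t *\<^sub>R ?e))"
        by (intro continuous_on_compose2[OF assms] continuous_intros) auto
      then show ?thesis by (simp add: continuous_on_eq_continuous_at)
    qed
    then obtain G where G: "\<And>s. (G has_vector_derivative e (x + s *\<^sub>R ?e)) (at s)"
      using einterval_antiderivative[of "-\<infinity>" "\<infinity>" "\<lambda>t. e (x + t *\<^sub>R ?e)"] by auto
    \<comment> \<open>\<open>- (x $ i)\<close> is the parameter at which the line through x meets
      that hyperplane.\<close>
    have "E (x + t *\<^sub>R ?e) = G t - G (- (x $ i))" for t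
    proof -
      let ?a = "x $ i + t"
      have "((\<lambda>s. ?a *\<^sub>R e (x + (t + (s - 1) * ?a) *\<^sub>R ?e)) has_integral
          (G (t + (1 - 1) * ?a) - G (t + (0 - 1) * ?a))) {0..1}"
      proof (rule fundamental_theorem_of_calculus)
        fix s :: real
        have "((G \<circ> (\<lambda>s. t + (s - 1) * ?a)) has_vector_derivative
            ?a *\<^sub>R e (x + (t + (s - 1) * ?a) *\<^sub>R ?e)) (at s)"
          by (rule vector_diff_chain_at[OF _ G]) (auto intro!: derivative_eq_intros)
        then show "((\<lambda>s. G (t + (s - 1) * ?a)) has_vector_derivative
            ?a *\<^sub>R e (x + (t + (s - 1) * ?a) *\<^sub>R ?e)) (at s within {0..1})"
          by (simp add: o_def has_vector_derivative_at_within)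
      qed simp
      moreover have "t + (1 - 1) * ?a = t" "t + (0 - 1) * ?a = - (x $ i)" by simp_all
      ultimately have "integral {0..1} (\<lambda>s. ?a *\<^sub>R e (x + (t + (s - 1) * ?a) *\<^sub>R ?e)) = G t - G (- (x $ i))"
        by (metis integral_unique)
      moreover have shift: "(x + t *\<^sub>R ?e) + ((s - 1) * ?a) *\<^sub>R ?e = x + (t + (s - 1) * ?a) *\<^sub>R ?e" for s
        by (simp add: scaleR_add_left)
      moreover have "E (x + t *\<^sub>R ?e) = ?a *\<^sub>R integral {0..1} (\<lambda>s. e ((x + t *\<^sub>R ?e) + ((s - 1) * ?a) *\<^sub>R ?e))"
        by (simp add: E_def)
      ultimately show ?thesis unfolding shift by simp
    qed
    then show ?thesis
      using has_vector_derivative_diff[OF G[of 0] has_vector_derivative_const[of "G (- (x $ i))"]] by simp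
  qed
  then have "has_pderiv i E e" unfolding has_pderiv_def by blast
  with cont show ?thesis by (rule that)
qed

section \<open>Bump functions and mollification\<close>

text \<open>Numerators of the derivatives of exp(2 - 2/u), where u = 1 - t^2: differentiating
  p/u^(2n) times this exponential over the common denominator u^(2n+2) gives p' u^2 + 4 n t u p - 4
  t p.\<close>

fun bump_poly :: "nat \<Rightarrow> real poly" where
  "bump_poly 0 = 1"
| "bump_poly (Suc n) = pderiv (bump_poly n) * [:1, 0, -1:] ^ 2
     + [:0, 4 * real n:] * [:1, 0, -1:] * bump_poly n - [:0, 4:] * bump_poly n"

text \<open>For n = 0 this is the standard bump, and n counts its derivatives. The exponent 2 - 2/(1
  - t^2) vanishes at t = 0, which makes the bump equal to 1 there.\<close>

definition bump1 :: "nat \<Rightarrow> real \<Rightarrow> real" where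
  "bump1 n t = (if \<bar>t\<bar> < 1
     then poly (bump_poly n) t / (1 - t\<^sup>2) ^ (2 * n) * exp (2 - 2 / (1 - t\<^sup>2)) else 0)"

lemma bump1_outside: "1 \<le> \<bar>t\<bar> \<Longrightarrow> bump1 n t = 0"
  by (simp add: bump1_def)

lemma bump1_0_0: "bump1 0 0 = 1"
  by (simp add: bump1_def)

lemma bump1_nonneg: "0 \<le> bump1 0 t"
  by (simp add: bump1_def)

lemma bump1_le_1: "bump1 0 t \<le> 1"
proof (cases "\<bar>t\<bar> < 1")
  case True
  then have "t\<^sup>2 < 1" by (simp add: abs_square_less_1)
  then have "2 - 2 / (1 - t\<^sup>2) \<le> 0" by (simp add: field_simps)
  then show ?thesis using True by (simp add: bump1_def)
qed (simp add: bump1_def)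

text \<open>Near a boundary point the exponential beats the pole of order 2n in u = 1 - s^2, with
  two powers of u to spare. A quadratic bound is what differentiability of the extension by zero
  requires, including at 1 and -1.\<close>

lemma bump1_quadratic_bound:
  "\<exists>C. \<forall>s t. 1 \<le> \<bar>t\<bar> \<longrightarrow> \<bar>bump1 n s\<bar> \<le> C * (s - t)\<^sup>2"
proof -
  have "bounded (poly (bump_poly n) ` {-1..1})"
    by (intro compact_imp_bounded compact_continuous_image continuous_intros) auto
  then obtain M where M: "\<And>s. s \<in> {-1..1} \<Longrightarrow> \<bar>poly (bump_poly n) s\<bar> \<le> M"
    unfolding bounded_iff by (auto simp del: atLeastAtMost_iff)
  have "0 \<le> M" using M[of 0] by simp
  \<comment> \<open>Of these factors of u, 2n cancel the denominator in \<open>bump1 n\<close>; the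
    remaining two become the square in the claim.\<close>
  define N where "N = 2 * n + 2"
  have "\<bar>bump1 n s\<bar> \<le> M * exp 2 * real N ^ N * 4 * (s - t)\<^sup>2" if t: "1 \<le> \<bar>t\<bar>" for s t
  proof (cases "\<bar>s\<bar> < 1")
    case True
    define u where "u = 1 - s\<^sup>2"
    have u: "0 < u" using True by (simp add: u_def abs_square_less_1)
    \<comment> \<open>Aim: exp(-2/u) <= (N u)^N. It follows by inverting exp(2/u) >= (1 + (2/u)/N)^N
      >= (1/(N u))^N.\<close>
    have "(1 + (2 / u) / real N) ^ N \<le> exp (2 / u)"
      by (rule exp_ge_one_plus_x_over_n_power_n)
        (use u in \<open>auto simp: N_def intro: order_trans[of _ 0]\<close>)
    moreover have "(1 / (real N * u)) ^ N \<le> (1 + (2 / u) / real N) ^ N"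
    proof (intro power_mono)
      have "(2 / u) / real N = 2 * (1 / (real N * u))" by (simp add: field_simps)
      moreover have "0 \<le> 1 / (real N * u)" using u by simp
      ultimately show "1 / (real N * u) \<le> 1 + (2 / u) / real N" by linarith
    qed (use u in simp)
    ultimately have "1 / (real N * u) ^ N \<le> exp (2 / u)" by (simp add: power_divide)
    moreover have "0 < (real N * u) ^ N" using u by (simp add: N_def)
    moreover have "1 / b \<le> a" if "1 / a \<le> b" "0 < a" "0 < b" for a b :: real
      using that by (simp add: field_simps)
    ultimately have "1 / exp (2 / u) \<le> (real N * u) ^ N" by (metis exp_gt_zero)
    then have "exp (- (2 / u)) \<le> (real N * u) ^ N"
      by (simp add: exp_minus divide_inverse)
    then have e: "exp (2 - 2 / u) \<le> exp 2 * (real N * u) ^ N"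
      by (simp add: exp_diff exp_minus divide_inverse)
    \<comment> \<open>Since |s| < 1 <= |t|, the factor 1 - |s| is at most |s - t|, hence u <= 2 |s -
      t|.\<close>
    have "u = (1 - \<bar>s\<bar>) * (1 + \<bar>s\<bar>)"
      by (simp add: u_def algebra_simps power2_eq_square)
    also have "\<dots> \<le> \<bar>s - t\<bar> * 2"
      using True t by (intro mult_mono) auto
    finally have "u\<^sup>2 \<le> (\<bar>s - t\<bar> * 2)\<^sup>2"
      using u by (intro power_mono) auto
    then have u2: "u\<^sup>2 \<le> 4 * (s - t)\<^sup>2" by (simp add: power_mult_distrib)
    have "\<bar>bump1 n s\<bar> = \<bar>poly (bump_poly n) s\<bar> / u ^ (2 * n) * exp (2 - 2 / u)"
      using True u by (simp add: bump1_def u_def abs_mult)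
    also have "\<dots> \<le> M / u ^ (2 * n) * (exp 2 * (real N * u) ^ N)"
      using M[of s] True u e \<open>0 \<le> M\<close> abs_le_D1[of s 1] abs_le_D2[of s 1] by (intro mult_mono divide_right_mono) auto
    also have "\<dots> = M * exp 2 * real N ^ N * u\<^sup>2"
      using u by (simp add: N_def power_mult_distrib power_add power2_eq_square)
    also have "\<dots> \<le> M * exp 2 * real N ^ N * (4 * (s - t)\<^sup>2)"
      using u2 \<open>0 \<le> M\<close> by (intro mult_left_mono) auto
    finally show ?thesis by simp
  qed (use \<open>0 \<le> M\<close> in \<open>simp add: bump1_outside\<close>)
  then show ?thesis by blast
qed

lemma bump1_deriv: "(bump1 n has_real_derivative bump1 (Suc n) t) (at t)"
proof (cases "\<bar>t\<bar> < 1")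
  case True
  let ?p = "bump_poly n"
  let ?f = "\<lambda>t. poly ?p t / (1 - t\<^sup>2) ^ (2 * n) * exp (2 - 2 / (1 - t\<^sup>2))"
  define u where "u = 1 - t\<^sup>2"
  let ?E = "(poly (pderiv ?p) t * (1 / u) ^ (2 * n) + 4 * real n * t * u / u ^ (2 * n + 2) * poly ?p t) * exp (2 - 2 / u)
      + - 4 * t / u\<^sup>2 * exp (2 - 2 / u) * (poly ?p t * (1 / u) ^ (2 * n))"
  have u: "0 < u" using True by (simp add: u_def abs_square_less_1)
  have "((\<lambda>t. 1 / (1 - t\<^sup>2)) has_real_derivative 2 * t / u\<^sup>2) (at t)"
    using u by (auto simp: u_def power2_eq_square intro!: derivative_eq_intros)
  from DERIV_power[OF this, of "2 * n"]
  have inv: "((\<lambda>t. (1 / (1 - t\<^sup>2)) ^ (2 * n)) has_real_derivative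
      real (2 * n) * ((2 * t / u\<^sup>2) * (1 / u) ^ (2 * n - 1))) (at t)"
    by (simp add: u_def)
  have inv_eq: "real (2 * n) * ((2 * t / u\<^sup>2) * (1 / u) ^ (2 * n - 1)) = 4 * real n * t * u / u ^ (2 * n + 2)"
    using u by (cases n) (auto simp: field_simps power2_eq_square)
  have ex: "((\<lambda>t. exp (2 - 2 / (1 - t\<^sup>2))) has_real_derivative - 4 * t / u\<^sup>2 * exp (2 - 2 / u)) (at t)"
    using u by (auto simp: u_def power2_eq_square intro!: derivative_eq_intros)
  have "((\<lambda>t. poly ?p t * (1 / (1 - t\<^sup>2)) ^ (2 * n) * exp (2 - 2 / (1 - t\<^sup>2))) has_real_derivative
      ?E) (at t)"
    using DERIV_mult[OF DERIV_mult[OF poly_DERIV inv[unfolded inv_eq]] ex] by (simp add: u_def)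
  also have "(\<lambda>t. poly ?p t * (1 / (1 - t\<^sup>2)) ^ (2 * n) * exp (2 - 2 / (1 - t\<^sup>2))) = ?f"
    by (simp add: power_divide)
  also have "?E = bump1 (Suc n) t"
  proof -
    have "poly (bump_poly (Suc n)) t = poly (pderiv ?p) t * u\<^sup>2 + 4 * real n * t * u * poly ?p t - 4 * t * poly ?p t"
      by (simp add: u_def algebra_simps power2_eq_square)
    then have "bump1 (Suc n) t = (poly (pderiv ?p) t * u\<^sup>2 + 4 * real n * t * u * poly ?p t - 4 * t * poly ?p t)
        / u ^ (2 * n + 2) * exp (2 - 2 / u)"
      using True by (simp add: bump1_def u_def)
    also have "\<dots> = ?E"
      using u by (simp add: field_simps power_add power2_eq_square)
    finally show ?thesis ..
  qed
  finally have "(?f has_real_derivative bump1 (Suc n) t) (at t)" .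
  then show ?thesis
    by (rule has_field_derivative_transform_within_open[of _ _ _ "{-1<..<1}"])
      (use True in \<open>auto simp: bump1_def\<close>)
next
  case False
  then have t: "1 \<le> \<bar>t\<bar>" by simp
  obtain C where C: "\<And>s. \<bar>bump1 n s\<bar> \<le> C * (s - t)\<^sup>2"
    using bump1_quadratic_bound[of n] t by blast
  have "((\<lambda>s. (bump1 n s - bump1 n t) / (s - t)) \<longlongrightarrow> 0) (at t)"
  proof (rule Lim_null_comparison)
    show "\<forall>\<^sub>F s in at t. norm ((bump1 n s - bump1 n t) / (s - t)) \<le> C * \<bar>s - t\<bar>"
    proof (rule eventually_at_filter[THEN iffD2], rule always_eventually, intro allI impI)
      fix s assume "s \<noteq> t"
      then show "norm ((bump1 n s - bump1 n t) / (s - t)) \<le> C * \<bar>s - t\<bar>"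
        using C[of s] by (simp add: bump1_outside[OF t] field_simps power2_eq_square abs_mult[symmetric])
    qed
    have "((\<lambda>s. C * \<bar>s - t\<bar>) \<longlongrightarrow> C * \<bar>t - t\<bar>) (at t)" by (intro tendsto_intros)
    then show "((\<lambda>s. C * \<bar>s - t\<bar>) \<longlongrightarrow> 0) (at t)" by simp
  qed
  then show ?thesis
    by (simp add: has_field_derivative_iff bump1_outside[OF t])
qed

lemma continuous_bump1: "continuous_on S (bump1 n)"
  by (rule DERIV_continuous_on) (use bump1_deriv has_field_derivative_at_within in blast)

lemma bump1_bounded: "\<exists>B. \<forall>t. \<bar>bump1 n t\<bar> \<le> B"
proof -
  have "bounded (bump1 n ` {-1..1})"
    by (intro compact_imp_bounded compact_continuous_image continuous_bump1) auto
  then obtain B where B: "\<And>t. t \<in> {-1..1} \<Longrightarrow> \<bar>bump1 n t\<bar> \<le> B"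
    unfolding bounded_iff by (auto simp del: atLeastAtMost_iff)
  have "\<bar>bump1 n t\<bar> \<le> B" for t
  proof (cases "\<bar>t\<bar> \<le> 1")
    case False
    then show ?thesis using B[of 0] by (simp add: bump1_outside)
  qed (use B[of t] in \<open>simp add: abs_le_iff\<close>)
  then show ?thesis by blast
qed

lemma vec_line_nth: "(x + t *\<^sub>R axis i 1) $ j = (if j = i then x $ j + t else x $ j)"
  by (simp add: axis_def)

lemma has_pderiv_tensor:
  fixes h :: "'d::finite \<Rightarrow> real \<Rightarrow> complex"
  assumes "\<And>t. (h i has_vector_derivative h' t) (at t)"
  shows "has_pderiv i (\<lambda>x. \<Prod>j\<in>UNIV. h j (x $ j)) (\<lambda>x. \<Prod>j\<in>UNIV. (h(i := h')) j (x $ j))"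
  unfolding has_pderiv_def
proof
  fix x :: "real^'d"
  let ?c = "\<Prod>j\<in>UNIV - {i}. h j (x $ j)"
  have "(h i has_vector_derivative h' (x $ i)) (at (x $ i + 0))" using assms by simp
  moreover have "((\<lambda>t. x $ i + t) has_vector_derivative 1) (at 0)"
    by (auto intro!: derivative_eq_intros)
  ultimately have "((h i \<circ> (\<lambda>t. x $ i + t)) has_vector_derivative 1 *\<^sub>R h' (x $ i)) (at 0)"
    by (intro vector_diff_chain_at)
  then have "((\<lambda>t. h i (x $ i + t)) has_vector_derivative h' (x $ i)) (at 0)" by (simp add: o_def)
  then have "((\<lambda>t. h i (x $ i + t) * ?c) has_vector_derivative h' (x $ i) * ?c) (at 0)"
    by (auto intro!: derivative_eq_intros)
  moreover have "(\<Prod>j\<in>UNIV. h j ((x + t *\<^sub>R axis i 1) $ j)) = h i (x $ i + t) * ?c" for t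
    by (simp only: vec_line_nth) (simp add: prod.remove[of UNIV i])
  moreover have "(\<Prod>j\<in>UNIV. (h(i := h')) j (x $ j)) = h' (x $ i) * ?c"
    by (simp add: prod.remove[of UNIV i])
  ultimately show "((\<lambda>t. \<Prod>j\<in>UNIV. h j ((x + t *\<^sub>R axis i 1) $ j)) has_vector_derivative
      (\<Prod>j\<in>UNIV. (h(i := h')) j (x $ j))) (at 0)"
    by simp
qed

text \<open>The derivative of order \<open>k\<close> of the tensor product of the functions
  \<open>bump1 0 (c * t)\<close>; the powers of c come from the chain rule. Large c concentrates the
  bump for mollification, small c widens it into a cutoff.\<close>

definition bump :: "real \<Rightarrow> ('d::finite \<Rightarrow> nat) \<Rightarrow> 'd cfun" where
  "bump c k x = (\<Prod>i\<in>UNIV. complex_of_real (c ^ k i * bump1 (k i) (c * x $ i)))"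

lemma bump_has_pderiv: "has_pderiv i (bump c k) (bump c (inc i k))"
proof -
  let ?h = "\<lambda>j t. complex_of_real (c ^ k j * bump1 (k j) (c * t))"
  let ?h' = "\<lambda>t. complex_of_real (c ^ inc i k i * bump1 (inc i k i) (c * t))"
  have "((\<lambda>t. c ^ k i * bump1 (k i) (c * t)) has_real_derivative c ^ k i * (bump1 (Suc (k i)) (c * t) * c)) (at t)" for t
    by (intro DERIV_cmult DERIV_chain'[where f = "\<lambda>t. c * t"] bump1_deriv)
      (auto intro!: derivative_eq_intros)
  then have "(?h i has_vector_derivative ?h' t) (at t)" for t
  proof -
    have "c ^ k i * (bump1 (Suc (k i)) (c * t) * c) = c ^ inc i k i * bump1 (inc i k i) (c * t)" by simp
    then show ?thesis
      using \<open>((\<lambda>t. c ^ k i * bump1 (k i) (c * t)) has_real_derivative _) (at t)\<close>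
      by (intro has_vector_derivative_of_real) (simp only: has_real_derivative_iff_has_vector_derivative)
  qed
  from has_pderiv_tensor[of ?h i ?h', OF this]
  have "has_pderiv i (bump c k) (\<lambda>x. \<Prod>j\<in>UNIV. (?h(i := ?h')) j (x $ j))"
    unfolding bump_def[abs_def] .
  also have "(\<lambda>x. \<Prod>j\<in>UNIV. (?h(i := ?h')) j (x $ j)) = bump c (inc i k)"
    unfolding bump_def[abs_def] by (intro ext prod.cong) (auto simp: inc_apply)
  finally show ?thesis .
qed

lemma continuous_bump: "continuous_on UNIV (bump c k)"
  unfolding bump_def[abs_def]
  by (intro continuous_intros continuous_on_compose2[OF continuous_bump1[of UNIV]]) auto

lemma smoothI_family:
  fixes D :: "('d::{finite,linorder} \<Rightarrow> nat) \<Rightarrow> 'd cfun"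
  assumes "\<And>k. continuous_on UNIV (D k)" and "\<And>k i. has_pderiv i (D k) (D (inc i k))"
  shows "smooth (D zero_index)" and "mderiv k (D zero_index) = D k"
  using cont_derivsI_family[of D "D zero_index"] assms by (auto simp: smooth_def)

lemma
  fixes k l :: "'d::{finite,linorder} \<Rightarrow> nat"
  shows cont_derivs_const: "cont_derivs l (\<lambda>x. c)"
    and mderiv_const: "mderiv k (\<lambda>x. c) = (\<lambda>x. if k = zero_index then c else 0)"
proof -
  have hp: "has_pderiv i (\<lambda>x. if k = zero_index then c else 0) (\<lambda>x. if inc i k = zero_index then c else 0)"
    for i and k :: "'d \<Rightarrow> nat"
  proof -
    have "inc i k \<noteq> zero_index" by (metis inc_same nat.distinct(1))
    then show ?thesis by (simp add: has_pderiv_const)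
  qed
  from smoothI_family[of "\<lambda>k x. if k = zero_index then c else 0", OF _ hp]
  show "cont_derivs l (\<lambda>x. c)" "mderiv k (\<lambda>x. c) = (\<lambda>x. if k = zero_index then c else 0)"
    by (simp_all add: smooth_def)
qed

lemmas smooth_bump = smoothI_family(1)[OF continuous_bump bump_has_pderiv]
  and mderiv_bump = smoothI_family(2)[OF continuous_bump bump_has_pderiv]

lemma bump_bounded: "\<exists>B. \<forall>c\<ge>0. \<forall>x. norm (bump c k x) \<le> B * c ^ mdegree k"
proof -
  obtain B where B: "\<And>n t. \<bar>bump1 n t\<bar> \<le> B n" using bump1_bounded by metis
  have "norm (bump c k x) \<le> (\<Prod>i\<in>UNIV. B (k i)) * c ^ mdegree k" if "c \<ge> 0" for c x
  proof -
    have "norm (bump c k x) = (\<Prod>i\<in>UNIV. c ^ k i * \<bar>bump1 (k i) (c * x $ i)\<bar>)"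
      using that by (simp add: bump_def prod_norm[symmetric] norm_mult norm_power)
    also have "\<dots> \<le> (\<Prod>i\<in>UNIV. c ^ k i * B (k i))"
      using that B by (intro prod_mono) (auto intro: mult_left_mono)
    also have "\<dots> = (\<Prod>i\<in>UNIV. B (k i)) * c ^ mdegree k"
      by (simp add: prod.distrib power_sum mult.commute)
    finally show ?thesis .
  qed
  then show ?thesis by blast
qed

text \<open>The support lies in the cube of half-width 1/c. The Euclidean norm is at most the sum of
  the absolute coordinates, whence the factor \<open>CARD('d)\<close>.\<close>

lemma bump_outside:
  assumes "c > 0" "real CARD('d::finite) / c < norm x"
  shows "bump c k (x :: real^'d) = 0"
proof -
  have "\<exists>i. 1 / c \<le> \<bar>x $ i\<bar>"
  proof (rule ccontr)
    assume "\<not> ?thesis"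
    then have "(\<Sum>i\<in>UNIV. \<bar>x $ i\<bar>) \<le> (\<Sum>i\<in>(UNIV::'d set). 1 / c)"
      by (intro sum_mono) (auto simp: not_le less_imp_le)
    then show False using norm_le_l1_cart[of x] assms(2) by simp
  qed
  then obtain i where "1 / c \<le> \<bar>x $ i\<bar>" by blast
  then have "bump1 (k i) (c * x $ i) = 0"
    using assms(1) by (intro bump1_outside) (simp add: abs_mult field_simps)
  then show ?thesis by (auto simp: bump_def intro!: prod_zero)
qed

lemma integrable_bump:
  assumes "c > 0"
  shows "integrable lborel (bump c k)"
  by (rule integrable_compact_support[OF continuous_bump compact_cball[of 0]])
    (use bump_outside[OF assms] in \<open>auto simp: not_le\<close>)

text \<open>By continuity at 0, where it equals 1, the bump is at least 1/2 on a ball of positive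
  measure. Being real and nonnegative, it has the same integral \<open>N\<close> as its norm; a
  mollifier is normalized by this number.\<close>

lemma bump_integral_pos:
  assumes "c > 0"
  obtains N where "N > 0" "integral\<^sup>L lborel (bump c zero_index :: 'd::finite cfun) = complex_of_real N"
    "integral\<^sup>L lborel (\<lambda>x::real^'d. norm (bump c zero_index x)) = N"
proof -
  define f :: "real^'d \<Rightarrow> real" where "f x = (\<Prod>i\<in>UNIV. bump1 0 (c * x $ i))" for x
  have f: "bump c zero_index x = complex_of_real (f x)" for x :: "real^'d"
    by (simp add: bump_def f_def)
  have f_nonneg: "0 \<le> f x" for x by (simp add: f_def prod_nonneg bump1_nonneg)
  have int: "integrable lborel f"
    using integrable_bump[OF assms, of "zero_index :: 'd \<Rightarrow> nat"] by (simp add: f[abs_def] complex_of_real_integrable_eq)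
  have "continuous_on UNIV f"
    unfolding f_def by (intro continuous_intros continuous_on_compose2[OF continuous_bump1[of UNIV]]) auto
  then have "isCont f 0" by (simp add: continuous_on_eq_continuous_at)
  then obtain \<delta> where \<delta>: "\<delta> > 0" "\<And>x. norm x < \<delta> \<Longrightarrow> dist (f x) (f 0) < 1 / 2"
    unfolding continuous_at_eps_delta by (metis dist_0_norm dist_commute half_gt_zero zero_less_one)
  have "f 0 = 1" by (simp add: f_def bump1_0_0)
  then have half: "1 / 2 \<le> f x" if "norm x < \<delta>" for x
    using \<delta>(2)[OF that] by (simp add: dist_real_def abs_if split: if_splits)
  have fin: "emeasure lborel (ball (0::real^'d) \<delta>) < \<infinity>"
    by (rule emeasure_bounded_finite) auto
  have "0 < measure lborel (ball (0::real^'d) \<delta>) * (1 / 2)"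
    using content_ball_pos[OF \<delta>(1), of "0::real^'d"] by simp
  also have "\<dots> = (LINT x|lborel. indicator (ball (0::real^'d) \<delta>) x * (1 / 2))"
    using fin by simp
  also have "\<dots> \<le> (LINT x|lborel. f x)"
    using fin f_nonneg half
    by (intro integral_mono int integrable_mult_left integrable_real_indicator) (auto simp: indicator_def)
  finally have "0 < (LINT x|lborel. f x)" .
  then show ?thesis
  proof (rule that)
    have feq: "bump c zero_index = (\<lambda>x. complex_of_real (f x))" by (simp add: fun_eq_iff f)
    show "integral\<^sup>L lborel (bump c zero_index :: 'd cfun) = complex_of_real (LINT x|lborel. f x)"
      unfolding feq by simp
    show "integral\<^sup>L lborel (\<lambda>x::real^'d. norm (bump c zero_index x)) = (LINT x|lborel. f x)"
      unfolding feq using f_nonneg by simp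
  qed
qed

lemma continuous_on_integral:
  fixes F :: "'a::metric_space \<Rightarrow> 'b \<Rightarrow> complex"
  assumes "\<And>x. F x \<in> borel_measurable M" "\<And>z. continuous_on UNIV (\<lambda>x. F x z)"
    and "integrable M w" "\<And>x z. norm (F x z) \<le> w z"
  shows "continuous_on UNIV (\<lambda>x. LINT z|M. F x z)"
proof (rule continuous_on_sequentiallyI)
  fix u a assume u: "u \<longlonglongrightarrow> (a::'a)"
  have "(\<lambda>n. F (u n) z) \<longlonglongrightarrow> F a z" for z
    using assms(2)[of z] u by (simp add: continuous_on_sequentially o_def)
  then show "(\<lambda>n. LINT z|M. F (u n) z) \<longlonglongrightarrow> (LINT z|M. F a z)"
    using assms by (intro integral_dominated_convergence[where w = w]) auto
qed

section \<open>Convolution and mollification\<close>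

definition conv :: "'d::finite cfun \<Rightarrow> 'd cfun \<Rightarrow> 'd cfun" where
  "conv f g x = (LINT z|lborel. f z * g (x - z))"

lemma bounded_fun_bound: "bounded (range f) \<Longrightarrow> \<exists>B\<ge>0. \<forall>x. norm (f x) \<le> B"
  by (auto simp: bounded_pos dest: less_imp_le)

lemma
  fixes f g :: "'d::finite cfun"
  assumes f: "integrable lborel f" and g: "continuous_on UNIV g" "bounded (range g)"
  shows conv_integrable: "integrable lborel (\<lambda>z. f z * g (x - z))"
    and conv_continuous: "continuous_on UNIV (conv f g)"
proof -
  obtain B where B: "B \<ge> 0" "\<And>x. norm (g x) \<le> B" using bounded_fun_bound[OF g(2)] by blast
  have [measurable]: "f \<in> borel_measurable borel" "g \<in> borel_measurable borel"
    using borel_measurable_integrable[OF f] continuous_on_borel_measurable[OF g(1)] by auto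
  have w: "integrable lborel (\<lambda>z. B * norm (f z))" using f by simp
  have bound: "norm (f z * g (x - z)) \<le> B * norm (f z)" for x z
    using mult_left_mono[OF B(2)[of "x - z"] norm_ge_zero[of "f z"]] by (simp add: norm_mult mult.commute)
  show "integrable lborel (\<lambda>z. f z * g (x - z))"
    by (rule Bochner_Integration.integrable_bound[OF w]) (use bound B in auto)
  show "continuous_on UNIV (conv f g)"
    unfolding conv_def[abs_def]
    by (rule continuous_on_integral[OF _ _ w bound])
      (auto intro!: continuous_intros continuous_on_compose2[OF g(1)])
qed

text \<open>The derivative falls on the second factor, so \<open>f\<close> need only be integrable.
  With \<open>conv_commute\<close> either factor can be put in that place.\<close>

lemma conv_has_pderiv:
  fixes f g g' :: "'d::finite cfun"
  assumes f: "integrable lborel f" and g: "continuous_on UNIV g" "bounded (range g)"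
    and g': "continuous_on UNIV g'" "bounded (range g')" and deriv: "has_pderiv i g g'"
  shows "has_pderiv i (conv f g) (conv f g')"
  unfolding has_pderiv_def
proof
  fix x
  obtain B where B: "B \<ge> 0" "\<And>x. norm (g' x) \<le> B" using bounded_fun_bound[OF g'(2)] by blast
  have [measurable]: "f \<in> borel_measurable borel" "g' \<in> borel_measurable borel"
    using borel_measurable_integrable[OF f] continuous_on_borel_measurable[OF g'(1)] by auto
  have "((\<lambda>t. LINT z|lborel. f z * g (x + t *\<^sub>R axis i 1 - z)) has_vector_derivative
      (LINT z|lborel. f z * g' (x + 0 *\<^sub>R axis i 1 - z))) (at 0)"
  proof (rule has_vector_derivative_integral)
    show "integrable lborel (\<lambda>z. f z * g (x + t *\<^sub>R axis i 1 - z))" for t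
      by (rule conv_integrable[OF f g])
    show "((\<lambda>t. f z * g (x + t *\<^sub>R axis i 1 - z)) has_vector_derivative
        f z * g' (x + t *\<^sub>R axis i 1 - z)) (at t)" for t z
    proof -
      have "((\<lambda>t. g ((x - z) + t *\<^sub>R axis i 1)) has_vector_derivative g' ((x - z) + t *\<^sub>R axis i 1)) (at t)"
        by (rule has_pderiv_at[OF deriv])
      then have "((\<lambda>t. f z * g ((x - z) + t *\<^sub>R axis i 1)) has_vector_derivative
          f z * g' ((x - z) + t *\<^sub>R axis i 1)) (at t)"
        by (rule has_vector_derivative_mult_right)
      then show ?thesis by (simp add: algebra_simps)
    qed
    show "integrable lborel (\<lambda>z. B * norm (f z))" using f by simp
    show "norm (f z * g' (x + t *\<^sub>R axis i 1 - z)) \<le> B * norm (f z)" for t z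
      using mult_left_mono[OF B(2)[of "x + t *\<^sub>R axis i 1 - z"] norm_ge_zero[of "f z"]]
      by (simp add: norm_mult mult.commute)
  qed measurable
  then show "((\<lambda>t. conv f g (x + t *\<^sub>R axis i 1)) has_vector_derivative conv f g' x) (at 0)"
    by (simp add: conv_def)
qed

lemma conv_commute:
  fixes f g :: "'d::finite cfun"
  assumes [measurable]: "f \<in> borel_measurable borel" "g \<in> borel_measurable borel"
  shows "conv f g = conv g f"
proof
  fix x
  show "conv f g x = conv g f x"
    unfolding conv_def
    using lborel_integral_affine[of "-1" "\<lambda>z. f z * g (x - z)" x] by (simp add: mult.commute)
qed

lemma bounded_compact_support:
  fixes f :: "'a::topological_space \<Rightarrow> 'b::real_normed_vector"
  assumes "continuous_on UNIV f" "compact K" "\<And>x. x \<notin> K \<Longrightarrow> f x = 0"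
  shows "bounded (range f)"
proof -
  have "bounded (f ` K)"
    using assms(1,2) by (intro compact_imp_bounded compact_continuous_image) (auto intro: continuous_on_subset)
  then have "bounded (insert 0 (f ` K))" by simp
  then show ?thesis by (rule bounded_subset) (use assms(3) in blast)
qed

lemma bounded_bump: "c > 0 \<Longrightarrow> bounded (range (bump c k))"
  by (rule bounded_compact_support[OF continuous_bump compact_cball[of 0]])
    (use bump_outside in \<open>auto simp: not_le\<close>)

text \<open>Convolution with concentrating bumps. Written one way, the derivatives fall on the bump
  and give smoothness; written the other way, they fall on \<open>\<eta>\<close>, whose derivatives
  up to l are uniformly continuous, and give uniform convergence. One \<open>K'\<close> serves all
  n, so that later estimates run over a fixed compact set.\<close>

lemma test_function_approximation:
  fixes \<eta> :: "'d::{finite,linorder} cfun"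
  assumes \<eta>: "cont_derivs l \<eta>" and K: "compact K" "\<And>x. x \<notin> K \<Longrightarrow> \<eta> x = 0"
  obtains K' \<eta>s where "compact K'" "\<And>x. x \<notin> K' \<Longrightarrow> \<eta> x = 0"
    "\<And>n. \<eta>s n \<in> test_functions" "\<And>n x. x \<notin> K' \<Longrightarrow> \<eta>s n x = 0"
    "\<And>k. k \<le> l \<Longrightarrow> uniform_limit UNIV (\<lambda>n. mderiv k (\<eta>s n)) (mderiv k \<eta>) sequentially"
proof -
  let ?d = "real CARD('d)"
  obtain R where R: "\<And>x. x \<in> K \<Longrightarrow> norm x \<le> R" "0 \<le> R"
    using compact_imp_bounded[OF K(1)] by (metis bounded_pos less_imp_le)
  define c where "c n = real (Suc n)" for n
  have c: "0 < c n" "1 \<le> c n" for n by (auto simp: c_def)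
  have cd: "?d / c n \<le> ?d" for n
    using c[of n] by (simp add: divide_le_eq mult_le_cancel_left1)
  let ?b = "\<lambda>n. bump (c n) zero_index :: 'd cfun"
  \<comment> \<open>The bumps do not have mass 1; division by \<open>N n\<close> normalizes
    them.\<close>
  define N where "N n = integral\<^sup>L lborel (\<lambda>x. norm (?b n x))" for n
  have "N n > 0 \<and> integral\<^sup>L lborel (?b n) = complex_of_real (N n)" for n
  proof -
    obtain N' where "N' > 0" "integral\<^sup>L lborel (?b n) = complex_of_real N'"
      "integral\<^sup>L lborel (\<lambda>x. norm (?b n x)) = N'"
      by (rule bump_integral_pos[OF c(1)[of n]])
    then show ?thesis unfolding N_def by metis
  qed
  then have N: "N n > 0" "integral\<^sup>L lborel (?b n) = complex_of_real (N n)" for n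
    by blast+
  let ?N = "\<lambda>n. inverse (complex_of_real (N n))"
  define \<eta>s where "\<eta>s n x = ?N n * conv \<eta> (?b n) x" for n x
  \<comment> \<open>The n-th bump vanishes beyond radius \<open>?d / c n\<close>, which is at most
    \<open>?d\<close>; this gives one ball for all n.\<close>
  let ?K' = "cball (0::(real, 'd) vec) (R + ?d)"
  have cont: "continuous_on UNIV (mderiv k \<eta>)" if "k \<le> l" for k
    using \<eta> that by (rule cont_derivs_continuous)
  have vanish: "mderiv k \<eta> x = 0" if "k \<le> l" "R < norm x" for k x
    by (rule mderiv_eq_0_outside[OF cont_derivs_mono[OF \<eta> that(1)] compact_imp_closed[OF K(1)] K(2)])
      (use R(1) that(2) in fastforce)+
  have bdd: "bounded (range (mderiv k \<eta>))" if "k \<le> l" for k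
    by (rule bounded_compact_support[OF cont[OF that] compact_cball[of 0 R]])
      (use vanish[OF that] in auto)
  have l0: "zero_index \<le> l" by (simp add: le_fun_def)
  have \<eta>_cont: "continuous_on UNIV \<eta>" using cont[OF l0] by simp
  have \<eta>_int: "integrable lborel \<eta>" by (rule integrable_compact_support[OF \<eta>_cont K])
  have fam: "continuous_on UNIV (\<lambda>x. ?N n * conv \<eta> (bump (c n) k) x)"
    "has_pderiv i (\<lambda>x. ?N n * conv \<eta> (bump (c n) k) x)
      (\<lambda>x. ?N n * conv \<eta> (bump (c n) (inc i k)) x)" for n k i
    by (intro continuous_intros conv_continuous has_pderiv_cmult conv_has_pderiv \<eta>_int
      continuous_bump bounded_bump c bump_has_pderiv)+
  have smooth: "smooth (\<eta>s n)" for n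
    using smoothI_family(1)[of "\<lambda>k x. ?N n * conv \<eta> (bump (c n) k) x", OF fam]
    unfolding \<eta>s_def[abs_def] .
  have supp: "\<eta>s n x = 0" if "x \<notin> ?K'" for n x
  proof -
    have "\<eta> z * ?b n (x - z) = 0" for z
    proof (cases "z \<in> K")
      case True
      have "?d / c n < norm (x - z)"
        using that R(1)[OF True] cd[of n] norm_triangle_ineq2[of x z] by auto
      then show ?thesis by (simp add: bump_outside[OF c(1)])
    qed (simp add: K(2))
    then have "(\<lambda>z. \<eta> z * ?b n (x - z)) = (\<lambda>z. 0)" by blast
    then show ?thesis by (simp only: \<eta>s_def conv_def Bochner_Integration.integral_zero mult_zero_right)
  qed
  have unif: "uniform_limit UNIV (\<lambda>n. mderiv k (\<eta>s n)) (mderiv k \<eta>) sequentially" if k: "k \<le> l" for k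
  proof -
    \<comment> \<open>Here the factors are exchanged, so that the derivatives fall on
      \<open>\<eta>\<close>; this is possible up to order l.\<close>
    have eq: "mderiv k (\<eta>s n) x = ?N n * conv (?b n) (mderiv k \<eta>) x" for n x
    proof -
      have "\<eta>s n = (\<lambda>x. ?N n * conv (?b n) (mderiv zero_index \<eta>) x)"
        unfolding \<eta>s_def[abs_def]
        by (subst conv_commute) (auto intro!: continuous_on_borel_measurable \<eta>_cont continuous_bump)
      moreover have "mderiv k (\<lambda>x. ?N n * conv (?b n) (mderiv zero_index \<eta>) x)
          = (\<lambda>x. ?N n * conv (?b n) (mderiv k \<eta>) x)"
        by (rule mderiv_family[where D = "\<lambda>k x. ?N n * conv (?b n) (mderiv k \<eta>) x", OF _ k])
          (intro has_pderiv_cmult conv_has_pderiv integrable_bump c cont bdd cont_derivs_has_pderiv[OF \<eta>];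
            blast intro: le_incD)
      ultimately show ?thesis by simp
    qed
    have "uniformly_continuous_on (cball 0 (R + 2 * ?d)) (mderiv k \<eta>)"
      by (rule compact_uniformly_continuous[OF continuous_on_subset[OF cont[OF k]]]) auto
    show ?thesis
    proof (rule uniform_limitI)
      fix e :: real assume "e > 0"
      then have e2: "e / 2 > 0" by simp
      obtain \<delta> where \<delta>: "\<delta> > 0"
        "\<And>x y. x \<in> cball 0 (R + 2 * ?d) \<Longrightarrow> y \<in> cball 0 (R + 2 * ?d) \<Longrightarrow> dist y x < \<delta> \<Longrightarrow>
          dist (mderiv k \<eta> y) (mderiv k \<eta> x) < e / 2"
        using uniformly_continuous_onE[OF \<open>uniformly_continuous_on _ _\<close> e2] by metis
      \<comment> \<open>For x beyond \<open>R + ?d\<close> both values vanish. Otherwise x and x - z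
        lie in the ball of radius \<open>R + 2 * ?d\<close>, on which uniform continuity is
        available.\<close>
      have close: "norm (mderiv k \<eta> (x - z) - mderiv k \<eta> x) \<le> e / 2" if "norm z < \<delta>" "norm z \<le> ?d" for x z
      proof (cases "norm x \<le> R + ?d")
        case True
        then show ?thesis
          using \<delta>(2)[of x "x - z"] that norm_triangle_ineq4[of x z] by (simp add: dist_norm norm_minus_commute[of z x])
      next
        case False
        then have "R < norm x" "R < norm (x - z)"
          using norm_triangle_ineq2[of x z] that by auto
        then show ?thesis using vanish[OF k] e2 by simp
      qed
      have "(\<lambda>n. ?d * inverse (real (Suc n))) \<longlonglongrightarrow> ?d * 0"
        by (intro tendsto_intros LIMSEQ_inverse_real_of_nat)
      then have "\<forall>\<^sub>F n in sequentially. ?d * inverse (real (Suc n)) < \<delta>"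
        by (intro order_tendstoD(2)) (use \<delta>(1) in auto)
      then show "\<forall>\<^sub>F n in sequentially. \<forall>x\<in>UNIV. dist (mderiv k (\<eta>s n) x) (mderiv k \<eta> x) < e"
      proof eventually_elim
        fix n assume "?d * inverse (real (Suc n)) < \<delta>"
        then have n: "?d / c n < \<delta>" by (simp add: c_def divide_inverse)
        have b: "integrable lborel (?b n)" by (rule integrable_bump[OF c(1)])
        show "\<forall>x\<in>UNIV. dist (mderiv k (\<eta>s n) x) (mderiv k \<eta> x) < e"
        proof
          fix x
          let ?D = "\<lambda>z. mderiv k \<eta> (x - z) - mderiv k \<eta> x"
          have i1: "integrable lborel (\<lambda>z. ?b n z * mderiv k \<eta> (x - z))"
            by (rule conv_integrable[OF b cont[OF k] bdd[OF k]])
          have "of_real (N n) * mderiv k \<eta> x = (LINT z|lborel. ?b n z * mderiv k \<eta> x)"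
            using b N(2)[of n] by simp
          then have "mderiv k \<eta> x = ?N n * (LINT z|lborel. ?b n z * mderiv k \<eta> x)"
            using N(1)[of n] by (simp add: field_simps)
          then have "mderiv k (\<eta>s n) x - mderiv k \<eta> x =
              ?N n * (conv (?b n) (mderiv k \<eta>) x - (LINT z|lborel. ?b n z * mderiv k \<eta> x))"
            unfolding eq by (simp add: right_diff_distrib)
          also have "conv (?b n) (mderiv k \<eta>) x - (LINT z|lborel. ?b n z * mderiv k \<eta> x) =
              (LINT z|lborel. ?b n z * ?D z)"
            unfolding conv_def right_diff_distrib
            by (rule Bochner_Integration.integral_diff[OF i1, symmetric]) (use b in simp)
          finally have "norm (mderiv k (\<eta>s n) x - mderiv k \<eta> x) =
              inverse (N n) * norm (LINT z|lborel. ?b n z * ?D z)"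
            using N(1)[of n] by (simp add: norm_mult norm_inverse)
          also have "norm (LINT z|lborel. ?b n z * ?D z) \<le> N n * (e / 2)"
          proof -
            have "norm (LINT z|lborel. ?b n z * ?D z) \<le>
                (LINT z|lborel. norm (?b n z * ?D z))"
              by (rule integral_norm_bound)
            also have "\<dots> \<le> (LINT z|lborel. norm (?b n z) * (e / 2))"
            proof (rule integral_mono)
              have "integrable lborel (\<lambda>z. ?b n z * mderiv k \<eta> (x - z) - ?b n z * mderiv k \<eta> x)"
                using i1 b by (intro Bochner_Integration.integrable_diff) auto
              then show "integrable lborel (\<lambda>z. norm (?b n z * ?D z))"
                by (simp add: right_diff_distrib)
              show "integrable lborel (\<lambda>z. norm (?b n z) * (e / 2))" using b by simp
              show "norm (?b n z * ?D z) \<le> norm (?b n z) * (e / 2)" for z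
              proof (cases "norm z \<le> ?d / c n")
                case True
                then show ?thesis
                  using mult_left_mono[OF close[of z x], of "norm (?b n z)"] n cd[of n] by (simp add: norm_mult)
              qed (simp add: bump_outside[OF c(1)])
            qed
            also have "\<dots> = N n * (e / 2)" using b by (simp add: N_def)
            finally show ?thesis .
          qed
          finally have "norm (mderiv k (\<eta>s n) x - mderiv k \<eta> x) \<le> e / 2"
            using N(1)[of n] by (simp add: field_simps)
          then show "dist (mderiv k (\<eta>s n) x) (mderiv k \<eta> x) < e"
            using \<open>e > 0\<close> by (simp add: dist_norm)
        qed
      qed
    qed
  qed
  show ?thesis
  proof (rule that[of ?K' \<eta>s])
    show "compact ?K'" by simp
    show "\<eta> x = 0" if "x \<notin> ?K'" for x
    proof (rule K(2))
      have "0 \<le> ?d" by simp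
      then show "x \<notin> K" using that R(1)[of x] by force
    qed
    show "\<eta>s n \<in> test_functions" for n
      unfolding test_functions_def using smooth[of n] supp[of _ n] compact_cball by blast
  qed (use supp unif in auto)
qed

section \<open>Products with generalized derivatives\<close>

lemma norm_integral_compact_support_le:
  fixes c h :: "'d::finite cfun"
  assumes "continuous_on UNIV c" "continuous_on UNIV h" "compact K" "\<And>x. x \<notin> K \<Longrightarrow> h x = 0"
    and "\<And>x. x \<in> K \<Longrightarrow> norm (c x) \<le> C" "\<And>x. norm (h x) \<le> e" "0 \<le> C"
  shows "norm (pairing c h) \<le> C * e * measure lborel K"
proof -
  have fin: "emeasure lborel K < \<infinity>"
    using assms(3) by (intro emeasure_bounded_finite compact_imp_bounded)
  have "norm (pairing c h) \<le> (LINT x|lborel. norm (c x * h x))"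
    by (rule integral_norm_bound)
  also have "\<dots> \<le> (LINT x|lborel. indicator K x * (C * e))"
  proof (rule integral_mono)
    show "integrable lborel (\<lambda>x. norm (c x * h x))"
      by (intro integrable_norm integrable_compact_support[OF _ assms(3)])
        (auto intro!: continuous_intros assms(1,2) simp: assms(4))
    show "integrable lborel (\<lambda>x. indicator K x * (C * e))"
      using fin assms(3) by (intro integrable_mult_left integrable_real_indicator) (auto simp: borel_compact)
    show "norm (c x * h x) \<le> indicator K x * (C * e)" for x
    proof (cases "x \<in> K")
      case True
      then show ?thesis
        using assms(5)[OF True] assms(6)[of x] assms(7) by (auto simp: norm_mult intro: mult_mono)
    qed (simp add: assms(4))
  qed
  also have "\<dots> = C * e * measure lborel K" using fin by simp
  finally show ?thesis .
qed

lemma continuous_bounded_on_compact: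
  fixes c :: "'a::topological_space \<Rightarrow> 'b::real_normed_vector"
  assumes "continuous_on UNIV c" "compact K"
  obtains C where "0 \<le> C" "\<And>x. x \<in> K \<Longrightarrow> norm (c x) \<le> C"
proof -
  have "bounded (c ` K)"
    using assms by (intro compact_imp_bounded compact_continuous_image) (auto intro: continuous_on_subset)
  then obtain C where "C > 0" "\<forall>y\<in>c ` K. norm y \<le> C" unfolding bounded_pos by blast
  then show ?thesis using that[of C] by auto
qed

lemma integrable_mult_mderiv:
  fixes c \<eta> :: "'d::{finite,linorder} cfun"
  assumes "continuous_on UNIV c" "cont_derivs l \<eta>" "compact K" "\<And>x. x \<notin> K \<Longrightarrow> \<eta> x = 0"
  shows "integrable lborel (\<lambda>x. c x * mderiv l \<eta> x)"
  by (intro integrable_compact_support[OF _ assms(3)] continuous_intros assms(1)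
      cont_derivs_continuous[OF assms(2)] order_refl)
    (simp add: mderiv_eq_0_outside[OF assms(2) compact_imp_closed[OF assms(3)] assms(4)])

text \<open>The error must be small for all n at once; the approximating null sequence may depend on
  the error.\<close>

lemma LIMSEQ_approximation:
  fixes x :: "nat \<Rightarrow> 'a::real_normed_vector"
  assumes "\<And>e. e > 0 \<Longrightarrow> \<exists>y. y \<longlonglongrightarrow> 0 \<and> (\<forall>n. norm (x n - y n) \<le> e)"
  shows "x \<longlonglongrightarrow> 0"
proof (rule tendstoI)
  fix e :: real assume "e > 0"
  then obtain y where y: "y \<longlonglongrightarrow> 0" "\<And>n. norm (x n - y n) \<le> e / 2"
    using assms[of "e / 2"] by auto
  have "\<forall>\<^sub>F n in sequentially. dist (y n) 0 < e / 2"
    using tendstoD[OF y(1), of "e / 2"] \<open>e > 0\<close> by simp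
  then show "\<forall>\<^sub>F n in sequentially. dist (x n) 0 < e"
  proof eventually_elim
    fix n assume "dist (y n) 0 < e / 2"
    then show "dist (x n) 0 < e"
      using y(2)[of n] norm_triangle_ineq[of "x n - y n" "y n"] by simp
  qed
qed

text \<open>As \<open>\<eta>\<close> is only of class \<open>C\<^sup>l\<close>, convergence on test functions does not apply to it directly. The bound on
  \<open>ds n\<close> that is uniform in \<open>n\<close> makes up for this: it controls the error of replacing \<open>\<eta>\<close> by test functions.\<close>

lemma integral_mderiv_mult_tendsto_0:
  fixes \<phi> \<eta> :: "'d::{finite,linorder} cfun"
  assumes ds: "\<And>n. continuous_on UNIV (ds n)" "\<And>n x. norm (ds n x) \<le> B x" and B: "continuous_on UNIV (B :: (real, 'd) vec \<Rightarrow> real)"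
    and \<phi>: "cont_derivs l \<phi>"
    and test: "\<And>\<psi>. \<psi> \<in> test_functions \<Longrightarrow> (\<lambda>n. pairing (ds n) (mderiv l (\<lambda>y. \<phi> y * \<psi> y))) \<longlonglongrightarrow> 0"
    and \<eta>: "cont_derivs l \<eta>" and K: "compact K" "\<And>x. x \<notin> K \<Longrightarrow> \<eta> x = 0"
  shows "(\<lambda>n. pairing (ds n) (mderiv l (\<lambda>y. \<phi> y * \<eta> y))) \<longlonglongrightarrow> 0"
proof (rule LIMSEQ_approximation, rule test_function_approximation[OF \<eta> K])
  fix e :: real and K' and \<eta>s
  assume e: "e > 0" and K': "compact K'" "\<And>x. x \<notin> K' \<Longrightarrow> \<eta> x = 0"
    and \<eta>s: "\<And>n. \<eta>s n \<in> test_functions" "\<And>n x. x \<notin> K' \<Longrightarrow> \<eta>s n x = 0"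
    and unif: "\<And>k. k \<le> l \<Longrightarrow> uniform_limit UNIV (\<lambda>n. mderiv k (\<eta>s n)) (mderiv k \<eta>) sequentially"
  let ?p = "mderiv l (\<lambda>y. \<phi> y * \<eta> y)" and ?q = "\<lambda>n. mderiv l (\<lambda>y. \<phi> y * \<eta>s n y)"
  have s: "cont_derivs l (\<eta>s n)" for n using \<eta>s(1)[of n] by (simp add: test_functions_def smooth_def)
  have \<phi>s: "cont_derivs l (\<lambda>y. \<phi> y * \<eta>s n y)" for n by (rule cont_derivs_mult[OF \<phi> s])
  have \<phi>\<eta>: "cont_derivs l (\<lambda>y. \<phi> y * \<eta> y)" by (rule cont_derivs_mult[OF \<phi> \<eta>])
  obtain C where C: "0 \<le> C" "\<And>x. x \<in> K' \<Longrightarrow> norm (B x) \<le> C"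
    by (rule continuous_bounded_on_compact[OF B K'(1)]) blast
  \<comment> \<open>The added 1 keeps the divisor positive when C or the measure of
    \<open>K'\<close> is 0.\<close>
  define A where "A = C * measure lborel K' + 1"
  have A: "0 < A" using C(1) by (simp add: A_def add_nonneg_pos)
  have "uniform_limit K' ?q ?p sequentially"
    by (rule uniform_limit_mderiv_mult[OF K'(1) \<phi> s \<eta> uniform_limit_on_subset[OF unif]]) auto
  moreover have "e / A > 0" using e A by simp
  ultimately have "\<forall>\<^sub>F j in sequentially. \<forall>x\<in>K'. dist (?q j x) (?p x) < e / A"
    by (rule uniform_limitD)
  then obtain j where j: "\<And>x. x \<in> K' \<Longrightarrow> dist (?q j x) (?p x) < e / A"
    by (auto simp: eventually_sequentially)
  have out: "?q j x = 0" "?p x = 0" if "x \<notin> K'" for x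
    by (rule mderiv_eq_0_outside[OF _ compact_imp_closed[OF K'(1)] _ that]; use \<phi>s \<phi>\<eta> \<eta>s(2) K'(2) in simp)+
  have bound: "norm (?p x - ?q j x) \<le> e / A" for x
  proof (cases "x \<in> K'")
    case True
    then show ?thesis using j[OF True] by (simp add: dist_norm norm_minus_commute less_imp_le)
  next
    case False
    then show ?thesis using e A by (simp add: out)
  qed
  show "\<exists>y. y \<longlonglongrightarrow> 0 \<and> (\<forall>n. norm ((pairing (ds n) ?p) - y n) \<le> e)"
  proof (intro exI conjI allI)
    show "(\<lambda>n. pairing (ds n) (?q j)) \<longlonglongrightarrow> 0"
      by (rule test[OF \<eta>s(1)])
    fix n
    have int: "integrable lborel (\<lambda>x. ds n x * ?p x)"
      "integrable lborel (\<lambda>x. ds n x * ?q j x)"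
      by (rule integrable_mult_mderiv[OF ds(1) _ K'(1)]; use \<phi>s \<phi>\<eta> \<eta>s(2) K'(2) in simp)+
    have "norm (LINT x|lborel. ds n x * (?p x - ?q j x))
        \<le> C * (e / A) * measure lborel K'"
    proof (rule norm_integral_compact_support_le[OF ds(1) _ K'(1) _ _ bound C(1)])
      show "continuous_on UNIV (\<lambda>x. ?p x - ?q j x)"
        by (intro continuous_intros cont_derivs_continuous[OF \<phi>\<eta> order_refl] cont_derivs_continuous[OF \<phi>s order_refl])
      show "norm (ds n x) \<le> C" if "x \<in> K'" for x
        using ds(2)[of n x] C(2)[OF that] by (simp add: abs_le_iff)
    qed (simp add: out)
    also have "\<dots> = (C * measure lborel K') / A * e" by (simp add: mult_ac)
    also have "\<dots> \<le> 1 * e" using A e by (intro mult_right_mono) (auto simp: A_def)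
    finally show "norm ((pairing (ds n) ?p)
        - (pairing (ds n) (?q j))) \<le> e"
      using int by (simp add: right_diff_distrib)
  qed
qed

text \<open>The constant sequence with factor 1 in the preceding limit statement: vanishing on test
  functions extends to compactly supported functions of class C^l.\<close>

lemma integral_mderiv_eq_0:
  fixes c :: "'d::{finite,linorder} cfun"
  assumes c: "continuous_on UNIV c"
    and zero: "\<And>\<psi>. \<psi> \<in> test_functions \<Longrightarrow> (pairing c (mderiv l \<psi>)) = 0"
    and \<eta>: "cont_derivs l \<eta>" and K: "compact K" "\<And>x. x \<notin> K \<Longrightarrow> \<eta> x = 0"
  shows "(pairing c (mderiv l \<eta>)) = 0"
proof -
  have "(\<lambda>n::nat. pairing c (mderiv l (\<lambda>y. 1 * \<eta> y))) \<longlonglongrightarrow> 0"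
    by (rule integral_mderiv_mult_tendsto_0[OF c order_refl continuous_on_norm[OF c] cont_derivs_const _ \<eta> K])
      (simp_all add: zero)
  then show ?thesis by (simp add: LIMSEQ_const_iff)
qed

text \<open>The generalized product \<open>\<phi> \<partial>\<^sup>l c\<close> is again of the form \<open>\<partial>\<^sup>l e\<close>: one uses
  \<open>\<phi> \<partial>\<^sub>i b = \<partial>\<^sub>i (\<phi> b) - (\<partial>\<^sub>i \<phi>) b\<close> repeatedly, writing the last term as \<open>\<partial>\<^sub>i\<close> of a primitive.\<close>

lemma product_representation:
  fixes c \<phi> :: "'d::{finite,linorder} cfun"
  assumes c: "continuous_on UNIV c" and "cont_derivs l \<phi>"
  shows "\<exists>e. continuous_on UNIV e \<and> (\<forall>\<eta> K. cont_derivs l \<eta> \<longrightarrow> compact K \<longrightarrow> (\<forall>x. x \<notin> K \<longrightarrow> \<eta> x = 0) \<longrightarrow>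
    (pairing c (mderiv l (\<lambda>y. \<phi> y * \<eta> y))) = (pairing e (mderiv l \<eta>)))"
  using assms(2)
proof (induction l arbitrary: \<phi> rule: multiindex_induct)
  case zero
  then show ?case
    using continuous_on_mult[OF c cont_derivs_imp_continuous[OF zero.prems]]
    by (intro exI[of _ "\<lambda>x. c x * \<phi> x"]) (simp add: mult.assoc)
next
  case (inc l i)
  note \<phi> = inc.prems
  \<comment> \<open>\<open>e2\<close> represents the product with \<open>\<phi>\<close> and, below,
    \<open>e1\<close> the one with \<open>pderiv1 i \<phi>\<close>; both at order l only.\<close>
  obtain e2 where e2: "continuous_on UNIV e2"
    "\<And>\<eta> K. cont_derivs l \<eta> \<Longrightarrow> compact K \<Longrightarrow> \<forall>x. x \<notin> K \<longrightarrow> \<eta> x = 0 \<Longrightarrow>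
      (pairing c (mderiv l (\<lambda>y. \<phi> y * \<eta> y))) = (pairing e2 (mderiv l \<eta>))"
    using inc.IH[OF cont_derivs_incD[OF \<phi>]] by blast
  obtain e1 where e1: "continuous_on UNIV e1"
    "\<And>\<eta> K. cont_derivs l \<eta> \<Longrightarrow> compact K \<Longrightarrow> \<forall>x. x \<notin> K \<longrightarrow> \<eta> x = 0 \<Longrightarrow>
      (pairing c (mderiv l (\<lambda>y. pderiv1 i \<phi> y * \<eta> y))) = (pairing e1 (mderiv l \<eta>))"
    using inc.IH[OF cont_derivs_inc[OF \<phi>]] by blast
  obtain E where E: "continuous_on UNIV E" "has_pderiv i E e1"
    using continuous_primitive[OF e1(1)] .
  show ?case
  \<comment> \<open>\<open>e2\<close> already pairs with the derivative of order l of
    \<open>pderiv1 i \<eta>\<close>. For \<open>e1\<close>, partial integration against its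
    primitive \<open>E\<close> raises the order by one and produces the minus sign.\<close>
  proof (intro exI[of _ "\<lambda>x. e2 x - E x"] conjI allI impI)
    show "continuous_on UNIV (\<lambda>x. e2 x - E x)" by (intro continuous_intros e2(1) E(1))
    fix \<eta> K assume \<eta>: "cont_derivs (inc i l) \<eta>" and K: "compact K" "\<forall>x. x \<notin> K \<longrightarrow> \<eta> x = 0"
    note van = mderiv_eq_0_outside[OF _ compact_imp_closed[OF K(1)]]
    have \<eta>l: "cont_derivs l \<eta>" by (rule cont_derivs_incD[OF \<eta>])
    have \<eta>i: "cont_derivs l (pderiv1 i \<eta>)" by (rule cont_derivs_inc[OF \<eta>])
    have \<phi>l: "cont_derivs l \<phi>" by (rule cont_derivs_incD[OF \<phi>])
    have \<phi>i: "cont_derivs l (pderiv1 i \<phi>)" by (rule cont_derivs_inc[OF \<phi>])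
    have \<eta>i0: "\<forall>x. x \<notin> K \<longrightarrow> pderiv1 i \<eta> x = 0"
    proof (intro allI impI)
      fix x assume "x \<notin> K"
      have "cont_derivs (inc i zero_index) \<eta>"
        by (rule cont_derivs_mono[OF \<eta>]) (simp add: le_fun_def inc_apply)
      from van[OF this, of x] \<open>x \<notin> K\<close> K(2) show "pderiv1 i \<eta> x = 0"
        using mderiv_pderiv1[OF \<open>cont_derivs (inc i zero_index) \<eta>\<close> order_refl] by simp
    qed
    have integrable: "integrable lborel (\<lambda>x. a x * mderiv k h x)"
      if "continuous_on UNIV a" "cont_derivs k h" "\<forall>x. x \<notin> K \<longrightarrow> h x = 0" for a k h
      using that(3)
      by (intro integrable_compact_support[OF _ K(1)] continuous_intros that(1) cont_derivs_continuous[OF that(2)])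
        (auto intro: van[OF that(2)])
    have "(pairing c (mderiv (inc i l) (\<lambda>y. \<phi> y * \<eta> y))) =
        (LINT x|lborel. c x * mderiv l (\<lambda>x. \<phi> x * pderiv1 i \<eta> x) x + c x * mderiv l (\<lambda>x. pderiv1 i \<phi> x * \<eta> x) x)"
      by (simp add: mderiv_mult_inc[OF \<phi> \<eta>] distrib_left)
    also have "\<dots> = (pairing c (mderiv l (\<lambda>x. \<phi> x * pderiv1 i \<eta> x)))
        + (pairing c (mderiv l (\<lambda>x. pderiv1 i \<phi> x * \<eta> x)))"
      by (intro Bochner_Integration.integral_add integrable c cont_derivs_mult \<phi>l \<phi>i \<eta>l \<eta>i)
        (use K(2) \<eta>i0 in auto)
    also have "\<dots> = (pairing e2 (mderiv l (pderiv1 i \<eta>))) + (pairing e1 (mderiv l \<eta>))"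
      by (simp only: e2(2)[OF \<eta>i K(1) \<eta>i0] e1(2)[OF \<eta>l K])
    also have "(pairing e1 (mderiv l \<eta>)) = - (pairing E (mderiv (inc i l) \<eta>))"
      by (intro integral_by_parts_compact_support[OF E(2,1) e1(1) cont_derivs_has_pderiv[OF \<eta> order_refl] _ _ K(1)]
        cont_derivs_continuous[OF \<eta>l order_refl] cont_derivs_continuous[OF \<eta> order_refl] van \<eta>l \<eta>)
        (use K(2) in auto)
    also have "mderiv l (pderiv1 i \<eta>) = mderiv (inc i l) \<eta>"
      by (rule mderiv_pderiv1[OF \<eta> order_refl])
    also have "(pairing e2 (mderiv (inc i l) \<eta>)) + - (pairing E (mderiv (inc i l) \<eta>)) =
        (LINT x|lborel. (e2 x - E x) * mderiv (inc i l) \<eta> x)"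
      using integrable[OF e2(1) \<eta> K(2)] integrable[OF E(1) \<eta> K(2)] by (simp add: left_diff_distrib)
    finally show "(pairing c (mderiv (inc i l) (\<lambda>y. \<phi> y * \<eta> y))) =
        (LINT x|lborel. (e2 x - E x) * mderiv (inc i l) \<eta> x)" .
  qed
qed

lemma test_functionE:
  assumes "\<psi> \<in> test_functions"
  obtains K where "cont_derivs l \<psi>" "compact K" "\<And>x. x \<notin> K \<Longrightarrow> \<psi> x = 0"
  using assms unfolding test_functions_def smooth_def by blast

text \<open>The representative hidden in \<open>is_product\<close> may be exchanged for any other:
  their difference annihilates test functions, and hence also \<open>\<phi>\<close> times
  \<open>\<psi>\<close>.\<close>

lemma is_product_formula:
  fixes \<phi> :: "'d::{finite,linorder} cfun"
  assumes p: "is_product l b \<phi> p"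
    and c: "continuous_on UNIV c" "\<And>\<psi>. \<psi> \<in> test_functions \<Longrightarrow> b \<psi> = gderiv l c \<psi>"
    and \<psi>: "\<psi> \<in> test_functions"
  shows "p \<psi> = (- 1) ^ mdegree l * (pairing c (mderiv l (\<lambda>y. \<phi> y * \<psi> y)))"
proof -
  from p obtain c0 where \<phi>: "cont_derivs l \<phi>" and c0: "continuous_on UNIV c0"
    "\<And>\<psi>. \<psi> \<in> test_functions \<Longrightarrow> b \<psi> = gderiv l c0 \<psi>"
    "\<And>\<psi>. \<psi> \<in> test_functions \<Longrightarrow>
      p \<psi> = (- 1) ^ mdegree l * (pairing c0 (mderiv l (\<lambda>y. \<phi> y * \<psi> y)))"
    unfolding is_product_def by blast
  let ?m = "mderiv l (\<lambda>y. \<phi> y * \<psi> y)"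
  obtain K where K: "cont_derivs l \<psi>" "compact K" "\<And>x. x \<notin> K \<Longrightarrow> \<psi> x = 0"
    by (rule test_functionE[OF \<psi>, of l]) blast
  have \<phi>\<psi>: "cont_derivs l (\<lambda>y. \<phi> y * \<psi> y)" by (rule cont_derivs_mult[OF \<phi> K(1)])
  \<comment> \<open>The product of \<open>\<phi>\<close> and \<open>\<psi>\<close> is of class C^l
    but need not be smooth, so \<open>integral_mderiv_eq_0\<close> is called for.\<close>
  have "(LINT x|lborel. (c0 x - c x) * ?m x) = 0"
  proof (rule integral_mderiv_eq_0[OF _ _ \<phi>\<psi> K(2)])
    show "continuous_on UNIV (\<lambda>x. c0 x - c x)" by (intro continuous_intros c c0)
    fix \<eta> :: "'d cfun" assume \<eta>: "\<eta> \<in> test_functions"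
    obtain L where L: "cont_derivs l \<eta>" "compact L" "\<And>x. x \<notin> L \<Longrightarrow> \<eta> x = 0"
      by (rule test_functionE[OF \<eta>, of l]) blast
    have "(pairing c0 (mderiv l \<eta>)) = (pairing c (mderiv l \<eta>))"
      using c(2)[OF \<eta>] c0(2)[OF \<eta>] by (simp add: gderiv_def)
    then show "(LINT x|lborel. (c0 x - c x) * mderiv l \<eta> x) = 0"
      using integrable_mult_mderiv[OF c0(1) L] integrable_mult_mderiv[OF c(1) L]
      by (simp add: left_diff_distrib)
  qed (simp add: K(3))
  moreover have "integrable lborel (\<lambda>x. c0 x * ?m x)"
    "integrable lborel (\<lambda>x. c x * ?m x)"
    by (rule integrable_mult_mderiv[OF _ \<phi>\<psi> K(2)]; simp add: c0(1) c(1) K(3))+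
  ultimately show ?thesis
    using c0(3)[OF \<psi>] by (simp add: left_diff_distrib)
qed

section \<open>The Schwartz space\<close>

text \<open>A product over the coordinates instead of a power of 1 + |x|^2: the reciprocal is then a
  tensor product, and its integrability reduces to that of 1/(1 + t^2) on the line.\<close>

abbreviation weight :: "nat \<Rightarrow> real ^ 'd::finite \<Rightarrow> real" where
  "weight M x \<equiv> (\<Prod>i\<in>UNIV. (1 + (x $ i)\<^sup>2) ^ M)"

lemma weight_pos: "0 < weight M x"
  by (intro prod_pos) (simp add: add_pos_nonneg)

lemma weight_Suc: "weight (Suc M) x = weight M x * weight 1 x"
  by (simp add: prod.distrib mult.commute)

text \<open>Each factor satisfies (1 + u)^M <= 2^M (1 + u^M) with u the square of a coordinate.
  Expanding the product over subsets \<open>A\<close> leaves the monomials with exponent 2M on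
  \<open>A\<close>, so the monomial seminorms control all weights.\<close>

lemma weight_le_monomials:
  fixes x :: "real ^ 'd::finite" and y :: complex
  shows "weight M x * norm y \<le>
    2 ^ (M * CARD('d)) * (\<Sum>A\<in>Pow UNIV. norm (monomial (\<lambda>i. if i \<in> A then 2 * M else 0) x * y))"
proof -
  let ?m = "\<lambda>A. monomial (\<lambda>i. if i \<in> A then 2 * M else 0)"
  have one: "(1 + u) ^ M \<le> 2 ^ M * (1 + u ^ M)" if "0 \<le> u" for u :: real
  proof (cases "u \<le> 1")
    case True
    then have "(1 + u) ^ M \<le> 2 ^ M" using that by (intro power_mono) auto
    also have "\<dots> \<le> 2 ^ M * (1 + u ^ M)" using that by simp
    finally show ?thesis .
  next
    case False
    then have "(1 + u) ^ M \<le> (2 * u) ^ M" using that by (intro power_mono) auto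
    also have "\<dots> \<le> 2 ^ M * (1 + u ^ M)" by (simp add: power_mult_distrib)
    finally show ?thesis .
  qed
  have "weight M x \<le> (\<Prod>i\<in>UNIV. 2 ^ M * (1 + ((x $ i)\<^sup>2) ^ M))"
    by (intro prod_mono conjI one) auto
  also have "\<dots> = 2 ^ (M * CARD('d)) * (\<Prod>i\<in>UNIV. ((x $ i)\<^sup>2) ^ M + 1)"
    by (simp add: prod.distrib power_mult add.commute)
  also have "(\<Prod>i\<in>UNIV. ((x $ i)\<^sup>2) ^ M + 1) = (\<Sum>A\<in>Pow UNIV. \<Prod>i\<in>A. ((x $ i)\<^sup>2) ^ M)"
    by (subst prod_add) auto
  also have "\<dots> = (\<Sum>A\<in>Pow UNIV. norm (?m A x))"
  proof (rule sum.cong[OF refl])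
    fix A :: "'d set"
    have "norm (?m A x) = (\<Prod>i\<in>UNIV. if i \<in> A then ((x $ i)\<^sup>2) ^ M else 1)"
      unfolding monomial_def norm_of_real abs_prod
      by (intro prod.cong) (auto simp: power_mult power_abs)
    also have "\<dots> = (\<Prod>i\<in>A. ((x $ i)\<^sup>2) ^ M)"
      by (simp add: prod.If_cases)
    finally show "(\<Prod>i\<in>A. ((x $ i)\<^sup>2) ^ M) = norm (?m A x)" ..
  qed
  finally have "weight M x \<le> 2 ^ (M * CARD('d)) * (\<Sum>A\<in>Pow UNIV. norm (?m A x))" .
  then have "weight M x * norm y \<le>
      2 ^ (M * CARD('d)) * (\<Sum>A\<in>Pow UNIV. norm (?m A x)) * norm y"
    by (intro mult_right_mono) auto
  then show ?thesis by (simp add: norm_mult sum_distrib_right mult.assoc)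
qed

lemma rapid_decay:
  assumes "\<And>a. bounded (range (\<lambda>x. monomial a x * f x))"
  shows "\<exists>C\<ge>0. \<forall>x. weight M x * norm (f x) \<le> C"
proof -
  have "\<exists>B\<ge>0. \<forall>x. norm (monomial a x * f x) \<le> B" for a
    by (rule bounded_fun_bound[OF assms])
  then obtain B where B: "\<And>a. 0 \<le> B a" "\<And>a x. norm (monomial a x * f x) \<le> B a" by metis
  let ?C = "2 ^ (M * CARD('a)) * (\<Sum>A\<in>Pow UNIV. B (\<lambda>i. if i \<in> A then 2 * M else 0))"
  have "weight M x * norm (f x) \<le> ?C" for x
    by (rule order_trans[OF weight_le_monomials]) (intro mult_left_mono sum_mono B, simp)
  moreover have "0 \<le> ?C" by (simp add: B sum_nonneg)
  ultimately show ?thesis by blast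
qed

section \<open>Uniformly null sequences of functions\<close>

abbreviation unif_null :: "(nat \<Rightarrow> 'a \<Rightarrow> 'b::real_normed_vector) \<Rightarrow> bool" where
  "unif_null fs \<equiv> uniform_limit UNIV fs (\<lambda>_. 0) sequentially"

lemma unif_null_add: "unif_null fs \<Longrightarrow> unif_null gs \<Longrightarrow> unif_null (\<lambda>n x. fs n x + gs n x)"
  by (drule (1) uniform_limit_add) simp

lemma unif_null_cmult:
  fixes fs :: "nat \<Rightarrow> 'a \<Rightarrow> 'b::real_normed_algebra"
  shows "unif_null fs \<Longrightarrow> unif_null (\<lambda>n x. c * fs n x)"
  by (drule bounded_linear.uniform_limit[OF bounded_linear_mult_right[of c]]) simp

lemma unif_null_bound:
  assumes "unif_null gs" "\<And>n x. norm (fs n x) \<le> norm (gs n x)"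
  shows "unif_null fs"
proof (rule uniform_limitI)
  fix e :: real assume "e > 0"
  from uniform_limitD[OF assms(1) this]
  show "\<forall>\<^sub>F n in sequentially. \<forall>x\<in>UNIV. dist (fs n x) 0 < e"
    by eventually_elim (use assms(2) in \<open>auto intro: le_less_trans\<close>)
qed

lemma unif_null_sum:
  assumes "finite A" "\<And>a. a \<in> A \<Longrightarrow> unif_null (fs a)"
  shows "unif_null (\<lambda>n x. \<Sum>a\<in>A. fs a n x)"
  using assms
proof (induction A rule: finite_induct)
  case empty
  then show ?case by (simp add: uniform_limit_iff)
next
  case (insert a A)
  then show ?case by (simp add: unif_null_add)
qed

lemma unif_null_norm: "unif_null fs \<Longrightarrow> unif_null (\<lambda>n x. norm (fs n x))"
  by (rule unif_null_bound) auto

lemma unif_null_weight: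
  fixes fs :: "nat \<Rightarrow> 'd::finite cfun"
  assumes "\<And>a. unif_null (\<lambda>n x. monomial a x * fs n x)"
  shows "unif_null (\<lambda>n x. weight M x * norm (fs n x))"
proof (rule unif_null_bound)
  show "unif_null (\<lambda>n x. 2 ^ (M * CARD('d)) *
      (\<Sum>A\<in>Pow UNIV. norm (monomial (\<lambda>i. if i \<in> A then 2 * M else 0) x * fs n x)))"
    by (intro unif_null_cmult unif_null_sum unif_null_norm assms) auto
  show "norm (weight M x * norm (fs n x)) \<le> norm (2 ^ (M * CARD('d)) *
      (\<Sum>A\<in>Pow UNIV. norm (monomial (\<lambda>i. if i \<in> A then 2 * M else 0) x * fs n x)))" for n x
  proof -
    have "0 \<le> weight M x * norm (fs n x)" using weight_pos[where M=M and x=x] by simp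
    then show ?thesis using weight_le_monomials[where M=M and x=x and y="fs n x"] by (simp only: real_norm_def abs_of_nonneg)
  qed
qed

section \<open>Stability of the Schwartz space under linear operations, derivatives and polynomial
  factors\<close>

lemma schwartz_cont_derivs: "\<psi> \<in> schwartz \<Longrightarrow> cont_derivs l \<psi>"
  by (simp add: schwartz_def smooth_def)

lemma schwartz_bounded: "\<psi> \<in> schwartz \<Longrightarrow> bounded (range (\<lambda>x. monomial a x * mderiv k \<psi> x))"
  by (simp add: schwartz_def)

lemma schwartz_continuous: "\<psi> \<in> schwartz \<Longrightarrow> continuous_on UNIV (mderiv k \<psi>)"
  using schwartz_cont_derivs cont_derivs_continuous by blast

lemma schwartzI_family:
  fixes D :: "('d::{finite,linorder} \<Rightarrow> nat) \<Rightarrow> 'd cfun"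
  assumes "\<And>k. continuous_on UNIV (D k)" "\<And>k i. has_pderiv i (D k) (D (inc i k))"
    and "\<And>a k. bounded (range (\<lambda>x. monomial a x * D k x))"
  shows "D zero_index \<in> schwartz"
  using smoothI_family[of D, OF assms(1,2)] assms(3) by (simp add: schwartz_def)

lemma bounded_range_add:
  fixes f g :: "'a \<Rightarrow> 'b::real_normed_vector"
  assumes "bounded (range f)" "bounded (range g)"
  shows "bounded (range (\<lambda>x. f x + g x))"
  using bounded_plus_comp[OF assms] .

lemma bounded_range_cmult:
  fixes f :: "'a \<Rightarrow> complex"
  assumes "bounded (range f)"
  shows "bounded (range (\<lambda>x. c * f x))"
  using bounded_linear_image[OF assms bounded_linear_mult_right[of c]] by (simp add: image_image)

lemma
  assumes "\<psi> \<in> schwartz" "\<eta> \<in> schwartz"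
  shows schwartz_add: "(\<lambda>x. \<psi> x + \<eta> x) \<in> schwartz"
    and mderiv_add_schwartz: "mderiv k (\<lambda>x. \<psi> x + \<eta> x) = (\<lambda>x. mderiv k \<psi> x + mderiv k \<eta> x)"
proof -
  note c = assms[THEN schwartz_cont_derivs]
  show m: "mderiv k (\<lambda>x. \<psi> x + \<eta> x) = (\<lambda>x. mderiv k \<psi> x + mderiv k \<eta> x)" for k
    by (rule mderiv_add[OF c order_refl])
  have "bounded (range (\<lambda>x. monomial a x * mderiv k (\<lambda>x. \<psi> x + \<eta> x) x))" for a k
    unfolding m distrib_left by (intro bounded_range_add schwartz_bounded assms)
  then show "(\<lambda>x. \<psi> x + \<eta> x) \<in> schwartz"
    using cont_derivs_add[OF c] by (simp add: schwartz_def smooth_def)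
qed

lemma
  assumes "\<psi> \<in> schwartz"
  shows schwartz_cmult: "(\<lambda>x. c * \<psi> x) \<in> schwartz"
    and mderiv_cmult_schwartz: "mderiv k (\<lambda>x. c * \<psi> x) = (\<lambda>x. c * mderiv k \<psi> x)"
proof -
  note d = assms[THEN schwartz_cont_derivs]
  show m: "mderiv k (\<lambda>x. c * \<psi> x) = (\<lambda>x. c * mderiv k \<psi> x)" for k
    by (rule mderiv_cmult[OF d order_refl])
  have "bounded (range (\<lambda>x. c * (monomial a x * mderiv k \<psi> x)))" for a k
    by (intro bounded_range_cmult schwartz_bounded assms)
  then have "bounded (range (\<lambda>x. monomial a x * mderiv k (\<lambda>x. c * \<psi> x) x))" for a k
    unfolding m by (simp add: mult.left_commute)
  then show "(\<lambda>x. c * \<psi> x) \<in> schwartz"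
    using cont_derivs_cmult[OF d] by (simp add: schwartz_def smooth_def)
qed

lemma
  assumes "\<psi> \<in> schwartz" "\<eta> \<in> schwartz"
  shows schwartz_diff: "(\<lambda>x. \<psi> x - \<eta> x) \<in> schwartz"
    and mderiv_diff_schwartz: "mderiv k (\<lambda>x. \<psi> x - \<eta> x) = (\<lambda>x. mderiv k \<psi> x - mderiv k \<eta> x)"
  using schwartz_add[OF assms(1) schwartz_cmult[OF assms(2), of "- 1"]]
    mderiv_add_schwartz[OF assms(1) schwartz_cmult[OF assms(2), of "- 1"], of k]
    mderiv_cmult_schwartz[OF assms(2), of k "- 1"]
  by simp_all

text \<open>Continuity of linear maps is tested at 0 with this notion, which frees the estimates
  from the limit function.\<close>

definition schwartz_null :: "(nat \<Rightarrow> 'd::{finite,linorder} cfun) \<Rightarrow> bool" where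
  "schwartz_null \<psi>s \<longleftrightarrow> (\<forall>n. \<psi>s n \<in> schwartz) \<and> (\<forall>a k. unif_null (\<lambda>n x. monomial a x * mderiv k (\<psi>s n) x))"

lemma schwartz_tendsto_iff_null:
  "schwartz_tendsto \<psi>s \<psi> \<longleftrightarrow>
    (\<forall>n. \<psi>s n \<in> schwartz) \<and> \<psi> \<in> schwartz \<and> schwartz_null (\<lambda>n x. \<psi>s n x - \<psi> x)"
proof -
  have "uniform_limit UNIV (\<lambda>n x. monomial a x * mderiv k (\<psi>s n) x) (\<lambda>x. monomial a x * mderiv k \<psi> x) sequentially
      \<longleftrightarrow> unif_null (\<lambda>n x. monomial a x * mderiv k (\<lambda>x. \<psi>s n x - \<psi> x) x)"
    if "\<And>n. \<psi>s n \<in> schwartz" "\<psi> \<in> schwartz" for a k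
    using that by (simp add: mderiv_diff_schwartz uniform_limit_iff dist_norm right_diff_distrib)
  then show ?thesis
    unfolding schwartz_tendsto_def schwartz_null_def using schwartz_diff by blast
qed

lemma
  assumes \<psi>: "\<psi> \<in> schwartz"
  shows schwartz_pderiv1: "pderiv1 i \<psi> \<in> schwartz"
    and mderiv_pderiv1_schwartz: "mderiv k (pderiv1 i \<psi>) = mderiv (inc i k) \<psi>"
    and schwartz_has_pderiv: "has_pderiv i \<psi> (pderiv1 i \<psi>)"
proof -
  note c = schwartz_cont_derivs[OF \<psi>]
  show m: "mderiv k (pderiv1 i \<psi>) = mderiv (inc i k) \<psi>" for k
    by (rule mderiv_pderiv1[OF c order_refl])
  have "cont_derivs l (pderiv1 i \<psi>)" for l by (rule cont_derivs_inc[OF c])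
  then show "pderiv1 i \<psi> \<in> schwartz"
    using schwartz_bounded[OF \<psi>] by (simp add: schwartz_def smooth_def m)
  show "has_pderiv i \<psi> (pderiv1 i \<psi>)"
    by (rule cont_derivs_pderiv1[OF c[of "inc i zero_index"]]) simp
qed

definition mult_coord :: "'d::finite \<Rightarrow> 'd cfun \<Rightarrow> 'd cfun" where
  "mult_coord i f x = complex_of_real (x $ i) * f x"

lemma monomial_inc: "monomial (inc i a) x = complex_of_real (x $ i) * monomial a x"
proof -
  have "(\<Prod>j\<in>UNIV. (x $ j) ^ inc i a j) = x $ i * (\<Prod>j\<in>UNIV. (x $ j) ^ a j)"
    by (simp add: prod.remove[of UNIV i] inc_apply mult.assoc)
  then show ?thesis by (simp add: monomial_def)
qed

lemma has_pderiv_coord: "has_pderiv i (\<lambda>x. complex_of_real (x $ j)) (\<lambda>x. if i = j then 1 else 0)"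
proof -
  have "((\<lambda>t. complex_of_real ((x + t *\<^sub>R axis i 1) $ j)) has_vector_derivative (if i = j then 1 else 0)) (at 0)"
    for x :: "(real, 'a) vec"
  proof (cases "i = j")
    case True
    have "((\<lambda>t. complex_of_real (x $ j + t)) has_vector_derivative complex_of_real 1) (at 0)"
      by (intro has_vector_derivative_of_real) (auto intro!: derivative_eq_intros)
    then show ?thesis using True by (simp only: vec_line_nth) simp
  qed (simp only: vec_line_nth, simp)
  then show ?thesis unfolding has_pderiv_def by blast
qed

lemma continuous_coord: "continuous_on S (\<lambda>x. complex_of_real (x $ j))"
  by (intro continuous_intros)

text \<open>The Leibniz rule for a linear factor. The truncated subtraction in
  \<open>dec i k\<close> is harmless for \<open>k i = 0\<close>, where the coefficient
  \<open>of_nat (k i)\<close> vanishes.\<close>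

lemma
  assumes \<psi>: "\<psi> \<in> schwartz"
  shows schwartz_mult_coord: "mult_coord i \<psi> \<in> schwartz"
    and mderiv_mult_coord: "mderiv k (mult_coord i \<psi>) =
      (\<lambda>x. complex_of_real (x $ i) * mderiv k \<psi> x + of_nat (k i) * mderiv (dec i k) \<psi> x)"
proof -
  let ?D = "\<lambda>k x. complex_of_real (x $ i) * mderiv k \<psi> x + of_nat (k i) * mderiv (dec i k) \<psi> x"
  have hp: "has_pderiv j (mderiv k \<psi>) (mderiv (inc j k) \<psi>)" for j k
    by (rule cont_derivs_has_pderiv[OF schwartz_cont_derivs[OF \<psi>] order_refl])
  have fam: "has_pderiv j (?D k) (?D (inc j k))" for j k
  proof -
    have "has_pderiv j (?D k) (\<lambda>x. (complex_of_real (x $ i) * mderiv (inc j k) \<psi> x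
        + (if j = i then 1 else 0) * mderiv k \<psi> x) + of_nat (k i) * mderiv (inc j (dec i k)) \<psi> x)"
      by (intro has_pderiv_add has_pderiv_mult has_pderiv_cmult has_pderiv_coord hp)
    also have "(\<lambda>x. (complex_of_real (x $ i) * mderiv (inc j k) \<psi> x
        + (if j = i then 1 else 0) * mderiv k \<psi> x) + of_nat (k i) * mderiv (inc j (dec i k)) \<psi> x) = ?D (inc j k)"
    proof (cases "j = i")
      case True
      then show ?thesis by (cases "k i = 0") (auto simp: algebra_simps)
    next
      case False
      then have "inc j (dec i k) = dec i (inc j k)" by (intro ext) (auto simp: inc_apply dec_apply)
      then show ?thesis using False by (simp add: inc_apply)
    qed
    finally show ?thesis .
  qed
  have cont: "continuous_on UNIV (?D k)" for k
    by (intro continuous_intros continuous_coord schwartz_continuous[OF \<psi>])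
  have D0: "?D zero_index = mult_coord i \<psi>" by (simp add: mult_coord_def[abs_def])
  have eq: "monomial a x * ?D k x = monomial (inc i a) x * mderiv k \<psi> x
      + of_nat (k i) * (monomial a x * mderiv (dec i k) \<psi> x)" for a k x
    by (simp add: monomial_inc algebra_simps)
  have "bounded (range (\<lambda>x. monomial a x * ?D k x))" for a k
    unfolding eq by (intro bounded_range_add bounded_range_cmult schwartz_bounded \<psi>)
  from schwartzI_family[of ?D, OF cont fam this] show "mult_coord i \<psi> \<in> schwartz"
    unfolding D0 .
  show "mderiv k (mult_coord i \<psi>) = ?D k"
    using smoothI_family(2)[of ?D k, OF cont fam] unfolding D0 .
qed

lemma schwartz_null_mult_coord:
  assumes "schwartz_null \<psi>s"
  shows "schwartz_null (\<lambda>n. mult_coord i (\<psi>s n))"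
proof -
  have S: "\<psi>s n \<in> schwartz" for n using assms by (simp add: schwartz_null_def)
  have "monomial a x * mderiv k (mult_coord i (\<psi>s n)) x = monomial (inc i a) x * mderiv k (\<psi>s n) x
      + of_nat (k i) * (monomial a x * mderiv (dec i k) (\<psi>s n) x)" for a k x n
    by (simp add: mderiv_mult_coord[OF S] monomial_inc algebra_simps)
  moreover have "unif_null (\<lambda>n x. monomial (inc i a) x * mderiv k (\<psi>s n) x
      + of_nat (k i) * (monomial a x * mderiv (dec i k) (\<psi>s n) x))" for a k
    using assms by (intro unif_null_add unif_null_cmult) (simp_all add: schwartz_null_def)
  ultimately show ?thesis
    unfolding schwartz_null_def using S by (simp add: schwartz_mult_coord)
qed

lemma schwartz_null_cmult:
  assumes "schwartz_null \<psi>s"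
  shows "schwartz_null (\<lambda>n x. c * \<psi>s n x)"
proof -
  have S: "\<psi>s n \<in> schwartz" for n using assms by (simp add: schwartz_null_def)
  have "unif_null (\<lambda>n x. c * (monomial a x * mderiv k (\<psi>s n) x))" for a k
    using assms by (intro unif_null_cmult) (simp add: schwartz_null_def)
  then show ?thesis
    unfolding schwartz_null_def using S by (simp add: schwartz_cmult mderiv_cmult_schwartz mult.left_commute)
qed

lemma schwartz_mderiv: "\<psi> \<in> schwartz \<Longrightarrow> mderiv k \<psi> \<in> schwartz"
proof (induction k arbitrary: \<psi> rule: multiindex_induct)
  case (inc k i)
  then show ?case using inc.IH[OF schwartz_pderiv1[OF inc.prems]] by (simp only: mderiv_pderiv1_schwartz)
qed simp

lemma
  shows schwartz_monomial: "\<psi> \<in> schwartz \<Longrightarrow> (\<lambda>x. monomial k x * \<psi> x) \<in> schwartz"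
    and schwartz_null_monomial: "schwartz_null \<psi>s \<Longrightarrow> schwartz_null (\<lambda>n x. monomial k x * \<psi>s n x)"
proof (induction k arbitrary: \<psi> \<psi>s rule: multiindex_induct)
  case (inc k i)
  have eq: "(\<lambda>x. monomial (inc i k) x * f x) = mult_coord i (\<lambda>x. monomial k x * f x)" for f
    by (simp add: fun_eq_iff mult_coord_def monomial_inc mult.assoc)
  { case 1
    then show ?case unfolding eq by (intro schwartz_mult_coord inc.IH)
  next
    case 2
    then show ?case unfolding eq by (intro schwartz_null_mult_coord inc.IH) }
qed (simp_all add: monomial_def)

lemma schwartz_decay: "\<psi> \<in> schwartz \<Longrightarrow> \<exists>C\<ge>0. \<forall>x. weight M x * norm (mderiv k \<psi> x) \<le> C"
  by (intro rapid_decay schwartz_bounded)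

lemma schwartz_null_weight: "schwartz_null \<psi>s \<Longrightarrow> unif_null (\<lambda>n x. weight M x * norm (mderiv k (\<psi>s n) x))"
  unfolding schwartz_null_def by (intro unif_null_weight) blast

lemma integrable_inverse_weight: "integrable lborel (\<lambda>x::(real, 'd::finite) vec. inverse (weight 1 x))"
proof -
  have "integrable lborel (\<lambda>t::real. inverse (1 + t\<^sup>2))"
    using integrable_inverse_1_plus_square by (simp add: set_integrable_def einterval_def)
  then have "integrable lborel (\<lambda>x::(real, 'd) vec. \<Prod>i\<in>UNIV. inverse (1 + (x $ i)\<^sup>2))"
    by (rule lborel_integrable_prod)
  then show ?thesis by (simp add: prod_inversef[symmetric] o_def)
qed

text \<open>The constant that turns a bound on a function times \<open>weight 1\<close> into a bound
  on its integral.\<close>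

definition weight_mass :: "'d::finite itself \<Rightarrow> real" where
  "weight_mass _ = integral\<^sup>L lborel (\<lambda>x::(real, 'd) vec. inverse (weight 1 x))"

lemma weight_mass_nonneg: "0 \<le> weight_mass TYPE('d::finite)"
  unfolding weight_mass_def
  by (intro integral_nonneg_AE AE_I2) (rule less_imp_le[OF positive_imp_inverse_positive[OF weight_pos]])

lemma norm_le_inverse_weight:
  "weight 1 x * norm y \<le> C \<Longrightarrow> norm y \<le> C * inverse (weight 1 x)"
  using weight_pos[where M=1 and x=x] by (simp add: field_simps)

lemma integrable_weight_bounded:
  fixes f :: "'d::finite cfun"
  assumes "f \<in> borel_measurable borel" "\<And>x. weight 1 x * norm (f x) \<le> C"
  shows "integrable lborel f" "norm (LINT x|lborel. f x) \<le> C * weight_mass TYPE('d)"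
proof -
  have w: "integrable lborel (\<lambda>x::(real, 'd) vec. C * inverse (weight 1 x))"
    by (intro integrable_mult_right integrable_inverse_weight)
  have bound: "norm (f x) \<le> C * inverse (weight 1 x)" for x
    by (rule norm_le_inverse_weight[OF assms(2)])
  show int: "integrable lborel f"
    by (rule Bochner_Integration.integrable_bound[OF w])
      (use bound assms(1) in \<open>auto intro: order_trans[OF _ abs_ge_self]\<close>)
  have "norm (LINT x|lborel. f x) \<le> (LINT x|lborel. norm (f x))" by (rule integral_norm_bound)
  also have "\<dots> \<le> integral\<^sup>L lborel (\<lambda>x::(real, 'd) vec. C * inverse (weight 1 x))"
    by (intro integral_mono w integrable_norm int bound)
  also have "\<dots> = C * weight_mass TYPE('d)"
    unfolding weight_mass_def by (rule integral_mult_right_zero)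
  finally show "norm (LINT x|lborel. f x) \<le> C * weight_mass TYPE('d)" .
qed

section \<open>Density of test functions\<close>

lemma test_function_schwartz:
  assumes "\<psi> \<in> test_functions"
  shows "\<psi> \<in> schwartz"
proof -
  from assms obtain K where s: "smooth \<psi>" and K: "compact K" "\<And>x. x \<notin> K \<Longrightarrow> \<psi> x = 0"
    unfolding test_functions_def by blast
  have c: "cont_derivs k \<psi>" for k using s by (simp add: smooth_def)
  have "bounded (range (\<lambda>x. monomial a x * mderiv k \<psi> x))" for a k
  proof (rule bounded_compact_support[OF _ K(1)])
    show "continuous_on UNIV (\<lambda>x. monomial a x * mderiv k \<psi> x)"
      unfolding monomial_def by (intro continuous_intros cont_derivs_continuous[OF c order_refl])
    show "monomial a x * mderiv k \<psi> x = 0" if "x \<notin> K" for x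
      using mderiv_eq_0_outside[OF c compact_imp_closed[OF K(1)] K(2) that] by simp
  qed
  then show ?thesis using s by (simp add: schwartz_def)
qed

lemma unif_null_inverse_Suc: "unif_null (\<lambda>n (x::'a). B * inverse (real (Suc n)))"
proof (rule uniform_limitI)
  fix e :: real assume "e > 0"
  have "(\<lambda>n. B * inverse (real (Suc n))) \<longlonglongrightarrow> B * 0"
    by (intro tendsto_intros LIMSEQ_inverse_real_of_nat)
  then have "\<forall>\<^sub>F n in sequentially. dist (B * inverse (real (Suc n))) 0 < e"
    using \<open>e > 0\<close> by (auto dest: tendstoD)
  then show "\<forall>\<^sub>F n in sequentially. \<forall>x\<in>(UNIV::'a set). dist (B * inverse (real (Suc n))) 0 < e"
    by eventually_elim blast
qed

lemma weight1_ge: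
  fixes x :: "real ^ 'd::finite"
  shows "\<bar>x $ i\<bar> \<le> weight 1 x" "1 \<le> weight 1 x"
proof -
  have ge1: "1 \<le> (\<Prod>j\<in>A. (1 + (x $ j)\<^sup>2) ^ 1)" for A
    by (intro prod_ge_1) auto
  then show "1 \<le> weight 1 x" .
  have "2 * \<bar>x $ i\<bar> \<le> 1 + (x $ i)\<^sup>2"
    using zero_le_power2[of "\<bar>x $ i\<bar> - 1"] by (simp add: power2_diff)
  then have "\<bar>x $ i\<bar> \<le> 1 + (x $ i)\<^sup>2" using abs_ge_zero[of "x $ i"] by linarith
  also have "\<dots> \<le> (1 + (x $ i)\<^sup>2) * (\<Prod>j\<in>UNIV - {i}. (1 + (x $ j)\<^sup>2) ^ 1)"
    using mult_left_mono[OF ge1[of "UNIV - {i}"], of "1 + (x $ i)\<^sup>2"] by simp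
  also have "\<dots> = weight 1 x" by (simp add: prod.remove[of UNIV i])
  finally show "\<bar>x $ i\<bar> \<le> weight 1 x" .
qed

text \<open>The decay of \<open>\<psi>\<close> absorbs the growth \<open>weight 1\<close>, and the
  factor 1/(n+1) remains. The bound is assumed for all \<open>k\<close> so that it survives
  replacing \<open>\<alpha>s n\<close> by \<open>pderiv1 i (\<alpha>s n)\<close> in the Leibniz
  step.\<close>

lemma unif_null_cutoff:
  fixes \<alpha>s :: "nat \<Rightarrow> 'd::{finite,linorder} cfun"
  assumes "\<And>n. smooth (\<alpha>s n)"
    and "\<And>k. \<exists>B\<ge>0. \<forall>n x. norm (mderiv k (\<alpha>s n) x) \<le> B * inverse (real (Suc n)) * weight 1 x"
    and "\<psi> \<in> schwartz"
  shows "unif_null (\<lambda>n x. monomial a x * mderiv k (\<lambda>x. \<alpha>s n x * \<psi> x) x)"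
  using assms
proof (induction k arbitrary: \<alpha>s \<psi> rule: multiindex_induct)
  case zero
  obtain B where B: "0 \<le> B" "\<And>n x. norm (\<alpha>s n x) \<le> B * inverse (real (Suc n)) * weight 1 x"
    using zero.prems(2)[of zero_index] by (simp only: mderiv_zero) blast
  obtain C where C: "0 \<le> C" "\<And>x. weight 1 x * norm (monomial a x * \<psi> x) \<le> C"
    using schwartz_decay[OF schwartz_monomial[OF zero.prems(3), of a], of 1 zero_index]
    by (simp only: mderiv_zero) blast
  show ?case
  proof (rule unif_null_bound[OF unif_null_inverse_Suc])
    fix n and x :: "(real, 'd) vec"
    have "norm (monomial a x * mderiv zero_index (\<lambda>x. \<alpha>s n x * \<psi> x) x) = norm (\<alpha>s n x) * norm (monomial a x * \<psi> x)"
      by (simp add: norm_mult)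
    also have "\<dots> \<le> B * inverse (real (Suc n)) * weight 1 x * norm (monomial a x * \<psi> x)"
      by (intro mult_right_mono B) auto
    also have "\<dots> = B * inverse (real (Suc n)) * (weight 1 x * norm (monomial a x * \<psi> x))"
      by (simp only: mult.assoc)
    also have "\<dots> \<le> B * inverse (real (Suc n)) * C"
      using B(1) by (intro mult_left_mono C) auto
    also have "\<dots> \<le> norm (B * C * inverse (real (Suc n)))"
      using abs_ge_self[of "B * C * inverse (real (Suc n))"] by (simp add: mult_ac)
    finally show "norm (monomial a x * mderiv zero_index (\<lambda>x. \<alpha>s n x * \<psi> x) x) \<le> norm (B * C * inverse (real (Suc n)))" .
  qed
next
  case (inc k i)
  have c: "cont_derivs l (\<alpha>s n)" for l n using inc.prems(1) by (simp add: smooth_def)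
  have s: "smooth (pderiv1 i (\<alpha>s n))" for n unfolding smooth_def using cont_derivs_inc[OF c] by blast
  have m: "mderiv k (pderiv1 i (\<alpha>s n)) = mderiv (inc i k) (\<alpha>s n)" for k n
    by (rule mderiv_pderiv1[OF c order_refl])
  have "mderiv (inc i k) (\<lambda>x. \<alpha>s n x * \<psi> x) =
      (\<lambda>x. mderiv k (\<lambda>x. \<alpha>s n x * pderiv1 i \<psi> x) x + mderiv k (\<lambda>x. pderiv1 i (\<alpha>s n) x * \<psi> x) x)" for n
    by (rule mderiv_mult_inc[OF c schwartz_cont_derivs[OF inc.prems(3)]])
  moreover have "unif_null (\<lambda>n x. monomial a x * mderiv k (\<lambda>x. \<alpha>s n x * pderiv1 i \<psi> x) x)"
    by (rule inc.IH[OF inc.prems(1,2) schwartz_pderiv1[OF inc.prems(3)]])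
  moreover have "unif_null (\<lambda>n x. monomial a x * mderiv k (\<lambda>x. pderiv1 i (\<alpha>s n) x * \<psi> x) x)"
    by (rule inc.IH[OF s _ inc.prems(3)]) (unfold m, rule inc.prems(2))
  ultimately show ?case by (simp add: distrib_left unif_null_add)
qed

text \<open>The one-dimensional bump is Lipschitz and equals 1 at 0. A product of factors of modulus
  at most 1 differs from 1 by at most the sum of the single differences, and each coordinate is
  dominated by \<open>weight 1\<close>.\<close>

lemma bump_minus_1_bound:
  "\<exists>B\<ge>0. \<forall>c\<ge>0. \<forall>x::real^'d::finite. norm (bump c zero_index x - 1) \<le> B * c * weight 1 x"
proof -
  obtain L where L: "\<And>t. \<bar>bump1 1 t\<bar> \<le> L" using bump1_bounded[of 1] by blast
  have L0: "0 \<le> L" using L[of 0] by linarith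
  have lip: "\<bar>bump1 0 t - 1\<bar> \<le> L * \<bar>t\<bar>" for t
  proof -
    have "norm (bump1 0 t - bump1 0 0) \<le> L * norm (t - 0)"
      by (rule field_differentiable_bound[where S=UNIV and f'="bump1 1"])
        (use bump1_deriv[of 0] L in auto)
    then show ?thesis by (simp add: bump1_0_0)
  qed
  have "norm (bump c zero_index x - 1) \<le> (L * CARD('d)) * c * weight 1 x" if "c \<ge> 0" for c and x :: "real^'d"
  proof -
    let ?h = "\<lambda>i. complex_of_real (c ^ zero_index i * bump1 (zero_index i) (c * x $ i))"
    have "norm ((\<Prod>i\<in>UNIV. ?h i) - (\<Prod>i\<in>(UNIV::'d set). 1))
        \<le> (\<Sum>i\<in>UNIV. norm (?h i - 1))"
      by (rule norm_prod_diff) (auto simp: bump1_nonneg bump1_le_1)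
    also have "\<dots> \<le> (\<Sum>i\<in>(UNIV::'d set). L * c * weight 1 x)"
    proof (rule sum_mono)
      fix i
      have "norm (?h i - 1) = \<bar>bump1 0 (c * x $ i) - 1\<bar>"
        by (metis norm_of_real of_real_1 of_real_diff mult_1 power_0)
      also have "\<dots> \<le> L * \<bar>c * x $ i\<bar>" by (rule lip)
      also have "\<dots> = L * c * \<bar>x $ i\<bar>" using that by (simp add: abs_mult)
      also have "\<dots> \<le> L * c * weight 1 x" using L0 that by (intro mult_left_mono weight1_ge) auto
      finally show "norm (?h i - 1) \<le> L * c * weight 1 x" .
    qed
    finally show ?thesis by (simp add: bump_def mult_ac)
  qed
  then show ?thesis using L0 by (intro exI[of _ "L * CARD('d)"]) auto
qed

text \<open>Multiplication by ever wider cutoffs. They approach 1 only locally; globally the error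
  is a small constant times \<open>weight 1\<close>, which a Schwartz function absorbs.\<close>

lemma test_functions_dense:
  fixes \<psi> :: "'d::{finite,linorder} cfun"
  assumes \<psi>: "\<psi> \<in> schwartz"
  obtains \<psi>s where "\<And>n. \<psi>s n \<in> test_functions" "schwartz_tendsto \<psi>s \<psi>"
proof -
  define c where "c n = inverse (real (Suc n))" for n
  have c: "0 < c n" "c n \<le> 1" for n by (auto simp: c_def inverse_le_1_iff)
  define \<psi>s where "\<psi>s n x = bump (c n) zero_index x * \<psi> x" for n x
  have cd_bump: "cont_derivs l (bump c' zero_index :: 'd cfun)" for l c'
    using smooth_bump by (auto simp: smooth_def)
  have test: "\<psi>s n \<in> test_functions" for n
  proof -
    have "smooth (\<psi>s n)"
      unfolding smooth_def \<psi>s_def[abs_def]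
      by (intro allI cont_derivs_mult cd_bump schwartz_cont_derivs \<psi>)
    moreover have "\<psi>s n x = 0" if "x \<notin> cball 0 (real CARD('d) / c n)" for x
      using bump_outside[OF c(1), of n x] that by (simp add: \<psi>s_def)
    ultimately show ?thesis unfolding test_functions_def using compact_cball by blast
  qed
  have S: "\<psi>s n \<in> schwartz" for n by (rule test_function_schwartz[OF test])
  define \<alpha>s :: "nat \<Rightarrow> 'd cfun" where "\<alpha>s n x = bump (c n) zero_index x - 1" for n x
  have \<alpha>_eq: "\<alpha>s n = (\<lambda>x. bump (c n) zero_index x + - 1)" for n by (simp add: \<alpha>s_def fun_eq_iff)
  have \<alpha>_cd: "cont_derivs l (\<alpha>s n)" for l n
    unfolding \<alpha>_eq by (intro cont_derivs_add cd_bump cont_derivs_const)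
  have \<alpha>_mderiv: "mderiv k (\<alpha>s n) = (\<lambda>x. bump (c n) k x + (if k = zero_index then - 1 else 0))" for k n
    unfolding \<alpha>_eq mderiv_add[OF cd_bump cont_derivs_const order_refl] mderiv_bump mderiv_const ..
  \<comment> \<open>At order 0 the factor \<open>c n\<close> comes from the Lipschitz bound. At
    higher order the chain rule gives \<open>c n ^ mdegree k\<close>, which is at most
    \<open>c n\<close> because \<open>c n \<le> 1\<close>.\<close>
  have "\<exists>B\<ge>0. \<forall>n x. norm (mderiv k (\<alpha>s n) x) \<le> B * inverse (real (Suc n)) * weight 1 x" for k
  proof (cases "k = zero_index")
    case True
    obtain B where "0 \<le> B" "\<And>c x. 0 \<le> c \<Longrightarrow> norm (bump c zero_index (x::(real,'d) vec) - 1) \<le> B * c * weight 1 x"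
      using bump_minus_1_bound by blast
    then show ?thesis using True c(1) by (intro exI[of _ B]) (auto simp: \<alpha>s_def c_def less_imp_le)
  next
    case False
    then obtain i where i: "0 < k i" by auto
    obtain B where B: "\<And>c x. 0 \<le> c \<Longrightarrow> norm (bump c k x) \<le> B * c ^ mdegree k"
      using bump_bounded[of k] by blast
    have "norm (mderiv k (\<alpha>s n) x) \<le> \<bar>B\<bar> * inverse (real (Suc n)) * weight 1 x" for n x
    proof -
      have "norm (mderiv k (\<alpha>s n) x) \<le> B * c n ^ mdegree k"
        using B[of "c n" x] c(1)[of n] False by (simp add: \<alpha>_mderiv less_imp_le)
      also have "\<dots> \<le> \<bar>B\<bar> * c n ^ mdegree k"
        using c(1)[of n] by (intro mult_right_mono) auto
      also have "\<dots> \<le> \<bar>B\<bar> * c n ^ 1"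
      proof (intro mult_left_mono power_decreasing)
        show "1 \<le> (\<Sum>i\<in>UNIV. k i)"
          using i by (simp add: sum.remove[of UNIV i])
      qed (use c[of n] in auto)
      also have "\<dots> \<le> \<bar>B\<bar> * c n * weight 1 x"
        using mult_left_mono[OF weight1_ge(2)[of x], of "\<bar>B\<bar> * c n"] c(1)[of n] by simp
      finally show ?thesis by (simp add: c_def)
    qed
    then show ?thesis by (intro exI[of _ "\<bar>B\<bar>"]) auto
  qed
  then have "unif_null (\<lambda>n x. monomial a x * mderiv k (\<lambda>x. \<alpha>s n x * \<psi> x) x)" for a k
    using \<alpha>_cd \<psi> by (intro unif_null_cutoff) (auto simp: smooth_def)
  moreover have "(\<lambda>x. \<alpha>s n x * \<psi> x) = (\<lambda>x. \<psi>s n x - \<psi> x)" for n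
    by (simp add: \<alpha>s_def \<psi>s_def fun_eq_iff algebra_simps)
  ultimately have "schwartz_tendsto \<psi>s \<psi>"
    unfolding schwartz_tendsto_iff_null schwartz_null_def
    using \<psi> S schwartz_diff[OF S \<psi>] by simp
  with test show ?thesis by (rule that)
qed

lemma tempered_eqI:
  assumes "p \<in> tempered" "q \<in> tempered" "\<And>\<psi>. \<psi> \<in> test_functions \<Longrightarrow> p \<psi> = q \<psi>"
  shows "p = q"
proof
  fix \<psi>
  show "p \<psi> = q \<psi>"
  proof (cases "\<psi> \<in> schwartz")
    case True
    obtain \<psi>s where \<psi>s: "\<And>n. \<psi>s n \<in> test_functions" "schwartz_tendsto \<psi>s \<psi>"
      using test_functions_dense[OF True] by blast
    have "(\<lambda>n. p (\<psi>s n)) \<longlonglongrightarrow> p \<psi>" "(\<lambda>n. q (\<psi>s n)) \<longlonglongrightarrow> q \<psi>"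
      using assms(1,2) \<psi>s(2) by (auto simp: tempered_def)
    then show ?thesis using assms(3)[OF \<psi>s(1)] LIMSEQ_unique by simp
  next
    case False
    then show ?thesis using assms(1,2) by (simp add: tempered_def)
  qed
qed

text \<open>Uniqueness for the definite description: two products agree on test functions by
  \<open>is_product_formula\<close> with one common representative, and then everywhere by
  density.\<close>

lemma product_of_eqI:
  assumes p: "is_product l b h p"
  shows "product_of l b h = p"
  unfolding product_of_def
proof (rule the_equality[where P="is_product l b h", OF p])
  fix q assume q: "is_product l b h q"
  obtain c where c: "continuous_on UNIV c" "\<And>\<psi>. \<psi> \<in> test_functions \<Longrightarrow> b \<psi> = gderiv l c \<psi>"
    using p unfolding is_product_def by blast
  show "q = p"
  proof (rule tempered_eqI)
    show "q \<psi> = p \<psi>" if "\<psi> \<in> test_functions" for \<psi>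
      using is_product_formula[OF p c that] is_product_formula[OF q c that] by simp
  qed (use p q in \<open>auto simp: is_product_def\<close>)
qed

section \<open>The Fourier transform on the Schwartz space\<close>

lemma schwartz_integrable:
  assumes "\<eta> \<in> schwartz"
  shows "integrable lborel \<eta>"
proof -
  obtain C where "\<forall>x. weight 1 x * norm (\<eta> x) \<le> C"
    using schwartz_decay[OF assms, of 1 zero_index] by (simp only: mderiv_zero) blast
  moreover have "\<eta> \<in> borel_measurable borel"
    using schwartz_continuous[OF assms, of zero_index] by (simp add: continuous_on_borel_measurable)
  ultimately show ?thesis using integrable_weight_bounded(1) by blast
qed

lemma schwartz_measurable: "\<eta> \<in> schwartz \<Longrightarrow> \<eta> \<in> borel_measurable borel"
  using borel_measurable_integrable[OF schwartz_integrable] by simp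

abbreviation wave :: "(real, 'd::finite) vec \<Rightarrow> 'd cfun" where
  "wave s x \<equiv> exp (\<i> * complex_of_real (x \<bullet> s))"

lemma continuous_wave: "continuous_on S (wave s)"
  by (intro continuous_intros)

lemma schwartz_wave_integrable:
  assumes "\<eta> \<in> schwartz"
  shows "integrable lborel (\<lambda>x. \<eta> x * wave s x)"
proof (rule Bochner_Integration.integrable_bound[OF schwartz_integrable[OF assms]])
  show "(\<lambda>x. \<eta> x * wave s x) \<in> borel_measurable lborel"
    using borel_measurable_times[OF schwartz_measurable[OF assms] continuous_on_borel_measurable[OF continuous_wave]]
    by simp
qed (simp add: norm_mult)

lemma wave_has_vector_derivative:
  "((\<lambda>t. exp (\<i> * complex_of_real (a + t * b))) has_vector_derivative
    \<i> * complex_of_real b * exp (\<i> * complex_of_real (a + t * b))) (at t)"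
proof -
  have "((\<lambda>t. complex_of_real (a + t * b)) has_vector_derivative complex_of_real b) (at t)"
    by (intro has_vector_derivative_of_real) (auto intro!: derivative_eq_intros)
  then have "((\<lambda>t. \<i> * complex_of_real (a + t * b)) has_vector_derivative \<i> * complex_of_real b) (at t)"
    by (rule has_vector_derivative_mult_right)
  from field_vector_diff_chain_at[OF this DERIV_exp] show ?thesis
    by (simp add: o_def)
qed

lemma fourier_continuous:
  assumes "\<eta> \<in> schwartz"
  shows "continuous_on UNIV (fourier \<eta>)"
  unfolding fourier_def[abs_def]
proof (rule continuous_on_integral)
  show "(\<lambda>x. \<eta> x * wave s x) \<in> borel_measurable lborel" for s
    using borel_measurable_integrable[OF schwartz_wave_integrable[OF assms]] .
  show "continuous_on UNIV (\<lambda>s. \<eta> x * wave s x)" for x by (intro continuous_intros)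
  show "integrable lborel (\<lambda>x. norm (\<eta> x))" using schwartz_integrable[OF assms] by simp
qed (simp add: norm_mult)

text \<open>Differentiation under the integral brings down the factor \<i> times the i-th
  coordinate; \<open>mult_coord i \<eta>\<close> is a Schwartz function, so its norm is an
  integrable dominating function.\<close>

lemma fourier_has_pderiv:
  fixes \<eta> :: "'d::{finite,linorder} cfun"
  assumes \<eta>: "\<eta> \<in> schwartz"
  shows "has_pderiv i (fourier \<eta>) (fourier (\<lambda>x. \<i> * mult_coord i \<eta> x))"
  unfolding has_pderiv_def
proof
  fix s :: "(real, 'd) vec"
  have m: "mult_coord i \<eta> \<in> schwartz" by (rule schwartz_mult_coord[OF \<eta>])
  have "((\<lambda>t. LINT x|lborel. \<eta> x * wave (s + t *\<^sub>R axis i 1) x) has_vector_derivative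
      (LINT x|lborel. (\<i> * mult_coord i \<eta> x) * wave (s + 0 *\<^sub>R axis i 1) x)) (at 0)"
  proof (rule has_vector_derivative_integral)
    show "integrable lborel (\<lambda>x. \<eta> x * wave (s + t *\<^sub>R axis i 1) x)" for t
      by (rule schwartz_wave_integrable[OF \<eta>])
    show "((\<lambda>t. \<eta> x * wave (s + t *\<^sub>R axis i 1) x) has_vector_derivative
        (\<i> * mult_coord i \<eta> x) * wave (s + t *\<^sub>R axis i 1) x) (at t)" for t x
    proof -
      have "x \<bullet> (s + t *\<^sub>R axis i 1) = x \<bullet> s + t * x $ i" for t
        by (simp add: inner_add_right inner_axis)
      then show ?thesis
        using has_vector_derivative_mult_right[OF wave_has_vector_derivative[of "x \<bullet> s" "x $ i" t], of "\<eta> x"]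
        by (simp add: mult_coord_def mult_ac)
    qed
    show "(\<lambda>x. (\<i> * mult_coord i \<eta> x) * wave (s + 0 *\<^sub>R axis i 1) x) \<in> borel_measurable lborel"
      using borel_measurable_integrable[OF schwartz_wave_integrable[OF schwartz_cmult[OF m]]] .
    show "integrable lborel (\<lambda>x. norm (mult_coord i \<eta> x))" using schwartz_integrable[OF m] by simp
  qed (simp add: norm_mult)
  then show "((\<lambda>t. fourier \<eta> (s + t *\<^sub>R axis i 1)) has_vector_derivative fourier (\<lambda>x. \<i> * mult_coord i \<eta> x) s) (at 0)"
    by (simp add: fourier_def)
qed

text \<open>The dominating function in \<open>integral_pderiv_eq_0\<close> must be valid for all
  shifts by at most 1; such a shift changes only the i-th factor of the weight.\<close>

lemma weight1_shift:
  fixes x :: "real ^ 'd::finite"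
  assumes "\<bar>t\<bar> \<le> 1"
  shows "weight 1 x \<le> 3 * weight 1 (x + t *\<^sub>R axis i 1)"
proof -
  let ?P = "\<Prod>j\<in>UNIV - {i}. (1 + (x $ j)\<^sup>2) ^ 1"
  have "weight 1 (x + t *\<^sub>R axis i 1) = (\<Prod>j\<in>UNIV. (1 + (if j = i then x $ j + t else x $ j)\<^sup>2) ^ 1)"
    by (simp only: vec_line_nth)
  also have "\<dots> = (1 + (x $ i + t)\<^sup>2) * ?P"
    by (simp add: prod.remove[of UNIV i])
  finally have eq: "weight 1 (x + t *\<^sub>R axis i 1) = (1 + (x $ i + t)\<^sup>2) * ?P" .
  have "t\<^sup>2 \<le> 1" using assms by (simp add: abs_square_le_1)
  \<comment> \<open>With a the i-th coordinate of x, twice the difference 3 (1 + (a + t)^2) - (1 +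
    a^2) equals (2 a + 3 t)^2 + 4 - 3 t^2.\<close>
  moreover have "0 \<le> (2 * x $ i + 3 * t)\<^sup>2" by simp
  ultimately have "1 + (x $ i)\<^sup>2 \<le> 3 * (1 + (x $ i + t)\<^sup>2)"
    by (simp add: power2_eq_square algebra_simps)
  moreover have "0 \<le> ?P" by (intro prod_nonneg) auto
  ultimately have "(1 + (x $ i)\<^sup>2) * ?P \<le> 3 * (1 + (x $ i + t)\<^sup>2) * ?P"
    by (rule mult_right_mono)
  moreover have "weight 1 x = (1 + (x $ i)\<^sup>2) * ?P" by (simp add: prod.remove[of UNIV i])
  ultimately show ?thesis by (simp only: eq mult.assoc)
qed

text \<open>The i-th derivative of \<open>\<eta> x * wave s x\<close> has integral 0, and
  differentiating the wave brings down \<i> times the i-th coordinate of s.\<close>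

lemma fourier_pderiv1:
  fixes \<eta> :: "'d::{finite,linorder} cfun"
  assumes \<eta>: "\<eta> \<in> schwartz"
  shows "complex_of_real (s $ i) * fourier \<eta> s = \<i> * fourier (pderiv1 i \<eta>) s"
proof -
  have d: "pderiv1 i \<eta> \<in> schwartz" by (rule schwartz_pderiv1[OF \<eta>])
  let ?F = "\<lambda>x. \<eta> x * wave s x"
  let ?F' = "\<lambda>x. \<eta> x * (\<i> * complex_of_real (s $ i) * wave s x) + pderiv1 i \<eta> x * wave s x"
  let ?W = "\<lambda>x. \<i> * complex_of_real (s $ i) * wave s x"
  have hw: "has_pderiv i (wave s) ?W"
    unfolding has_pderiv_def
  proof
    fix x
    have "(x + t *\<^sub>R axis i 1) \<bullet> s = x \<bullet> s + t * s $ i" for t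
      by (simp add: inner_add_left inner_axis')
    then show "((\<lambda>t. wave s (x + t *\<^sub>R axis i 1)) has_vector_derivative
        \<i> * complex_of_real (s $ i) * wave s x) (at 0)"
      using wave_has_vector_derivative[of "x \<bullet> s" "s $ i" 0] by simp
  qed
  obtain C1 where C1: "\<And>x. weight 1 x * norm (\<eta> x) \<le> C1"
    using schwartz_decay[OF \<eta>, of 1 zero_index] by (simp only: mderiv_zero) blast
  obtain C2 where C2: "\<And>x. weight 1 x * norm (pderiv1 i \<eta> x) \<le> C2"
    using schwartz_decay[OF d, of 1 zero_index] by (simp only: mderiv_zero) blast
  define C where "C = \<bar>s $ i\<bar> * C1 + C2"
  have C: "weight 1 x * norm (?F' x) \<le> C" for x
  proof -
    have "norm (?F' x) \<le> \<bar>s $ i\<bar> * norm (\<eta> x) + norm (pderiv1 i \<eta> x)"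
      by (rule order_trans[OF norm_triangle_ineq]) (simp add: norm_mult)
    then have "weight 1 x * norm (?F' x) \<le> weight 1 x * (\<bar>s $ i\<bar> * norm (\<eta> x) + norm (pderiv1 i \<eta> x))"
      using weight_pos[where M=1 and x=x] by (intro mult_left_mono) auto
    also have "\<dots> = \<bar>s $ i\<bar> * (weight 1 x * norm (\<eta> x)) + weight 1 x * norm (pderiv1 i \<eta> x)"
      by (simp add: algebra_simps)
    also have "\<dots> \<le> C" unfolding C_def by (intro add_mono mult_left_mono C1 C2) auto
    finally show ?thesis .
  qed
  have "(LINT x|lborel. ?F' x) = 0"
  proof (rule integral_pderiv_eq_0[OF has_pderiv_mult[OF schwartz_has_pderiv[OF \<eta>] hw]])
    show "integrable lborel ?F" by (rule schwartz_wave_integrable[OF \<eta>])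
    have "continuous_on UNIV \<eta>" "continuous_on UNIV (pderiv1 i \<eta>)"
      using schwartz_continuous[OF \<eta>, of zero_index] schwartz_continuous[OF d, of zero_index] by simp_all
    then show "continuous_on UNIV ?F'" by (intro continuous_intros)
    show "integrable lborel (\<lambda>x::(real, 'd) vec. 3 * C * inverse (weight 1 x))"
      by (intro integrable_mult_right integrable_inverse_weight)
    fix t :: real and x :: "(real, 'd) vec"
    assume t: "\<bar>t\<bar> \<le> 1"
    let ?y = "x + t *\<^sub>R axis i 1"
    have "weight 1 x * norm (?F' ?y) \<le> 3 * weight 1 ?y * norm (?F' ?y)"
      by (intro mult_right_mono weight1_shift t) auto
    also have "\<dots> \<le> 3 * C"
      using C[of ?y] by (simp only: mult.assoc mult_le_cancel_left_pos zero_less_numeral)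
    finally show "norm (?F' ?y) \<le> 3 * C * inverse (weight 1 x)" by (rule norm_le_inverse_weight)
  qed
  moreover have "(LINT x|lborel. ?F' x) = \<i> * complex_of_real (s $ i) * fourier \<eta> s + fourier (pderiv1 i \<eta>) s"
  proof -
    have eq: "\<eta> x * ?W x = \<i> * complex_of_real (s $ i) * (\<eta> x * wave s x)" for x
      by (simp only: mult_ac)
    have "(LINT x|lborel. \<eta> x * ?W x + pderiv1 i \<eta> x * wave s x) =
        (LINT x|lborel. \<i> * complex_of_real (s $ i) * (\<eta> x * wave s x)) + (LINT x|lborel. pderiv1 i \<eta> x * wave s x)"
      unfolding eq
      by (intro Bochner_Integration.integral_add integrable_mult_right schwartz_wave_integrable \<eta> d)
    then show ?thesis by (simp only: fourier_def integral_mult_right_zero)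
  qed
  ultimately have "\<i> * (\<i> * complex_of_real (s $ i) * fourier \<eta> s + fourier (pderiv1 i \<eta>) s) = 0" by simp
  then have "\<i> * \<i> * complex_of_real (s $ i) * fourier \<eta> s + \<i> * fourier (pderiv1 i \<eta>) s = 0"
    by (simp only: distrib_left mult.assoc)
  then show ?thesis by simp
qed

lemma fourier_cmult: "fourier (\<lambda>x. c * f x) s = c * fourier f s"
  by (simp add: fourier_def mult.assoc)

lemma fourier_add:
  "f \<in> schwartz \<Longrightarrow> g \<in> schwartz \<Longrightarrow> fourier (\<lambda>x. f x + g x) s = fourier f s + fourier g s"
  by (simp add: fourier_def distrib_right schwartz_wave_integrable)

lemma fourier_diff:
  "f \<in> schwartz \<Longrightarrow> g \<in> schwartz \<Longrightarrow> fourier (\<lambda>x. f x - g x) s = fourier f s - fourier g s"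
  by (simp add: fourier_def left_diff_distrib schwartz_wave_integrable)

lemma sum_inc: "(\<Sum>j\<in>UNIV. inc i k j) = Suc (\<Sum>j\<in>UNIV. k j)" for i :: "'d::finite"
  by (simp add: sum.remove[of UNIV i] inc_apply)

lemma pderiv1_mderiv_schwartz: "\<eta> \<in> schwartz \<Longrightarrow> pderiv1 i (mderiv k \<eta>) = mderiv (inc i k) \<eta>"
  by (rule has_pderiv_imp_pderiv1[OF cont_derivs_has_pderiv[OF schwartz_cont_derivs order_refl]])

lemma monomial_fourier:
  assumes \<eta>: "\<eta> \<in> schwartz"
  shows "monomial a s * fourier \<eta> s = \<i> ^ mdegree a * fourier (mderiv a \<eta>) s"
proof (induction a rule: multiindex_induct)
  case zero
  then show ?case by (simp add: monomial_def)
next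
  case (inc a i)
  have "monomial (inc i a) s * fourier \<eta> s = complex_of_real (s $ i) * (monomial a s * fourier \<eta> s)"
    by (simp only: monomial_inc mult.assoc)
  also have "\<dots> = \<i> ^ mdegree a * (complex_of_real (s $ i) * fourier (mderiv a \<eta>) s)"
    by (simp only: inc.IH mult.left_commute)
  also have "\<dots> = \<i> ^ mdegree a * (\<i> * fourier (mderiv (inc i a) \<eta>) s)"
    by (simp only: fourier_pderiv1[OF schwartz_mderiv[OF \<eta>]] pderiv1_mderiv_schwartz[OF \<eta>])
  finally show ?case by (simp only: sum_inc power_Suc mult_ac)
qed

lemma fourier_bound:
  fixes \<eta> :: "'d::{finite,linorder} cfun"
  assumes "\<eta> \<in> schwartz" "\<And>x. weight 1 x * norm (\<eta> x) \<le> C"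
  shows "norm (fourier \<eta> s) \<le> C * weight_mass TYPE('d)"
  unfolding fourier_def
  by (rule integrable_weight_bounded(2))
    (use assms(2) borel_measurable_integrable[OF schwartz_wave_integrable[OF assms(1)]] in \<open>simp_all add: norm_mult\<close>)

text \<open>All derivatives of the transform are known: \<open>?D k\<close> is the transform of
  \<open>\<psi>\<close> times a monomial and a power of \<i>. Moving the outer monomial inside as a
  derivative turns every seminorm of \<open>fourier \<psi>\<close> into a bound on the transform of
  a Schwartz function.\<close>

lemma
  fixes \<psi> :: "'d::{finite,linorder} cfun"
  assumes \<psi>: "\<psi> \<in> schwartz"
  shows fourier_schwartz: "fourier \<psi> \<in> schwartz"
    and monomial_mderiv_fourier: "monomial a s * mderiv k (fourier \<psi>) s =
      \<i> ^ mdegree a * \<i> ^ mdegree k * fourier (mderiv a (\<lambda>x. monomial k x * \<psi> x)) s"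
proof -
  let ?D = "\<lambda>k. fourier (\<lambda>x. \<i> ^ mdegree k * (monomial k x * \<psi> x))"
  have S: "(\<lambda>x. \<i> ^ n * (monomial k x * \<psi> x)) \<in> schwartz" for n k
    by (intro schwartz_cmult schwartz_monomial \<psi>)
  have fam: "has_pderiv i (?D k) (?D (inc i k))" for i k
  proof -
    have "(\<lambda>x. \<i> * mult_coord i (\<lambda>x. \<i> ^ mdegree k * (monomial k x * \<psi> x)) x) =
        (\<lambda>x. \<i> ^ mdegree (inc i k) * (monomial (inc i k) x * \<psi> x))"
      by (simp only: mult_coord_def monomial_inc sum_inc power_Suc mult_ac)
    with fourier_has_pderiv[OF S, of i] show ?thesis by metis
  qed
  have D0: "?D zero_index = fourier \<psi>" by (simp add: monomial_def)
  have D: "monomial a s * ?D k s =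
      \<i> ^ mdegree a * \<i> ^ mdegree k * fourier (mderiv a (\<lambda>x. monomial k x * \<psi> x)) s" for a k s
  proof -
    have "monomial a s * ?D k s = \<i> ^ mdegree k * (monomial a s * fourier (\<lambda>x. monomial k x * \<psi> x) s)"
      by (subst fourier_cmult) (rule mult.left_commute)
    also have "monomial a s * fourier (\<lambda>x. monomial k x * \<psi> x) s =
        \<i> ^ mdegree a * fourier (mderiv a (\<lambda>x. monomial k x * \<psi> x)) s"
      by (rule monomial_fourier[OF schwartz_monomial[OF \<psi>]])
    finally show ?thesis by (simp only: mult.assoc mult.left_commute[of "\<i> ^ sum k UNIV"])
  qed
  have bdd: "bounded (range (\<lambda>s. monomial a s * ?D k s))" for a k
  proof -
    have "mderiv a (\<lambda>x. monomial k x * \<psi> x) \<in> schwartz" by (intro schwartz_mderiv schwartz_monomial \<psi>)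
    from fourier_bound[OF this] schwartz_decay[OF schwartz_monomial[OF \<psi>], of 1 a k]
    have "\<exists>B. \<forall>s. norm (fourier (mderiv a (\<lambda>x. monomial k x * \<psi> x)) s) \<le> B" by blast
    then show ?thesis unfolding bounded_iff D by (auto simp: norm_mult norm_power)
  qed
  note fam' = fourier_continuous[OF S] fam
  from schwartzI_family[of ?D, OF fam' bdd] show "fourier \<psi> \<in> schwartz" unfolding D0 .
  have "mderiv k (fourier \<psi>) = ?D k"
    using smoothI_family(2)[of ?D k, OF fam'] unfolding D0 .
  then show "monomial a s * mderiv k (fourier \<psi>) s =
      \<i> ^ mdegree a * \<i> ^ mdegree k * fourier (mderiv a (\<lambda>x. monomial k x * \<psi> x)) s"
    by (simp only: D)
qed

lemma schwartz_null_fourier: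
  fixes \<psi>s :: "nat \<Rightarrow> 'd::{finite,linorder} cfun"
  assumes null: "schwartz_null \<psi>s"
  shows "schwartz_null (\<lambda>n. fourier (\<psi>s n))"
proof -
  have S: "\<psi>s n \<in> schwartz" for n using null by (simp add: schwartz_null_def)
  define I where "I = weight_mass TYPE('d)"
  have I: "0 \<le> I" unfolding I_def by (rule weight_mass_nonneg)
  have "unif_null (\<lambda>n s. monomial a s * mderiv k (fourier (\<psi>s n)) s)" for a k
  proof (rule uniform_limitI)
    fix e :: real assume "e > 0"
    \<comment> \<open>I + 1 instead of I ensures a positive divisor and the strict inequality e I/(I
      + 1) < e at the end.\<close>
    then have e: "0 < e / (I + 1)" using I by simp
    let ?m = "\<lambda>n. mderiv a (\<lambda>x. monomial k x * \<psi>s n x)"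
    have "unif_null (\<lambda>n x. weight 1 x * norm (?m n x))"
      by (rule schwartz_null_weight[OF schwartz_null_monomial[OF null]])
    from uniform_limitD[OF this e]
    show "\<forall>\<^sub>F n in sequentially. \<forall>s\<in>UNIV. dist (monomial a s * mderiv k (fourier (\<psi>s n)) s) 0 < e"
    proof eventually_elim
      fix n assume *: "\<forall>x\<in>UNIV. dist (weight 1 x * norm (?m n x)) 0 < e / (I + 1)"
      have bound: "weight 1 x * norm (?m n x) \<le> e / (I + 1)" for x
      proof -
        have "\<bar>weight 1 x * norm (?m n x)\<bar> < e / (I + 1)"
          using * by (simp only: dist_real_def diff_zero) blast
        then show ?thesis by linarith
      qed
      show "\<forall>s\<in>UNIV. dist (monomial a s * mderiv k (fourier (\<psi>s n)) s) 0 < e"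
      proof
        fix s
        have "norm (monomial a s * mderiv k (fourier (\<psi>s n)) s) =
            norm (fourier (?m n) s)"
          by (simp add: monomial_mderiv_fourier[OF S] norm_mult norm_power)
        also have "\<dots> \<le> e / (I + 1) * I"
          unfolding I_def[symmetric]
          using fourier_bound[OF schwartz_mderiv[OF schwartz_monomial[OF S]] bound] by (simp only: I_def)
        also have "\<dots> < e" using I \<open>e > 0\<close> by (simp add: field_simps)
        finally show "dist (monomial a s * mderiv k (fourier (\<psi>s n)) s) 0 < e" by simp
      qed
    qed
  qed
  then show ?thesis using fourier_schwartz[OF S] by (simp add: schwartz_null_def)
qed

definition reflect :: "'d::finite cfun \<Rightarrow> 'd cfun" where
  "reflect f x = f (- x)"

lemma monomial_uminus: "norm (monomial a (- x)) = norm (monomial a x)"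
  unfolding monomial_def norm_of_real abs_prod by (intro prod.cong) (auto simp: power_abs)

lemma has_pderiv_reflect:
  assumes "has_pderiv i f f'"
  shows "has_pderiv i (reflect f) (\<lambda>x. - reflect f' x)"
  unfolding has_pderiv_def
proof
  fix x
  have "((\<lambda>t. f (- x + t *\<^sub>R axis i 1)) has_vector_derivative f' (- x)) (at (- 0))"
    using assms[unfolded has_pderiv_def, THEN spec, of "- x"] by simp
  moreover have "(uminus has_vector_derivative (- 1 :: real)) (at 0)"
    by (auto intro!: derivative_eq_intros)
  ultimately have "((\<lambda>t. f (- x + t *\<^sub>R axis i 1)) \<circ> uminus has_vector_derivative (- 1) *\<^sub>R f' (- x)) (at 0)"
    by (intro vector_diff_chain_at) auto
  then show "((\<lambda>t. reflect f (x + t *\<^sub>R axis i 1)) has_vector_derivative - reflect f' x) (at 0)"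
    by (simp add: reflect_def o_def minus_diff_commute)
qed

lemma
  fixes \<psi> :: "'d::{finite,linorder} cfun"
  assumes \<psi>: "\<psi> \<in> schwartz"
  shows schwartz_reflect: "reflect \<psi> \<in> schwartz"
    and mderiv_reflect: "mderiv k (reflect \<psi>) = (\<lambda>x. (- 1) ^ mdegree k * mderiv k \<psi> (- x))"
proof -
  let ?D = "\<lambda>k x. (- 1) ^ mdegree k * reflect (mderiv k \<psi>) x"
  have fam: "has_pderiv i (?D k) (?D (inc i k))" for i k
    using has_pderiv_cmult[OF has_pderiv_reflect[OF cont_derivs_has_pderiv[OF schwartz_cont_derivs[OF \<psi>] order_refl]],
        of i "(- 1) ^ mdegree k" k]
    by (simp add: sum_inc)
  have cont: "continuous_on UNIV (?D k)" for k
    unfolding reflect_def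
    by (intro continuous_intros continuous_on_compose2[OF schwartz_continuous[OF \<psi>]]) auto
  have D0: "?D zero_index = reflect \<psi>" by simp
  have "bounded (range (\<lambda>x. monomial a x * ?D k x))" for a k
  proof -
    obtain B where B: "\<And>x. norm (monomial a x * mderiv k \<psi> x) \<le> B"
      using bounded_fun_bound[OF schwartz_bounded[OF \<psi>, of a k]] by blast
    have "norm (monomial a x * ?D k x) \<le> B" for x
      using B[of "- x"] by (simp add: norm_mult norm_power monomial_uminus reflect_def)
    then show ?thesis unfolding bounded_iff by blast
  qed
  from schwartzI_family[of ?D, OF cont fam this] show "reflect \<psi> \<in> schwartz" unfolding D0 .
  show "mderiv k (reflect \<psi>) = (\<lambda>x. (- 1) ^ mdegree k * mderiv k \<psi> (- x))"
    using smoothI_family(2)[of ?D k, OF cont fam] unfolding D0 by (simp add: reflect_def)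
qed

lemma schwartz_null_reflect:
  fixes \<psi>s :: "nat \<Rightarrow> 'd::{finite,linorder} cfun"
  assumes null: "schwartz_null \<psi>s"
  shows "schwartz_null (\<lambda>n. reflect (\<psi>s n))"
proof -
  have S: "\<psi>s n \<in> schwartz" for n using null by (simp add: schwartz_null_def)
  have "unif_null (\<lambda>n x. monomial a x * mderiv k (reflect (\<psi>s n)) x)" for a k
  proof (rule uniform_limitI)
    fix e :: real assume "e > 0"
    have "unif_null (\<lambda>n x. monomial a x * mderiv k (\<psi>s n) x)" using null by (simp add: schwartz_null_def)
    from uniform_limitD[OF this \<open>e > 0\<close>]
    show "\<forall>\<^sub>F n in sequentially. \<forall>x\<in>UNIV. dist (monomial a x * mderiv k (reflect (\<psi>s n)) x) 0 < e"
    proof eventually_elim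
      fix n assume *: "\<forall>x\<in>UNIV. dist (monomial a x * mderiv k (\<psi>s n) x) 0 < e"
      show "\<forall>x\<in>UNIV. dist (monomial a x * mderiv k (reflect (\<psi>s n)) x) 0 < e"
      proof
        fix x
        from * have "norm (monomial a (- x) * mderiv k (\<psi>s n) (- x)) < e" by simp
        then show "dist (monomial a x * mderiv k (reflect (\<psi>s n)) x) 0 < e"
          by (simp add: mderiv_reflect[OF S] norm_mult norm_power monomial_uminus)
      qed
    qed
  qed
  then show ?thesis using schwartz_reflect[OF S] by (simp add: schwartz_null_def)
qed

section \<open>Fourier inversion\<close>

lemma integrable_gauss1: "integrable lborel (\<lambda>t::real. exp (- t\<^sup>2 / 2))"
proof -
  have "(\<lambda>t::real. exp (- t\<^sup>2 / 2)) = (\<lambda>t. sqrt (2 * pi) * std_normal_density t)"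
    by (simp add: std_normal_density_def fun_eq_iff)
  then show ?thesis by simp
qed

text \<open>The characteristic function of the standard normal distribution, with the normalizing
  factor of the density removed.\<close>

lemma gauss1_fourier:
  "(LINT t|lborel. complex_of_real (exp (- t\<^sup>2 / 2)) * exp (\<i> * complex_of_real (u * t))) =
    complex_of_real (sqrt (2 * pi) * exp (- u\<^sup>2 / 2))"
proof -
  let ?w = "\<lambda>t. exp (\<i> * complex_of_real (u * t))"
  have "complex_of_real (exp (- u\<^sup>2 / 2)) = (LINT t|std_normal_distribution. ?w t)"
    using fun_cong[OF char_std_normal_distribution, of u] by (simp add: char_def)
  also have "\<dots> = (LINT t|lborel. std_normal_density t *\<^sub>R ?w t)"
    by (subst integral_density) (auto simp: normal_density_nonneg)
  also have "\<dots> = (LINT t|lborel. complex_of_real (1 / sqrt (2 * pi)) *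
      (complex_of_real (exp (- t\<^sup>2 / 2)) * ?w t))"
    by (simp add: std_normal_density_def scaleR_conv_of_real mult.assoc)
  also have "\<dots> = complex_of_real (1 / sqrt (2 * pi)) *
      (LINT t|lborel. complex_of_real (exp (- t\<^sup>2 / 2)) * ?w t)"
    by (rule integral_mult_right_zero)
  finally show ?thesis by (simp add: field_simps)
qed

lemma integrable_gauss1_scaled: "e > 0 \<Longrightarrow> integrable lborel (\<lambda>t::real. exp (- (e * t)\<^sup>2 / 2))"
  using lborel_integrable_real_affine[OF integrable_gauss1, of e 0] by simp

lemma gauss1_scaled_fourier:
  assumes "e > 0"
  shows "(LINT t|lborel. complex_of_real (exp (- (e * t)\<^sup>2 / 2)) * exp (\<i> * complex_of_real (u * t))) =
    complex_of_real (sqrt (2 * pi) / e * exp (- (u / e)\<^sup>2 / 2))"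
proof -
  let ?f = "\<lambda>t. complex_of_real (exp (- (e * t)\<^sup>2 / 2)) * exp (\<i> * complex_of_real (u * t))"
  have "(LINT t|lborel. ?f t) = (1 / e) *\<^sub>R (LINT t|lborel. ?f (0 + 1 / e * t))"
    using lborel_integral_real_affine[of "1 / e" ?f 0] assms by simp
  also have "(LINT t|lborel. ?f (0 + 1 / e * t)) =
      (LINT t|lborel. complex_of_real (exp (- t\<^sup>2 / 2)) * exp (\<i> * complex_of_real ((u / e) * t)))"
    using assms by simp
  also have "\<dots> = complex_of_real (sqrt (2 * pi) * exp (- (u / e)\<^sup>2 / 2))"
    by (rule gauss1_fourier)
  finally show ?thesis by (simp add: scaleR_conv_of_real)
qed

text \<open>This is exp(-(e |x|)^2/2), written as a product so that its integrals factor over the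
  coordinates.\<close>

definition gauss :: "real \<Rightarrow> (real, 'd::finite) vec \<Rightarrow> real" where
  "gauss e x = (\<Prod>i\<in>UNIV. exp (- (e * x $ i)\<^sup>2 / 2))"

lemma gauss_pos: "0 < gauss e x"
  by (simp add: gauss_def prod_pos)

lemma gauss_le_1: "gauss e x \<le> 1"
  by (simp add: gauss_def prod_le_1)

lemma continuous_gauss: "continuous_on S (gauss e)"
  unfolding gauss_def by (intro continuous_intros) auto

lemma integrable_gauss: "e > 0 \<Longrightarrow> integrable lborel (gauss e)"
  unfolding gauss_def by (intro lborel_integrable_prod integrable_gauss1_scaled)

lemma gauss_fourier:
  fixes u :: "(real, 'd::finite) vec"
  assumes "e > 0"
  shows "(LINT s|lborel. complex_of_real (gauss e s) * wave u s) =
    complex_of_real ((sqrt (2 * pi) / e) ^ CARD('d) * gauss (1 / e) u)"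
proof -
  let ?h = "\<lambda>i t. complex_of_real (exp (- (e * t)\<^sup>2 / 2)) * exp (\<i> * complex_of_real (u $ i * t))"
  have int: "integrable lborel (?h i)" for i
    by (rule Bochner_Integration.integrable_bound[OF integrable_gauss1_scaled[OF assms]]) (auto simp: norm_mult)
  have "complex_of_real (gauss e s) * wave u s = (\<Prod>i\<in>UNIV. ?h i (s $ i))" for s
  proof -
    have "\<i> * complex_of_real (s \<bullet> u) = (\<Sum>i\<in>UNIV. \<i> * complex_of_real (u $ i * s $ i))"
      by (simp add: inner_vec_def sum_distrib_left mult_ac)
    then have "wave u s = (\<Prod>i\<in>UNIV. exp (\<i> * complex_of_real (u $ i * s $ i)))"
      by (simp only: exp_sum finite)
    then show ?thesis by (simp only: gauss_def of_real_prod prod.distrib)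
  qed
  then have "(LINT s|lborel. complex_of_real (gauss e s) * wave u s) =
      integral\<^sup>L lborel (\<lambda>s::(real, 'd) vec. \<Prod>i\<in>UNIV. ?h i (s $ i))" by simp
  also have "\<dots> = (\<Prod>i\<in>UNIV. LINT t|lborel. ?h i t)" by (rule lborel_integral_prod[OF int])
  also have "\<dots> = (\<Prod>i\<in>UNIV. complex_of_real (sqrt (2 * pi) / e * exp (- (u $ i / e)\<^sup>2 / 2)))"
    by (simp only: gauss1_scaled_fourier[OF assms])
  also have "\<dots> = complex_of_real ((sqrt (2 * pi) / e) ^ CARD('d) * gauss (1 / e) u)"
  proof -
    have "gauss (1 / e) u = (\<Prod>i\<in>UNIV. exp (- (u $ i / e)\<^sup>2 / 2))"
      by (simp add: gauss_def)
    then show ?thesis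
      by (simp only: of_real_mult of_real_prod of_real_power prod.distrib prod_constant)
  qed
  finally show ?thesis .
qed

lemma wave_mult: "wave s x * wave (- y) s = wave (x - y) s"
  by (simp add: exp_add[symmetric] inner_diff_right inner_commute algebra_simps)

text \<open>Inserting \<open>fourier \<psi>\<close> leads to a double integral whose integrand,
  without the Gaussian, has modulus |\<open>\<psi> x\<close>| and is not integrable in s in general.
  The Gaussian admits Fubini, and the inner integral over s becomes a Gaussian of width e around
  y.\<close>

lemma fourier_gauss_regularized:
  fixes \<psi> :: "'d::{finite,linorder} cfun"
  assumes \<psi>: "\<psi> \<in> schwartz" and e: "e > 0"
  shows "(LINT s|lborel. fourier \<psi> s * wave (- y) s * complex_of_real (gauss e s)) =
    complex_of_real (sqrt (2 * pi) ^ CARD('d)) * (LINT u|lborel. \<psi> (y + e *\<^sub>R u) * complex_of_real (gauss 1 u))"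
proof -
  let ?w = "wave (- y)" and ?G = "\<lambda>s. complex_of_real (gauss e s)"
  let ?R = "LINT u|lborel. \<psi> (y + e *\<^sub>R u) * complex_of_real (gauss 1 u)"
  let ?f = "\<lambda>x s. \<psi> x * (?G s * wave (x - y) s)"
  have [measurable]: "\<psi> \<in> borel_measurable borel" by (rule schwartz_measurable[OF \<psi>])
  have [measurable]: "(gauss e :: (real, 'd) vec \<Rightarrow> real) \<in> borel_measurable borel"
    by (rule continuous_on_borel_measurable[OF continuous_gauss])
  have norm_f: "norm (?f x s) = norm (\<psi> x) * gauss e s" for x s
    using gauss_pos[of e s] by (simp add: norm_mult)
  have "integrable (lborel \<Otimes>\<^sub>M lborel) (\<lambda>(x, s). ?f x s)"
  proof (rule lborel_pair.Fubini_integrable)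
    show "(\<lambda>(x, s). ?f x s) \<in> borel_measurable (lborel \<Otimes>\<^sub>M lborel)" by measurable
    show "integrable lborel (\<lambda>x. LINT s|lborel. norm (case (x, s) of (x, s) \<Rightarrow> ?f x s))"
      unfolding prod.case norm_f
      using schwartz_integrable[OF \<psi>] by simp
    show "AE x in lborel. integrable lborel (\<lambda>s. case (x, s) of (x, s) \<Rightarrow> ?f x s)"
      unfolding prod.case
    proof (rule AE_I2)
      fix x
      show "integrable lborel (?f x)"
        by (rule Bochner_Integration.integrable_bound[OF integrable_mult_right[OF integrable_gauss[OF e], of "norm (\<psi> x)"]])
          (auto simp: norm_f less_imp_le[OF gauss_pos])
    qed
  qed
  then have swap: "(LINT s|lborel. LINT x|lborel. ?f x s) = (LINT x|lborel. LINT s|lborel. ?f x s)"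
    by (rule lborel_pair.Fubini_integral)
  let ?c = "(sqrt (2 * pi) / e) ^ CARD('d)"
  let ?g = "\<lambda>x. \<psi> x * complex_of_real (?c * gauss (1 / e) (x - y))"
  have [measurable]: "(gauss (1 / e) :: (real, 'd) vec \<Rightarrow> real) \<in> borel_measurable borel"
    by (rule continuous_on_borel_measurable[OF continuous_gauss])
  have "fourier \<psi> s * ?w s * ?G s = (LINT x|lborel. ?f x s)" for s
  proof -
    have "fourier \<psi> s * (?w s * ?G s) =
        (LINT x|lborel. \<psi> x * wave s x * (?w s * ?G s))"
      unfolding fourier_def by (rule integral_mult_left_zero[symmetric])
    moreover have "\<psi> x * wave s x * (?w s * ?G s) = ?f x s" for x
      unfolding wave_mult[symmetric] by (simp only: mult_ac)
    ultimately show ?thesis by (simp only: mult.assoc)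
  qed
  then have "(LINT s|lborel. fourier \<psi> s * ?w s * ?G s) = (LINT x|lborel. LINT s|lborel. ?f x s)"
    by (simp only: swap)
  also have "\<dots> = (LINT x|lborel. ?g x)"
    by (simp only: integral_mult_right_zero gauss_fourier[OF e])
  \<comment> \<open>Substitution x = y + e u. The Jacobian cancels the power of e in
    \<open>?c\<close>, so the right-hand side has a limit as e tends to 0.\<close>
  also have "\<dots> = \<bar>e\<bar> ^ CARD('d) *\<^sub>R (LINT u|lborel. ?g (y + e *\<^sub>R u))"
    using lborel_integral_affine[of e ?g y] e by simp
  also have "(LINT u|lborel. ?g (y + e *\<^sub>R u)) = (LINT u|lborel. complex_of_real ?c * (\<psi> (y + e *\<^sub>R u) * complex_of_real (gauss 1 u)))"
  proof -
    have "gauss (1 / e) (e *\<^sub>R u) = gauss 1 u" for u :: "(real, 'd) vec"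
      using e by (simp add: gauss_def)
    then show ?thesis by (simp add: mult_ac)
  qed
  also have "\<dots> = complex_of_real ?c * ?R"
    by (rule integral_mult_right_zero)
  also have "\<bar>e\<bar> ^ CARD('d) *\<^sub>R (complex_of_real ?c * ?R) =
      complex_of_real (\<bar>e\<bar> ^ CARD('d) * ?c) * ?R"
    by (simp only: scaleR_conv_of_real of_real_mult mult.assoc)
  also have "\<bar>e\<bar> ^ CARD('d) * ?c = sqrt (2 * pi) ^ CARD('d)"
    using e by (simp add: power_divide)
  finally show ?thesis .
qed

text \<open>Both sides of the regularized identity converge by dominated convergence as the
  regularization is removed. One factor \<open>sqrt (2 * pi) ^ CARD('d)\<close> is already in that
  identity, the other is the integral of \<open>gauss 1\<close>.\<close>

lemma fourier_inversion:
  fixes \<psi> :: "'d::{finite,linorder} cfun"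
  assumes \<psi>: "\<psi> \<in> schwartz"
  shows "fourier (fourier \<psi>) (- y) = complex_of_real ((2 * pi) ^ CARD('d)) * \<psi> y"
proof -
  define e where "e n = inverse (real (Suc n))" for n
  have e: "0 < e n" for n by (simp add: e_def)
  have e0: "e \<longlonglongrightarrow> 0" unfolding e_def by (rule LIMSEQ_inverse_real_of_nat)
  let ?F = "\<lambda>s. fourier \<psi> s * wave (- y) s"
  let ?g = "\<lambda>u. complex_of_real (gauss 1 u)"
  let ?G = "\<lambda>n s. complex_of_real (gauss (e n) s)"
  let ?c = "sqrt (2 * pi) ^ CARD('d)"
  have F: "fourier \<psi> \<in> schwartz" by (rule fourier_schwartz[OF \<psi>])
  have [measurable]: "\<psi> \<in> borel_measurable borel" by (rule schwartz_measurable[OF \<psi>])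
  have [measurable]: "(gauss c :: (real, 'd) vec \<Rightarrow> real) \<in> borel_measurable borel" for c
    by (rule continuous_on_borel_measurable[OF continuous_gauss])
  have Fw: "integrable lborel ?F" by (rule schwartz_wave_integrable[OF F])
  have "(\<lambda>n. LINT s|lborel. ?F s * ?G n s) \<longlonglongrightarrow>
      (LINT s|lborel. ?F s)"
  proof (rule integral_dominated_convergence[where w = "\<lambda>s. norm (?F s)"])
    show "integrable lborel (\<lambda>s. norm (?F s))" by (rule integrable_norm[OF Fw])
    show "AE s in lborel. (\<lambda>n. ?F s * ?G n s) \<longlonglongrightarrow> ?F s"
    proof (rule AE_I2)
      fix s :: "(real, 'd) vec"
      have "(\<lambda>n. gauss (e n) s) \<longlonglongrightarrow> (\<Prod>i\<in>UNIV. exp (- (0 * s $ i)\<^sup>2 / 2))"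
        unfolding gauss_def by (intro tendsto_intros e0) auto
      then have "(\<lambda>n. ?F s * ?G n s) \<longlonglongrightarrow> ?F s * complex_of_real 1"
        by (intro tendsto_intros) simp
      then show "(\<lambda>n. ?F s * ?G n s) \<longlonglongrightarrow> ?F s"
        by simp
    qed
    show "AE s in lborel. norm (?F s * ?G n s) \<le> norm (?F s)" for n
    proof (rule AE_I2)
      fix s :: "(real, 'd) vec"
      have "norm (?G n s) \<le> 1"
        using gauss_pos[of "e n" s] gauss_le_1[of "e n" s] by simp
      from mult_left_mono[OF this, of "norm (?F s)"]
      show "norm (?F s * ?G n s) \<le> norm (?F s)"
        by (simp only: norm_mult[of _ "?G n s"] mult_1_right norm_ge_zero)
    qed
    show "(\<lambda>s. ?F s * ?G n s) \<in> borel_measurable lborel" for n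
      by (rule borel_measurable_times[OF borel_measurable_integrable[OF Fw]]) measurable
  qed (rule borel_measurable_integrable[OF Fw])
  moreover have "(\<lambda>n. LINT u|lborel. \<psi> (y + e n *\<^sub>R u) * ?g u) \<longlonglongrightarrow>
      (LINT u|lborel. \<psi> y * ?g (u :: (real, 'd) vec))"
  proof -
    have cont: "continuous_on UNIV \<psi>" using schwartz_continuous[OF \<psi>, of zero_index] by simp
    obtain B where B: "0 \<le> B" "\<And>x. norm (\<psi> x) \<le> B"
    proof -
      have "bounded (range \<psi>)"
        using schwartz_bounded[OF \<psi>, of zero_index zero_index] by (simp add: monomial_def)
      then show ?thesis using bounded_fun_bound that by blast
    qed
    show ?thesis
    proof (rule integral_dominated_convergence[where w = "\<lambda>u. B * gauss 1 u"])
      show "integrable lborel (\<lambda>u. B * gauss 1 (u :: (real, 'd) vec))"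
        by (intro integrable_mult_right integrable_gauss) simp
      show "AE u in lborel. (\<lambda>n. \<psi> (y + e n *\<^sub>R u) * ?g u) \<longlonglongrightarrow> \<psi> y * ?g u"
      proof (rule AE_I2)
        fix u
        have "(\<lambda>n. y + e n *\<^sub>R u) \<longlonglongrightarrow> y + 0 *\<^sub>R u" by (intro tendsto_intros e0)
        then have "(\<lambda>n. \<psi> (y + e n *\<^sub>R u)) \<longlonglongrightarrow> \<psi> (y + 0 *\<^sub>R u)"
          using cont by (intro continuous_on_tendsto_compose[OF cont]) auto
        then show "(\<lambda>n. \<psi> (y + e n *\<^sub>R u) * ?g u) \<longlonglongrightarrow> \<psi> y * ?g u"
          by (intro tendsto_intros) simp
      qed
      show "AE u in lborel. norm (\<psi> (y + e n *\<^sub>R u) * ?g u) \<le> B * gauss 1 u" for n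
      proof (rule AE_I2)
        fix u :: "(real, 'd) vec"
        show "norm (\<psi> (y + e n *\<^sub>R u) * ?g u) \<le> B * gauss 1 u"
          using mult_right_mono[OF B(2)[of "y + e n *\<^sub>R u"] less_imp_le[OF gauss_pos[of 1 u]]] gauss_pos[of 1 u]
          by (simp add: norm_mult)
      qed
    qed measurable
  qed
  moreover have "(LINT u|lborel. \<psi> y * ?g (u :: (real, 'd) vec)) = \<psi> y * complex_of_real ?c"
  proof -
    have "(LINT u|lborel. ?g (u :: (real, 'd) vec)) = complex_of_real ?c"
      using gauss_fourier[of 1 "0 :: (real, 'd) vec"] by (simp add: gauss_def)
    then show ?thesis by (simp only: integral_mult_right_zero)
  qed
  ultimately have lim: "(\<lambda>n. LINT s|lborel. ?F s * ?G n s) \<longlonglongrightarrow> fourier (fourier \<psi>) (- y)"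
    and lim': "(\<lambda>n. complex_of_real ?c * (LINT u|lborel. \<psi> (y + e n *\<^sub>R u) * ?g u)) \<longlonglongrightarrow> complex_of_real ?c * (\<psi> y * complex_of_real ?c)"
    by (simp_all only: fourier_def[of "fourier \<psi>"] tendsto_mult_left)
  have "fourier (fourier \<psi>) (- y) = complex_of_real ?c * (\<psi> y * complex_of_real ?c)"
    using lim lim' unfolding fourier_gauss_regularized[OF \<psi> e] by (rule LIMSEQ_unique)
  also have "\<dots> = complex_of_real (?c * ?c) * \<psi> y" by (simp only: of_real_mult mult_ac)
  also have "?c * ?c = (2 * pi) ^ CARD('d)"
  proof -
    have "sqrt (2 * pi) * sqrt (2 * pi) = 2 * pi" by simp
    then show ?thesis by (metis power_mult_distrib)
  qed
  finally show ?thesis .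
qed

section \<open>The inverse transform on Schwartz functions and on tempered distributions\<close>

definition fourier_inv :: "'d::finite cfun \<Rightarrow> 'd cfun" where
  "fourier_inv \<psi> = (\<lambda>y. inverse (complex_of_real ((2 * pi) ^ CARD('d))) * reflect (fourier \<psi>) y)"

lemma schwartz_fourier_inv: "\<psi> \<in> schwartz \<Longrightarrow> fourier_inv \<psi> \<in> schwartz"
  unfolding fourier_inv_def by (intro schwartz_cmult schwartz_reflect fourier_schwartz)

lemma schwartz_null_fourier_inv: "schwartz_null \<psi>s \<Longrightarrow> schwartz_null (\<lambda>n. fourier_inv (\<psi>s n))"
  unfolding fourier_inv_def by (intro schwartz_null_cmult schwartz_null_reflect schwartz_null_fourier)

lemma two_pi_power_cancel:
  "inverse (complex_of_real ((2 * pi) ^ n)) * (complex_of_real ((2 * pi) ^ n) * z) = z"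
proof -
  have "complex_of_real ((2 * pi) ^ n) \<noteq> 0" by simp
  then show ?thesis by (metis left_inverse mult.assoc mult_1)
qed

lemma fourier_inv_fourier: "\<psi> \<in> schwartz \<Longrightarrow> fourier_inv (fourier \<psi>) = \<psi>"
  by (simp only: fourier_inv_def reflect_def fourier_inversion two_pi_power_cancel)

lemma fourier_reflect:
  fixes f :: "'d::{finite,linorder} cfun"
  assumes "f \<in> schwartz"
  shows "fourier (reflect f) y = fourier f (- y)"
proof -
  have "(\<lambda>x. f x * wave (- y) x) \<in> borel_measurable borel"
    using borel_measurable_integrable[OF schwartz_wave_integrable[OF assms, of "- y"]]
    by (simp only: measurable_lborel1 measurable_lborel2)
  from lborel_integral_affine[OF _ this, of "-1" 0] show ?thesis
    by (simp add: fourier_def reflect_def)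
qed

lemma fourier_fourier_inv:
  assumes "\<psi> \<in> schwartz"
  shows "fourier (fourier_inv \<psi>) = \<psi>"
proof
  fix y
  have "fourier (fourier_inv \<psi>) y = inverse (complex_of_real ((2 * pi) ^ CARD('a))) * fourier (fourier \<psi>) (- y)"
    unfolding fourier_inv_def fourier_cmult fourier_reflect[OF fourier_schwartz[OF assms]] ..
  then show "fourier (fourier_inv \<psi>) y = \<psi> y"
    by (simp only: fourier_inversion[OF assms] two_pi_power_cancel)
qed

lemma fourier_inv_add:
  "f \<in> schwartz \<Longrightarrow> g \<in> schwartz \<Longrightarrow> fourier_inv (\<lambda>x. f x + g x) = (\<lambda>y. fourier_inv f y + fourier_inv g y)"
  by (simp add: fourier_inv_def reflect_def fourier_add distrib_left)

lemma fourier_inv_diff: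
  "f \<in> schwartz \<Longrightarrow> g \<in> schwartz \<Longrightarrow> fourier_inv (\<lambda>x. f x - g x) = (\<lambda>y. fourier_inv f y - fourier_inv g y)"
  by (simp add: fourier_inv_def reflect_def fourier_diff right_diff_distrib)

lemma fourier_inv_cmult: "fourier_inv (\<lambda>x. c * f x) = (\<lambda>y. c * fourier_inv f y)"
  by (simp add: fourier_inv_def reflect_def fourier_cmult mult.left_commute)

lemma schwartz_tendsto_fourier_inv:
  assumes "schwartz_tendsto \<psi>s \<psi>"
  shows "schwartz_tendsto (\<lambda>n. fourier_inv (\<psi>s n)) (fourier_inv \<psi>)"
proof -
  have S: "\<And>n. \<psi>s n \<in> schwartz" "\<psi> \<in> schwartz" and null: "schwartz_null (\<lambda>n x. \<psi>s n x - \<psi> x)"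
    using assms by (auto simp: schwartz_tendsto_iff_null)
  have "schwartz_null (\<lambda>n. fourier_inv (\<lambda>x. \<psi>s n x - \<psi> x))"
    by (rule schwartz_null_fourier_inv[OF null])
  then show ?thesis
    unfolding schwartz_tendsto_iff_null
    using S by (simp add: schwartz_fourier_inv fourier_inv_diff)
qed

text \<open>The explicit preimage \<open>b'\<close> shows that \<open>b\<close> lies in the range of
  \<open>Ft\<close>, so \<open>inv_into\<close> returns a true preimage. Whatever preimage it
  returns, its value at \<open>\<psi>\<close> is forced, since \<open>\<psi>\<close> is the
  transform of \<open>fourier_inv \<psi>\<close>.\<close>

lemma
  fixes b :: "'d::{finite,linorder} functional"
  assumes b: "b \<in> tempered"
  shows Ft_inv_tempered: "Ft_inv b \<in> tempered"
    and Ft_inv_apply: "\<psi> \<in> schwartz \<Longrightarrow> Ft_inv b \<psi> = b (fourier_inv \<psi>)"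
proof -
  define b' where "b' = (\<lambda>\<psi>. if \<psi> \<in> schwartz then b (fourier_inv \<psi>) else 0)"
  have b_add: "b (\<lambda>x. f x + g x) = b f + b g" if "f \<in> schwartz" "g \<in> schwartz" for f g
    using b that by (simp add: tempered_def)
  have b_cmult: "b (\<lambda>x. a * f x) = a * b f" if "f \<in> schwartz" for f a
    using b that by (simp add: tempered_def)
  have b_cont: "(\<lambda>n. b (fs n)) \<longlonglongrightarrow> b f" if "schwartz_tendsto fs f" for fs f
    using b that by (simp add: tempered_def)
  have b_out: "b f = 0" if "f \<notin> schwartz" for f
    using b that by (simp add: tempered_def)
  have "b' \<in> tempered"
    unfolding tempered_def
  proof (intro CollectI conjI ballI allI impI)
    fix \<psi> \<eta> :: "'d cfun" assume "\<psi> \<in> schwartz" "\<eta> \<in> schwartz"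
    then show "b' (\<lambda>x. \<psi> x + \<eta> x) = b' \<psi> + b' \<eta>"
      by (simp add: b'_def schwartz_add fourier_inv_add b_add schwartz_fourier_inv)
  next
    fix \<psi> :: "'d cfun" and a assume "\<psi> \<in> schwartz"
    then show "b' (\<lambda>x. a * \<psi> x) = a * b' \<psi>"
      by (simp add: b'_def schwartz_cmult fourier_inv_cmult b_cmult schwartz_fourier_inv)
  next
    fix \<psi>s and \<psi> :: "'d cfun" assume "schwartz_tendsto \<psi>s \<psi>"
    moreover from this have "\<psi>s n \<in> schwartz" "\<psi> \<in> schwartz" for n by (auto simp: schwartz_tendsto_def)
    ultimately show "(\<lambda>n. b' (\<psi>s n)) \<longlonglongrightarrow> b' \<psi>"
      using b_cont[OF schwartz_tendsto_fourier_inv] by (simp add: b'_def)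
  qed (simp add: b'_def)
  moreover have "Ft b' = b"
    by (auto simp: Ft_def b'_def fun_eq_iff fourier_schwartz fourier_inv_fourier b_out)
  ultimately have img: "b \<in> Ft ` tempered" by blast
  show "Ft_inv b \<in> tempered" unfolding Ft_inv_def by (rule inv_into_into[OF img])
  assume \<psi>: "\<psi> \<in> schwartz"
  have "Ft (Ft_inv b) (fourier_inv \<psi>) = Ft_inv b (fourier (fourier_inv \<psi>))"
    using schwartz_fourier_inv[OF \<psi>] by (simp add: Ft_def)
  moreover have "Ft (Ft_inv b) = b" unfolding Ft_inv_def by (rule f_inv_into_f[OF img])
  ultimately show "Ft_inv b \<psi> = b (fourier_inv \<psi>)" by (simp add: fourier_fourier_inv[OF \<psi>])
qed

lemma tempered_tendsto_Ft_inv: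
  assumes "tempered_tendsto bs b"
  shows "tempered_tendsto (\<lambda>n. Ft_inv (bs n)) (Ft_inv b)"
  using assms unfolding tempered_tendsto_def
  by (simp add: Ft_inv_tempered Ft_inv_apply schwartz_fourier_inv)

section \<open>Convergence\<close>

text \<open>The exponents \<open>m i / 2\<close> are coarsened to one integer exponent, the degree
  of \<open>m\<close>, so that growth is measured by the same \<open>weight\<close> as Schwartz
  decay. The bound depends on \<open>m\<close> and \<open>V\<close> alone and is thus shared by the
  whole sequence.\<close>

lemma SlmE:
  fixes \<gamma> :: "'d::{finite,linorder} functional"
  assumes "\<gamma> \<in> Slm l m V"
  obtains c where "\<gamma> \<in> tempered" "continuous_on UNIV c"
    "\<And>x. norm (c x) \<le> V * weight (\<Sum>i\<in>UNIV. m i) x" "\<And>\<psi>. \<psi> \<in> schwartz \<Longrightarrow> \<gamma> \<psi> = gderiv l c \<psi>"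
proof -
  let ?w = "\<lambda>x::(real, 'd) vec. \<Prod>i\<in>UNIV. (1 + (x $ i)\<^sup>2) powr (real (m i) / 2)"
  from assms obtain c c' where \<gamma>: "\<gamma> \<in> tempered"
    and c: "\<And>x. c x = complex_of_real (?w x) * c' x" and c': "continuous_on UNIV c'" "\<And>x. norm (c' x) < V"
    and eq: "\<And>\<psi>. \<psi> \<in> schwartz \<Longrightarrow> \<gamma> \<psi> = gderiv l c \<psi>"
    unfolding Slm_def by blast
  have pos: "0 < 1 + (x $ i)\<^sup>2" for x :: "(real, 'd) vec" and i by (simp add: add_pos_nonneg)
  have w_le: "?w x \<le> weight (\<Sum>i\<in>UNIV. m i) x" for x
  proof (intro prod_mono conjI)
    fix i
    have "real (m i) / 2 \<le> real (\<Sum>i\<in>UNIV. m i)"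
    proof -
      have "m i \<le> (\<Sum>i\<in>UNIV. m i)" by (rule member_le_sum) auto
      then show ?thesis by linarith
    qed
    then have "(1 + (x $ i)\<^sup>2) powr (real (m i) / 2) \<le> (1 + (x $ i)\<^sup>2) powr real (\<Sum>i\<in>UNIV. m i)"
      by (intro powr_mono) auto
    also have "\<dots> = (1 + (x $ i)\<^sup>2) ^ mdegree m" by (rule powr_realpow[OF pos])
    finally show "(1 + (x $ i)\<^sup>2) powr (real (m i) / 2) \<le> (1 + (x $ i)\<^sup>2) ^ mdegree m" .
  qed simp
  have w_nonneg: "0 \<le> ?w x" for x by (simp add: prod_nonneg)
  have cont: "continuous_on UNIV c"
  proof -
    have "continuous_on UNIV (\<lambda>x. complex_of_real (?w x) * c' x)"
      using pos by (intro continuous_intros c'(1)) (auto simp: less_imp_neq[symmetric])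
    then show ?thesis by (simp add: c[abs_def])
  qed
  have "norm (c x) \<le> V * weight (\<Sum>i\<in>UNIV. m i) x" for x
  proof -
    have "norm (c x) = ?w x * norm (c' x)" using w_nonneg[of x] by (simp only: c norm_mult norm_of_real abs_of_nonneg)
    also have "\<dots> \<le> weight (\<Sum>i\<in>UNIV. m i) x * V"
      by (intro mult_mono w_le less_imp_le[OF c'(2)] less_imp_le[OF weight_pos]) auto
    finally show ?thesis by (simp only: mult.commute)
  qed
  with \<gamma> cont show ?thesis using eq that by blast
qed

text \<open>\<open>product_representation\<close> writes \<open>p\<close> as the generalized
  derivative of a continuous \<open>e\<close>, as a further product requires. Testing this
  representation against \<open>inverse (\<phi> x) * \<psi> x\<close> cancels \<open>\<phi>\<close>
  and returns \<open>\<gamma>\<close>.\<close>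

lemma is_product_inverse:
  fixes \<phi> :: "'d::{finite,linorder} cfun"
  assumes \<gamma>: "\<gamma> \<in> tempered" and c: "continuous_on UNIV c" "\<And>\<psi>. \<psi> \<in> test_functions \<Longrightarrow> \<gamma> \<psi> = gderiv l c \<psi>"
    and p: "is_product l \<gamma> \<phi> p" and nz: "\<And>x. \<phi> x \<noteq> 0"
  shows "is_product l p (\<lambda>x. inverse (\<phi> x)) \<gamma>"
proof -
  have \<phi>: "cont_derivs l \<phi>" using p by (simp add: is_product_def)
  obtain e where e: "continuous_on UNIV e"
    "\<And>\<eta> K. cont_derivs l \<eta> \<Longrightarrow> compact K \<Longrightarrow> \<forall>x. x \<notin> K \<longrightarrow> \<eta> x = 0 \<Longrightarrow>
      (pairing c (mderiv l (\<lambda>y. \<phi> y * \<eta> y))) = (pairing e (mderiv l \<eta>))"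
    using product_representation[OF c(1) \<phi>] by blast
  have inv: "cont_derivs l (\<lambda>x. inverse (\<phi> x))" by (rule cont_derivs_inverse[OF \<phi> nz])
  have 1: "p \<psi> = gderiv l e \<psi>" if \<psi>: "\<psi> \<in> test_functions" for \<psi>
  proof -
    obtain K where K: "cont_derivs l \<psi>" "compact K" "\<And>x. x \<notin> K \<Longrightarrow> \<psi> x = 0"
      by (rule test_functionE[OF \<psi>, of l]) blast
    then show ?thesis using is_product_formula[OF p c \<psi>] e(2)[OF K(1,2)] by (simp add: gderiv_def)
  qed
  have 2: "\<gamma> \<psi> = (- 1) ^ mdegree l * (pairing e (mderiv l (\<lambda>y. inverse (\<phi> y) * \<psi> y)))"
    if \<psi>: "\<psi> \<in> test_functions" for \<psi>
  proof -
    obtain K where K: "cont_derivs l \<psi>" "compact K" "\<And>x. x \<notin> K \<Longrightarrow> \<psi> x = 0"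
      by (rule test_functionE[OF \<psi>, of l]) blast
    \<comment> \<open>Here the representation is used at a function that need not be smooth; this is
      why it is stated for all compactly supported functions of class C^l.\<close>
    have "(pairing c (mderiv l (\<lambda>y. \<phi> y * (inverse (\<phi> y) * \<psi> y)))) =
        (pairing e (mderiv l (\<lambda>y. inverse (\<phi> y) * \<psi> y)))"
      by (rule e(2)[OF cont_derivs_mult[OF inv K(1)] K(2)]) (simp add: K(3))
    moreover have "(\<lambda>y. \<phi> y * (inverse (\<phi> y) * \<psi> y)) = \<psi>"
      using nz by (simp add: fun_eq_iff mult.assoc[symmetric])
    ultimately show ?thesis using c(2)[OF \<psi>] by (simp add: gderiv_def)
  qed
  show ?thesis
    unfolding is_product_def using \<gamma> inv e(1) 1 2 by blast
qed

text \<open>Growth of order M against decay of order \<open>Suc M\<close> leaves one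
  \<open>weight 1\<close>, whose reciprocal is integrable. The resulting bound depends on
  \<open>c\<close> only through \<open>A\<close>.\<close>

lemma
  fixes c \<psi> :: "'d::{finite,linorder} cfun"
  assumes c: "continuous_on UNIV c" "\<And>x. norm (c x) \<le> A * weight M x"
    and \<psi>: "\<psi> \<in> schwartz" and e: "\<And>x. weight (Suc M) x * norm (mderiv l \<psi> x) \<le> e" and A: "0 \<le> A"
  shows integrable_weight_mderiv: "integrable lborel (\<lambda>x. c x * mderiv l \<psi> x)"
    and norm_integral_weight_mderiv_le: "norm (pairing c (mderiv l \<psi>)) \<le>
      A * e * weight_mass TYPE('d)"
proof -
  have "weight 1 x * norm (c x * mderiv l \<psi> x) \<le> A * e" for x
  proof -
    have "weight 1 x * norm (c x * mderiv l \<psi> x) = norm (c x) * (weight 1 x * norm (mderiv l \<psi> x))"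
      by (simp only: norm_mult mult_ac)
    also have "\<dots> \<le> (A * weight M x) * (weight 1 x * norm (mderiv l \<psi> x))"
      by (intro mult_right_mono c(2) mult_nonneg_nonneg less_imp_le[OF weight_pos] norm_ge_zero)
    also have "\<dots> = A * (weight (Suc M) x * norm (mderiv l \<psi> x))"
      by (simp only: weight_Suc[of _ M] mult.assoc)
    also have "\<dots> \<le> A * e" by (intro mult_left_mono e A)
    finally show ?thesis .
  qed
  moreover have "(\<lambda>x. c x * mderiv l \<psi> x) \<in> borel_measurable borel"
    by (intro continuous_on_borel_measurable continuous_intros c(1) schwartz_continuous[OF \<psi>])
  ultimately show "integrable lborel (\<lambda>x. c x * mderiv l \<psi> x)"
    "norm (pairing c (mderiv l \<psi>)) \<le>
      A * e * weight_mass TYPE('d)"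
    using integrable_weight_bounded by blast+
qed

text \<open>Replacing \<open>\<psi>\<close> by one test function close to it in the seminorm with
  weight \<open>Suc M\<close> costs an error proportional to \<open>A\<close>, the same for every
  \<open>ds n\<close>.\<close>

lemma integral_mderiv_schwartz_tendsto_0:
  fixes \<psi> :: "'d::{finite,linorder} cfun"
  assumes ds: "\<And>n. continuous_on UNIV (ds n)" "\<And>n x. norm (ds n x) \<le> A * weight M x" and A: "0 \<le> A"
    and test: "\<And>\<psi>. \<psi> \<in> test_functions \<Longrightarrow> (\<lambda>n. pairing (ds n) (mderiv l \<psi>)) \<longlonglongrightarrow> 0"
    and \<psi>: "\<psi> \<in> schwartz"
  shows "(\<lambda>n. pairing (ds n) (mderiv l \<psi>)) \<longlonglongrightarrow> 0"
proof (rule LIMSEQ_approximation)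
  fix e :: real assume e: "e > 0"
  define I where "I = weight_mass TYPE('d)"
  have I: "0 \<le> I" unfolding I_def by (rule weight_mass_nonneg)
  \<comment> \<open>Chosen so that \<open>A * \<delta> * I \<le> e\<close>; the added 1 allows A or
    I to be 0.\<close>
  define \<delta> where "\<delta> = e / (A * I + 1)"
  have \<delta>: "\<delta> > 0" using A I e by (simp add: \<delta>_def add_nonneg_pos)
  obtain \<psi>s where \<psi>s: "\<And>n. \<psi>s n \<in> test_functions" "schwartz_tendsto \<psi>s \<psi>"
    using test_functions_dense[OF \<psi>] by blast
  have S: "\<psi>s n \<in> schwartz" for n by (rule test_function_schwartz[OF \<psi>s(1)])
  have "schwartz_null (\<lambda>n x. \<psi>s n x - \<psi> x)"
    using \<psi>s(2) by (simp add: schwartz_tendsto_iff_null)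
  from uniform_limitD[OF schwartz_null_weight[OF this] \<delta>, of "Suc M" l]
  obtain j where j': "\<And>x. dist (weight (Suc M) x * norm (mderiv l (\<lambda>x. \<psi>s j x - \<psi> x) x)) 0 < \<delta>"
    unfolding eventually_sequentially by blast
  have j: "weight (Suc M) x * norm (mderiv l (\<lambda>x. \<psi>s j x - \<psi> x) x) \<le> \<delta>" for x
    using j'[of x] unfolding dist_real_def diff_zero by linarith
  obtain C where C: "\<And>x. weight (Suc M) x * norm (mderiv l \<psi> x) \<le> C"
    using schwartz_decay[OF \<psi>] by blast
  obtain C' where C': "\<And>x. weight (Suc M) x * norm (mderiv l (\<psi>s j) x) \<le> C'"
    using schwartz_decay[OF S] by blast
  show "\<exists>y. y \<longlonglongrightarrow> 0 \<and> (\<forall>n. norm ((pairing (ds n) (mderiv l \<psi>)) - y n) \<le> e)"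
  proof (intro exI conjI allI)
    show "(\<lambda>n. pairing (ds n) (mderiv l (\<psi>s j))) \<longlonglongrightarrow> 0" by (rule test[OF \<psi>s(1)])
    fix n
    have "norm (pairing (ds n) (mderiv l (\<lambda>x. \<psi>s j x - \<psi> x))) \<le> A * \<delta> * I"
      unfolding I_def by (rule norm_integral_weight_mderiv_le[OF ds schwartz_diff[OF S \<psi>] j A])
    also have "\<dots> = (A * I) / (A * I + 1) * e" by (simp add: \<delta>_def mult_ac)
    also have "\<dots> \<le> 1 * e" using A I e by (intro mult_right_mono) (auto simp: add_nonneg_pos)
    also have "(pairing (ds n) (mderiv l (\<lambda>x. \<psi>s j x - \<psi> x))) =
        (pairing (ds n) (mderiv l (\<psi>s j))) - (pairing (ds n) (mderiv l \<psi>))"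
      using integrable_weight_mderiv[OF ds \<psi> C A, of n] integrable_weight_mderiv[OF ds S C' A, of n]
      by (simp add: mderiv_diff_schwartz[OF S \<psi>] right_diff_distrib)
    finally show "norm ((pairing (ds n) (mderiv l \<psi>)) - (pairing (ds n) (mderiv l (\<psi>s j)))) \<le> e"
      by (simp add: norm_minus_commute)
  qed
qed

lemma continuous_weight: "continuous_on S (weight M)"
  by (intro continuous_intros)

theorem theorem4:
  fixes l m :: "'d::{finite,linorder} \<Rightarrow> nat" and V :: real
    and \<gamma> \<epsilon> g :: "'d functional" and \<gamma>s \<epsilon>s :: "nat \<Rightarrow> 'd functional"
    and \<phi> :: "'d cfun"
  assumes "V > 0"
    and "\<gamma> \<in> Slm l m V" and "\<And>n. \<gamma>s n \<in> Slm l m V"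
    and "continuous_on UNIV \<phi>" and "regular_function \<phi>" and "cont_derivs l \<phi>"
    and "product_exists l \<gamma> \<phi>" and "\<epsilon> = product_of l \<gamma> \<phi>"
    and "\<And>n. product_exists l (\<gamma>s n) \<phi>" and "\<And>n. \<epsilon>s n = product_of l (\<gamma>s n) \<phi>"
    and "tempered_tendsto (\<lambda>n \<psi>. \<epsilon>s n \<psi> - \<epsilon> \<psi>) (\<lambda>\<psi>. 0)"
    and "g = Ft_inv \<gamma>"
    and "\<And>x. \<phi> x \<noteq> 0"
    and "\<And>k. k \<le> l \<Longrightarrow> PG (mderiv k (\<lambda>x. inverse (\<phi> x)))"
  shows "(\<forall>n. product_exists l (\<epsilon>s n) (\<lambda>x. inverse (\<phi> x))) \<and>
         tempered_tendsto (\<lambda>n. Ft_inv (product_of l (\<epsilon>s n) (\<lambda>x. inverse (\<phi> x)))) g"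
proof -
  let ?M = "\<Sum>i\<in>UNIV. m i"
  note \<phi> = \<open>cont_derivs l \<phi>\<close> and nz = \<open>\<And>x. \<phi> x \<noteq> 0\<close>
  have \<epsilon>: "is_product l \<gamma> \<phi> \<epsilon>"
    using \<open>product_exists l \<gamma> \<phi>\<close> \<open>\<epsilon> = _\<close> product_of_eqI by (auto simp: product_exists_def)
  have \<epsilon>s: "is_product l (\<gamma>s n) \<phi> (\<epsilon>s n)" for n
    using assms(9)[of n] assms(10)[of n] product_of_eqI by (auto simp: product_exists_def)
  obtain c where c: "\<gamma> \<in> tempered" "continuous_on UNIV c"
    "\<And>x. norm (c x) \<le> V * weight ?M x" "\<And>\<psi>. \<psi> \<in> schwartz \<Longrightarrow> \<gamma> \<psi> = gderiv l c \<psi>"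
    by (rule SlmE[OF assms(2)]) blast
  have "\<forall>n. \<exists>c. \<gamma>s n \<in> tempered \<and> continuous_on UNIV c \<and>
    (\<forall>x. norm (c x) \<le> V * weight ?M x) \<and> (\<forall>\<psi>\<in>schwartz. \<gamma>s n \<psi> = gderiv l c \<psi>)"
    using SlmE[OF assms(3)] by metis
  then obtain cs where cs: "\<And>n. \<gamma>s n \<in> tempered" "\<And>n. continuous_on UNIV (cs n)"
    "\<And>n x. norm (cs n x) \<le> V * weight ?M x" "\<And>n \<psi>. \<psi> \<in> schwartz \<Longrightarrow> \<gamma>s n \<psi> = gderiv l (cs n) \<psi>"
    by metis
  \<comment> \<open>This identifies the product of \<open>\<epsilon>s n\<close> with the reciprocal
    as \<open>\<gamma>s n\<close>, so only the convergence of \<open>\<gamma>s n\<close> to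
    \<open>\<gamma>\<close> remains.\<close>
  have inverse_product: "is_product l (\<epsilon>s n) (\<lambda>x. inverse (\<phi> x)) (\<gamma>s n)" for n
    by (rule is_product_inverse[OF cs(1,2) cs(4) \<epsilon>s nz]) (rule test_function_schwartz)
  define ds where "ds n x = cs n x - c x" for n x
  have ds_cont: "continuous_on UNIV (ds n)" for n
    unfolding ds_def by (intro continuous_intros cs(2) c(2))
  have ds_bound: "norm (ds n x) \<le> (2 * V) * weight ?M x" for n x
    using norm_triangle_ineq4[of "cs n x" "c x"] cs(3)[of n x] c(3)[of x] by (simp add: ds_def)
  \<comment> \<open>The hypothesis on \<open>\<epsilon>s n\<close> rewritten for the
    representatives: up to sign, the pairing is the difference of the two products at
    \<open>\<psi>\<close>.\<close>
  have product_test: "(\<lambda>n. pairing (ds n) (mderiv l (\<lambda>y. \<phi> y * \<psi> y))) \<longlonglongrightarrow> 0"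
    if \<psi>: "\<psi> \<in> test_functions" for \<psi>
  proof -
    let ?s = "(- 1) ^ mdegree l :: complex"
    obtain K where K: "cont_derivs l \<psi>" "compact K" "\<And>x. x \<notin> K \<Longrightarrow> \<psi> x = 0"
      by (rule test_functionE[OF \<psi>, of l]) blast
    have \<phi>\<psi>: "cont_derivs l (\<lambda>y. \<phi> y * \<psi> y)" by (rule cont_derivs_mult[OF \<phi> K(1)])
    have int: "integrable lborel (\<lambda>x. a x * mderiv l (\<lambda>y. \<phi> y * \<psi> y) x)" if "continuous_on UNIV a" for a
      by (rule integrable_mult_mderiv[OF that \<phi>\<psi> K(2)]) (simp add: K(3))
    have "\<epsilon>s n \<psi> - \<epsilon> \<psi> = ?s * (pairing (ds n) (mderiv l (\<lambda>y. \<phi> y * \<psi> y)))" for n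
      using is_product_formula[OF \<epsilon>s cs(2) cs(4)[OF test_function_schwartz] \<psi>, of n]
        is_product_formula[OF \<epsilon> c(2) c(4)[OF test_function_schwartz] \<psi>] int[OF cs(2)[of n]] int[OF c(2)]
      by (simp add: ds_def left_diff_distrib right_diff_distrib)
    moreover have "(\<lambda>n. \<epsilon>s n \<psi> - \<epsilon> \<psi>) \<longlonglongrightarrow> 0"
      using assms(11) test_function_schwartz[OF \<psi>] by (simp add: tempered_tendsto_def)
    ultimately have "(\<lambda>n. ?s * (?s * (pairing (ds n) (mderiv l (\<lambda>y. \<phi> y * \<psi> y))))) \<longlonglongrightarrow> ?s * 0"
      by (intro tendsto_mult_left) simp
    \<comment> \<open>The sign is its own inverse; a second multiplication by it removes it from the
      limit.\<close>
    moreover have "?s * ?s = 1" by (simp add: power_mult_distrib[symmetric])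
    ultimately show ?thesis by (simp add: mult.assoc[symmetric])
  qed
  have test: "(\<lambda>n. pairing (ds n) (mderiv l \<psi>)) \<longlonglongrightarrow> 0" if \<psi>: "\<psi> \<in> test_functions" for \<psi>
  proof -
    obtain K where K: "cont_derivs l \<psi>" "compact K" "\<And>x. x \<notin> K \<Longrightarrow> \<psi> x = 0"
      by (rule test_functionE[OF \<psi>, of l]) blast
    \<comment> \<open>The decisive substitution: \<open>inverse (\<phi> y) * \<psi> y\<close> is
      compactly supported and of class C^l, and multiplying it by \<open>\<phi>\<close> gives back
      \<open>\<psi>\<close>.\<close>
    have "(\<lambda>n. pairing (ds n) (mderiv l (\<lambda>y. \<phi> y * (inverse (\<phi> y) * \<psi> y)))) \<longlonglongrightarrow> 0"
      by (rule integral_mderiv_mult_tendsto_0[OF ds_cont ds_bound _ \<phi> product_test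
            cont_derivs_mult[OF cont_derivs_inverse[OF \<phi> nz] K(1)] K(2)])
        (intro continuous_intros continuous_weight, simp_all add: K(3))
    moreover have "(\<lambda>y. \<phi> y * (inverse (\<phi> y) * \<psi> y)) = \<psi>"
      using nz by (simp add: fun_eq_iff mult.assoc[symmetric])
    ultimately show ?thesis by simp
  qed
  have "(\<lambda>n. \<gamma>s n \<psi>) \<longlonglongrightarrow> \<gamma> \<psi>" if \<psi>: "\<psi> \<in> schwartz" for \<psi>
  proof -
    obtain C where C: "\<And>x. weight (Suc ?M) x * norm (mderiv l \<psi> x) \<le> C"
      using schwartz_decay[OF \<psi>] by blast
    have V: "0 \<le> V" "0 \<le> 2 * V" using \<open>V > 0\<close> by simp_all
    \<comment> \<open>For Schwartz \<open>\<psi>\<close> the integral of the difference splits only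
      because both integrals converge, which the growth bounds on \<open>cs n\<close> and
      \<open>c\<close> ensure.\<close>
    have eq: "\<gamma>s n \<psi> = \<gamma> \<psi> + (- 1) ^ mdegree l * (pairing (ds n) (mderiv l \<psi>))" for n
      using integrable_weight_mderiv[OF cs(2,3) \<psi> C V(1), of n] integrable_weight_mderiv[OF c(2,3) \<psi> C V(1)]
      by (simp add: cs(4)[OF \<psi>] c(4)[OF \<psi>] gderiv_def ds_def left_diff_distrib right_diff_distrib)
    have "(\<lambda>n. \<gamma> \<psi> + (- 1) ^ mdegree l * (pairing (ds n) (mderiv l \<psi>))) \<longlonglongrightarrow>
        \<gamma> \<psi> + (- 1) ^ mdegree l * 0"
      by (intro tendsto_intros integral_mderiv_schwartz_tendsto_0[OF ds_cont ds_bound V(2) test \<psi>])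
    then show ?thesis by (simp add: eq)
  qed
  then have "tempered_tendsto \<gamma>s \<gamma>" using c(1) cs(1) by (simp add: tempered_tendsto_def)
  then have "tempered_tendsto (\<lambda>n. Ft_inv (\<gamma>s n)) (Ft_inv \<gamma>)" by (rule tempered_tendsto_Ft_inv)
  moreover have "product_of l (\<epsilon>s n) (\<lambda>x. inverse (\<phi> x)) = \<gamma>s n" for n
    by (rule product_of_eqI[OF inverse_product])
  ultimately show ?thesis
    using inverse_product \<open>g = _\<close> by (auto simp: product_exists_def)
qed

end
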